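(* Let $X\in\mathrm{Alex}(k)$, and let $F$ be the fixed point set of an isometry of $X$ onto itself. Then $F$ is quasi-convex in $X$.
   Context: $\mathrm{Alex}(k)$ is the set of complete, finite-dimensional Alexandrov spaces with curvature $\geqslant k$ ($k\in\mathbb R$). $\Sigma_pX$ is the space of directions of $X$ at $p$. For $q\ne p$, $\uparrow_p^q$ is the direction at $p$ of a given minimal geodesic $[pq]$, and $\Uparrow_p^q\subseteq\Sigma_pX$ is the closed set of directions at $p$ of all minimal geodesics from $p$ to $q$. For subsets $A,B\subseteq\Sigma_pX$, $|AB|$ is the distance between them (infimum of distances). Quasi-convex: a closed subset $F\subseteq X$ is quasi-convex in $X$ if whenever $q\in X\setminus F$ and the distance function $\mathrm{dist}_q|_F$ attains its minimum at $p\in F$, then $|\Uparrow_p^q\Uparrow_p^r|\leqslant\frac{\pi}{2}$ for all $r\in F\setminus\{p\}$ (because $q$ is arbitrary, this is equivalent to $|\uparrow_p^q\Uparrow_p^r|\leqslant\frac{\pi}{2}$ for every $[pq]$). By convention the empty set and single points are quasi-convex. *)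

theory Defs
  imports "HOL-Analysis.Analysis"
begin

text \<open>A metric space is a type of class \<^class>\<open>metric_space\<close>; the space \<open>X\<close> is its universe.\<close>

section \<open>Intrinsic metrics\<close>

text \<open>Supremum, over all \<open>0 \<le> t\<^sub>0 \<le> \<dots> \<le> t\<^sub>n \<le> 1\<close>, of the lengths of inscribed polygons.\<close>

definition curve_length :: "(real \<Rightarrow> 'a::metric_space) \<Rightarrow> ennreal" where
  "curve_length \<gamma> = (SUP (n, t) \<in> {(n::nat, t::nat \<Rightarrow> real). mono t \<and> range t \<subseteq> {0..1}}.
     \<Sum>i<n. ennreal (dist (\<gamma> (t i)) (\<gamma> (t (Suc i)))))"

definition intrinsic_metric :: "'a::metric_space itself \<Rightarrow> bool" where
  "intrinsic_metric _ \<longleftrightarrow> (\<forall>x y :: 'a.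
     ennreal (dist x y) =
       (INF \<gamma> \<in> {\<gamma>. path \<gamma> \<and> pathstart \<gamma> = x \<and> pathfinish \<gamma> = y}. curve_length \<gamma>))"

section \<open>Hausdorff dimension\<close>

definition hausdorff_premeasure :: "real \<Rightarrow> real \<Rightarrow> 'a::metric_space set \<Rightarrow> ennreal" where
  "hausdorff_premeasure d \<delta> S =
     (INF U \<in> {U :: nat \<Rightarrow> 'a set.
         S \<subseteq> (\<Union>i. U i) \<and> (\<forall>i. bounded (U i) \<and> diameter (U i) \<le> \<delta>)}.
       \<Sum>i. ennreal (diameter (U i) powr d))"

definition hausdorff_measure :: "real \<Rightarrow> 'a::metric_space set \<Rightarrow> ennreal" where
  "hausdorff_measure d S = (SUP \<delta> \<in> {0<..}. hausdorff_premeasure d \<delta> S)"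

text \<open>Only exponents \<open>d > 0\<close> are considered, since \<open>0 powr 0 = 0\<close> would spoil
  the case \<open>d = 0\<close>; the infimum is not affected by this.\<close>

definition hausdorff_dim :: "'a::metric_space set \<Rightarrow> ennreal" where
  "hausdorff_dim S = (INF d \<in> {d::real. d > 0 \<and> hausdorff_measure d S = 0}. ennreal d)"

section \<open>Lower curvature bounds\<close>

text \<open>The angle between the sides of lengths \<open>a\<close> and \<open>b\<close> in the triangle with side lengths
  \<open>a\<close>, \<open>b\<close>, \<open>c\<close> in the simply connected complete surface of constant curvature \<open>k\<close>,
  by the law of cosines. Meaningful if \<open>a, b > 0\<close>, the triangle inequalities hold and,
  for \<open>k > 0\<close>, the perimeter is less than \<open>2 * pi / sqrt k\<close>.\<close>

definition model_angle :: "real \<Rightarrow> real \<Rightarrow> real \<Rightarrow> real \<Rightarrow> real" where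
  "model_angle k a b c =
     (if k = 0 then arccos ((a\<^sup>2 + b\<^sup>2 - c\<^sup>2) / (2 * a * b))
      else if k > 0 then
        arccos ((cos (sqrt k * c) - cos (sqrt k * a) * cos (sqrt k * b))
                / (sin (sqrt k * a) * sin (sqrt k * b)))
      else
        arccos ((cosh (sqrt (-k) * a) * cosh (sqrt (-k) * b) - cosh (sqrt (-k) * c))
                / (sinh (sqrt (-k) * a) * sinh (sqrt (-k) * b))))"

text \<open>The comparison angle at the first point.\<close>

definition comparison_angle :: "real \<Rightarrow> 'a::metric_space \<Rightarrow> 'a \<Rightarrow> 'a \<Rightarrow> real" where
  "comparison_angle k p x y = model_angle k (dist p x) (dist p y) (dist x y)"

definition has_comparison_triangle :: "real \<Rightarrow> 'a::metric_space \<Rightarrow> 'a \<Rightarrow> 'a \<Rightarrow> bool" where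
  "has_comparison_triangle k x y z \<longleftrightarrow>
     (k > 0 \<longrightarrow> dist x y + dist y z + dist z x < 2 * pi / sqrt k)"

text \<open>The local quadruple condition of Burago, Gromov and Perelman. Their additional
  requirement on the diameter of one-dimensional spaces when \<open>k > 0\<close> is not imposed.\<close>

definition curvature_ge :: "real \<Rightarrow> 'a::metric_space itself \<Rightarrow> bool" where
  "curvature_ge k _ \<longleftrightarrow> (\<forall>x :: 'a. \<exists>U. open U \<and> x \<in> U \<and>
     (\<forall>a\<in>U. \<forall>b\<in>U. \<forall>c\<in>U. \<forall>d\<in>U. distinct [a, b, c, d] \<longrightarrow>
        has_comparison_triangle k a b c \<longrightarrow>
        has_comparison_triangle k a b d \<longrightarrow>
        has_comparison_triangle k a c d \<longrightarrow>
        comparison_angle k a b c + comparison_angle k a b d + comparison_angle k a c d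
          \<le> 2 * pi))"

definition Alex :: "real \<Rightarrow> 'a::metric_space itself \<Rightarrow> bool" where
  "Alex k X \<longleftrightarrow>
     complete (UNIV :: 'a set) \<and>
     intrinsic_metric X \<and>
     curvature_ge k X \<and>
     hausdorff_dim (UNIV :: 'a set) < \<infinity>"

section \<open>Minimal geodesics and angles\<close>

text \<open>Minimal geodesics are parametrised by arc length; only the values on
  \<open>{0..dist p q}\<close> matter.\<close>

definition minimal_geodesic :: "'a::metric_space \<Rightarrow> 'a \<Rightarrow> (real \<Rightarrow> 'a) \<Rightarrow> bool" where
  "minimal_geodesic p q \<gamma> \<longleftrightarrow>
     \<gamma> 0 = p \<and> \<gamma> (dist p q) = q \<and>
     (\<forall>s\<in>{0..dist p q}. \<forall>t\<in>{0..dist p q}. dist (\<gamma> s) (\<gamma> t) = \<bar>s - t\<bar>)"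

text \<open>The angle at the common starting point \<open>\<gamma> 0 = \<sigma> 0\<close>. In a space with curvature
  bounded below the limit exists, and it does not depend on the curvature of the model
  surface, so the Euclidean plane is used.\<close>

definition geodesic_angle :: "(real \<Rightarrow> 'a::metric_space) \<Rightarrow> (real \<Rightarrow> 'a) \<Rightarrow> real" where
  "geodesic_angle \<gamma> \<sigma> =
     Lim (at_right 0 \<times>\<^sub>F at_right 0) (\<lambda>(s, t). comparison_angle 0 (\<gamma> 0) (\<gamma> s) (\<sigma> t))"

section \<open>The space of directions\<close>

text \<open>The space of directions is the completion of the set of geodesic directions, that is,
  of nontrivial minimal geodesics from \<open>p\<close> modulo zero angle. Both the quotient and the
  completion are taken in one step: a point is a class of angle-Cauchy sequences of geodesics.\<close>

type_synonym 'a dir = "(nat \<Rightarrow> real \<Rightarrow> 'a) set"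

definition direction_sequences :: "'a::metric_space \<Rightarrow> (nat \<Rightarrow> real \<Rightarrow> 'a) set" where
  "direction_sequences p =
     {c. (\<forall>n. \<exists>q. q \<noteq> p \<and> minimal_geodesic p q (c n)) \<and>
         (\<forall>e>0. \<exists>N. \<forall>m\<ge>N. \<forall>n\<ge>N. geodesic_angle (c m) (c n) < e)}"

definition direction_rel ::
    "'a::metric_space \<Rightarrow> ((nat \<Rightarrow> real \<Rightarrow> 'a) \<times> (nat \<Rightarrow> real \<Rightarrow> 'a)) set" where
  "direction_rel p =
     {(c, d). c \<in> direction_sequences p \<and> d \<in> direction_sequences p \<and>
              (\<lambda>n. geodesic_angle (c n) (d n)) \<longlonglongrightarrow> 0}"

definition space_of_directions :: "'a::metric_space \<Rightarrow> 'a dir set" where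
  "space_of_directions p = direction_sequences p // direction_rel p"

definition direction_dist :: "'a::metric_space dir \<Rightarrow> 'a dir \<Rightarrow> real" where
  "direction_dist \<xi> \<eta> =
     (THE l. \<forall>c\<in>\<xi>. \<forall>d\<in>\<eta>. (\<lambda>n. geodesic_angle (c n) (d n)) \<longlonglongrightarrow> l)"

definition direction :: "'a::metric_space \<Rightarrow> (real \<Rightarrow> 'a) \<Rightarrow> 'a dir" where
  "direction p \<gamma> = direction_rel p `` {\<lambda>_. \<gamma>}"

definition directions_to :: "'a::metric_space \<Rightarrow> 'a \<Rightarrow> 'a dir set" where
  "directions_to p q =
     {\<xi> \<in> space_of_directions p. \<exists>\<gamma>. minimal_geodesic p q \<gamma> \<and> \<xi> = direction p \<gamma>}"

text \<open>Extended real values, so that the infimum over the empty set is \<open>\<infinity>\<close>.\<close>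

definition direction_setdist :: "'a::metric_space dir set \<Rightarrow> 'a dir set \<Rightarrow> ereal" where
  "direction_setdist A B = (INF \<xi>\<in>A. INF \<eta>\<in>B. ereal (direction_dist \<xi> \<eta>))"

section \<open>Quasi-convex subsets\<close>

text \<open>The empty set and singletons satisfy the condition vacuously.\<close>

definition quasi_convex :: "'a::metric_space set \<Rightarrow> bool" where
  "quasi_convex F \<longleftrightarrow> closed F \<and>
     (\<forall>q. q \<notin> F \<longrightarrow> (\<forall>p\<in>F. (\<forall>x\<in>F. dist q p \<le> dist q x) \<longrightarrow>
        (\<forall>r\<in>F - {p}. direction_setdist (directions_to p q) (directions_to p r) \<le> pi / 2)))"

end

theory Submission
  imports Defs
begin

text \<open>Finite Hausdorff dimension forces local compactness: if some ball were not totally bounded,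
  contractions along almost geodesics, which by the curvature bound shrink distances by no more than a
  constant multiple of their ratio, would carry arbitrarily large separated sets into every small ball,
  and the space would contain Cantor sets of arbitrarily large dimension. Hence closed balls are compact and minimal geodesics exist.

  Let \<open>p\<close> be the point of the fixed point set \<open>F\<close> nearest to \<open>q\<close>, and suppose that every direction
  from \<open>p\<close> to \<open>r \<in> F\<close> makes an angle greater than \<open>pi / 2\<close> with the direction \<open>\<gamma>\<close> of a geodesic to \<open>q\<close>.
  By first variation the derivative of \<open>dist r\<close> along \<open>\<gamma>\<close> is positive, so the gradient of the
  semiconcave function \<open>dist r\<close> makes an acute angle with \<open>\<gamma>\<close>. As \<open>dist r\<close> is invariant under the
  isometry, its gradient flow preserves \<open>F\<close>, and it moves \<open>p\<close> closer to \<open>q\<close>, a contradiction.\<close>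
section \<open>Comparison of model angles\<close>

text \<open>The curvature bound is local, and at first neither geodesics nor compact balls are
  available. It is relaxed to a hyperbolic bound and used in two forms: a Stewart inequality for
  points only almost on a segment, which serves the contractions, and, once geodesics exist, a
  Euclidean Stewart inequality whose relative error is of second order. Angles, first variation and
  semiconcavity come from the second form, because its error disappears under rescaling at a point.

  The gradient need not be the direction of a geodesic, and its flow is not constructed. Geodesics
  nearly realising the maximal slope replace the one, a minimum problem penalised by
  \<open>M * l\<^sup>2\<close> with \<open>l = dist x (g x)\<close> the other. What makes this work
  is that a step enlarges \<open>l\<close> at a rate proportional to \<open>l\<close>, up to an
  arbitrarily small error: the penalty then grows at a rate of order \<open>M * l\<^sup>2\<close>,
  which minimality bounds independently of \<open>M\<close>. All this happens near \<open>p\<close>,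
  where \<open>dist r\<close> is semiconcave, with \<open>\<gamma> s\<close> in place of
  \<open>q\<close>; by the triangle inequality a fixed point closer than \<open>s\<close> to
  \<open>\<gamma> s\<close> is closer to \<open>q\<close> than \<open>p\<close> is.\<close>

text \<open>Law of cosines in curvature \<open>- k\<^sup>2\<close>: unlike in
  \<open>model_angle\<close>, \<open>k\<close> is an inverse length, not a curvature.\<close>

definition hcos :: "real \<Rightarrow> real \<Rightarrow> real \<Rightarrow> real \<Rightarrow> real" where
  "hcos k a b c = (cosh (k * a) * cosh (k * b) - cosh (k * c)) / (sinh (k * a) * sinh (k * b))"

definition ecos :: "real \<Rightarrow> real \<Rightarrow> real \<Rightarrow> real" where
  "ecos a b c = (a\<^sup>2 + b\<^sup>2 - c\<^sup>2) / (2 * a * b)"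

section \<open>Ratio inequalities and half-angle formulas\<close>

lemma le_of_deriv_nonneg_from_0:
  fixes f f' :: "real \<Rightarrow> real"
  assumes "\<And>u. 0 \<le> u \<Longrightarrow> u \<le> x \<Longrightarrow> (f has_real_derivative f' u) (at u)"
    and "\<And>u. 0 \<le> u \<Longrightarrow> u \<le> x \<Longrightarrow> 0 \<le> f' u" and "0 \<le> x"
  shows "f 0 \<le> f x"
  by (rule DERIV_nonneg_imp_nondecreasing[OF assms(3)]) (use assms in blast)

lemma sinh_le_mult_cosh:
  fixes x :: real assumes "0 \<le> x" shows "sinh x \<le> x * cosh x"
proof -
  have "0 * cosh 0 - sinh 0 \<le> x * cosh x - sinh x"
    by (rule le_of_deriv_nonneg_from_0[where f = "\<lambda>x. x * cosh x - sinh x" and f' = "\<lambda>x. x * sinh x"])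
      (use assms in \<open>auto intro!: derivative_eq_intros\<close>)
  then show ?thesis by simp
qed

lemma sinh_ge_self:
  fixes x :: real assumes "0 \<le> x" shows "x \<le> sinh x"
proof -
  have "sinh 0 - 0 \<le> sinh x - x"
    by (rule le_of_deriv_nonneg_from_0[where f = "\<lambda>x. sinh x - x" and f' = "\<lambda>x. cosh x - 1"])
      (use assms in \<open>auto intro!: derivative_eq_intros simp: cosh_real_ge_1\<close>)
  then show ?thesis by simp
qed

lemma sinh_ratio_mono:
  fixes x y :: real assumes "0 \<le> x" "x \<le> y" shows "sinh x * y \<le> sinh y * x"
proof (cases "x = 0")
  case False
  have "sinh x / x \<le> sinh y / y"
  proof (rule DERIV_nonneg_imp_nondecreasing[OF assms(2)], intro exI conjI)
    fix u assume u: "x \<le> u" "u \<le> y"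
    then have "u > 0" using False assms by simp
    then show "((\<lambda>x. sinh x / x) has_real_derivative (cosh u * u - sinh u) / (u * u)) (at u)"
      by (auto intro!: derivative_eq_intros)
    show "0 \<le> (cosh u * u - sinh u) / (u * u)"
      using sinh_le_mult_cosh[of u] \<open>u > 0\<close> by (simp add: mult.commute)
  qed
  then show ?thesis using False assms by (simp add: field_simps)
qed simp

lemma sin_ratio_antimono:
  fixes x y :: real assumes "0 \<le> x" "x \<le> y" "y \<le> pi" shows "sin y * x \<le> sin x * y"
proof (cases "x = 0")
  case False
  have "sin y / y \<le> sin x / x"
  proof (rule DERIV_nonpos_imp_nonincreasing[OF assms(2)], intro exI conjI)
    fix u assume u: "x \<le> u" "u \<le> y"
    then have "u > 0" using False assms by simp
    then show "((\<lambda>x. sin x / x) has_real_derivative (cos u * u - sin u) / (u * u)) (at u)"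
      by (auto intro!: derivative_eq_intros)
    have "sin 0 - 0 * cos 0 \<le> sin u - u * cos u"
      by (rule le_of_deriv_nonneg_from_0[where f' = "\<lambda>x. x * sin x"])
        (use \<open>u > 0\<close> u assms in \<open>auto intro!: derivative_eq_intros mult_nonneg_nonneg sin_ge_zero\<close>)
    then show "(cos u * u - sin u) / (u * u) \<le> 0"
      using \<open>u > 0\<close> by (simp add: mult.commute divide_nonpos_pos)
  qed
  then show ?thesis using False assms by (simp add: field_simps)
qed simp

lemma cosh_diff_eq:
  fixes x y :: real
  shows "cosh x - cosh y = 2 * sinh ((x + y) / 2) * sinh ((x - y) / 2)"
proof -
  have "cosh x = cosh ((x+y)/2 + (x-y)/2)" "cosh y = cosh ((x+y)/2 - (x-y)/2)"
    by (auto intro!: arg_cong[where f = cosh] simp: field_simps)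
  then show ?thesis by (simp add: cosh_add cosh_diff)
qed

lemma one_minus_ecos: "a > 0 \<Longrightarrow> b > 0 \<Longrightarrow> 1 - ecos a b c = (c\<^sup>2 - (a - b)\<^sup>2) / (2 * a * b)"
  unfolding ecos_def by (simp add: field_simps power2_eq_square)

lemma one_plus_ecos: "a > 0 \<Longrightarrow> b > 0 \<Longrightarrow> 1 + ecos a b c = ((a + b)\<^sup>2 - c\<^sup>2) / (2 * a * b)"
  unfolding ecos_def by (simp add: field_simps power2_eq_square)

lemma ecos_bounds:
  assumes "a > 0" "b > 0" "\<bar>a - b\<bar> \<le> c" "c \<le> a + b"
  shows "-1 \<le> ecos a b c" "ecos a b c \<le> 1"
proof -
  have "(a - b)\<^sup>2 \<le> c\<^sup>2" using assms(3) by (metis abs_le_square_iff abs_ge_self order_trans)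
  moreover have "c\<^sup>2 \<le> (a + b)\<^sup>2" using assms by (intro power_mono) auto
  ultimately have "0 \<le> 1 - ecos a b c" "0 \<le> 1 + ecos a b c"
    using assms by (simp_all add: one_minus_ecos one_plus_ecos)
  then show "-1 \<le> ecos a b c" "ecos a b c \<le> 1" by auto
qed

text \<open>Half-angle form: once factored, each factor can be compared with one side by
  monotonicity of \<open>sinh x / x\<close>.\<close>

lemma one_minus_hcos:
  assumes "a > 0" "b > 0"
  shows "1 - hcos 1 a b c = 2 * sinh ((c + a - b) / 2) * sinh ((c - a + b) / 2) / (sinh a * sinh b)"
proof -
  have "1 - hcos 1 a b c = (cosh c - cosh (a - b)) / (sinh a * sinh b)"
    using assms by (simp add: hcos_def cosh_diff field_simps)
  then show ?thesis by (simp add: cosh_diff_eq[of c "a - b"] algebra_simps)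
qed

lemma one_plus_hcos:
  assumes "a > 0" "b > 0"
  shows "1 + hcos 1 a b c = 2 * sinh ((a + b + c) / 2) * sinh ((a + b - c) / 2) / (sinh a * sinh b)"
proof -
  have "1 + hcos 1 a b c = (cosh (a + b) - cosh c) / (sinh a * sinh b)"
    using assms by (simp add: hcos_def cosh_add field_simps)
  then show ?thesis by (simp add: cosh_diff_eq[of "a + b" c])
qed

lemma hcos_scale: "hcos k a b c = hcos 1 (k * a) (k * b) (k * c)"
  by (simp add: hcos_def)

lemma ecos_scale: "k \<noteq> 0 \<Longrightarrow> ecos (k * a) (k * b) (k * c) = ecos a b c"
proof -
  assume "k \<noteq> 0"
  have "ecos (k * a) (k * b) (k * c) = (k\<^sup>2 * (a\<^sup>2 + b\<^sup>2 - c\<^sup>2)) / (k\<^sup>2 * (2 * a * b))"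
    by (simp add: ecos_def power2_eq_square algebra_simps)
  also have "\<dots> = ecos a b c" using \<open>k \<noteq> 0\<close> by (simp add: ecos_def)
  finally show ?thesis .
qed

text \<open>The half-angle forms are compared factor by factor: the triangle inequalities give
  \<open>P \<le> a\<close> and \<open>Q \<le> b\<close>, so
  \<open>sinh P / sinh a \<le> P / a\<close>, and likewise for \<open>Q\<close> and
  \<open>b\<close>.\<close>

lemma ecos_le_hcos_1:
  assumes "a > 0" "b > 0" "\<bar>a - b\<bar> \<le> c" "c \<le> a + b"
  shows "ecos a b c \<le> hcos 1 a b c"
proof -
  define P where "P = (c + a - b) / 2"
  define Q where "Q = (c - a + b) / 2"
  have PQ: "0 \<le> P" "P \<le> a" "0 \<le> Q" "Q \<le> b" using assms by (auto simp: P_def Q_def)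
  have "sinh P / sinh a \<le> P / a" "sinh Q / sinh b \<le> Q / b"
    using PQ sinh_ratio_mono[of P a] sinh_ratio_mono[of Q b] assms by (simp_all add: field_simps)
  then have "(sinh P / sinh a) * (sinh Q / sinh b) \<le> (P / a) * (Q / b)"
    using PQ assms by (intro mult_mono) auto
  then have "2 * sinh P * sinh Q / (sinh a * sinh b) \<le> 2 * P * Q / (a * b)"
    by simp
  also have "2 * P * Q / (a * b) = 1 - ecos a b c"
    using assms by (simp add: one_minus_ecos P_def Q_def field_simps power2_eq_square)
  finally show ?thesis using one_minus_hcos[OF assms(1,2), of c] by (simp add: P_def Q_def)
qed

lemma hcos_bounds_1:
  assumes "a > 0" "b > 0" "\<bar>a - b\<bar> \<le> c" "c \<le> a + b"
  shows "-1 \<le> hcos 1 a b c" "hcos 1 a b c \<le> 1"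
proof -
  have "0 \<le> 1 - hcos 1 a b c" using assms one_minus_hcos[OF assms(1,2), of c] by simp
  then show "hcos 1 a b c \<le> 1" by simp
  show "-1 \<le> hcos 1 a b c" using ecos_bounds[OF assms] ecos_le_hcos_1[OF assms] by linarith
qed

lemma cosh_le_1_plus:
  fixes x :: real assumes "0 \<le> x" "x \<le> 1" shows "cosh x \<le> 1 + x\<^sup>2" "cosh x \<le> 2"
proof -
  have "sinh u \<le> 2 * u" if "0 \<le> u" "u \<le> 1" for u :: real
  proof -
    have "cosh u \<le> cosh 1" using that by (simp add: cosh_real_nonneg_le_iff)
    also have "cosh 1 \<le> (2::real)"
    proof -
      have "exp (1::real) \<le> 3" by (rule exp_le)
      moreover have "exp (-1::real) \<le> 1" by simp
      moreover have "cosh (1::real) = (exp 1 + exp (-1)) / 2" by (simp add: cosh_def)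
      moreover have "(exp 1 + exp (-1)) / 2 \<le> (3 + 1) / (2::real)"
        using calculation(1,2) by (intro divide_right_mono add_mono) auto
      ultimately show ?thesis by simp
    qed
    finally show ?thesis using sinh_le_mult_cosh[of u] that mult_left_mono[of "cosh u" 2 u] by linarith
  qed
  note sinh_le = this
  have "1 + 0\<^sup>2 - cosh 0 \<le> 1 + x\<^sup>2 - cosh x"
    by (rule le_of_deriv_nonneg_from_0[where f = "\<lambda>x. 1 + x\<^sup>2 - cosh x" and f' = "\<lambda>x. 2 * x - sinh x"])
      (use assms sinh_le in \<open>auto intro!: derivative_eq_intros\<close>)
  then show "cosh x \<le> 1 + x\<^sup>2" by simp
  also have "\<dots> \<le> 2" using assms by (simp add: power_le_one)
  finally show "cosh x \<le> 2" .
qed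

text \<open>\<open>sinh x / x\<close> is about \<open>1 + x\<^sup>2 / 6\<close>, and
  \<open>(a + b)\<^sup>2 - a\<^sup>2 \<le> 3 * (a * b)\<close> because \<open>b \<le> a\<close>: the
  relative increase is of order \<open>a * b\<close>, not merely \<open>a\<^sup>2\<close>. The
  constant 3 is generous.\<close>

lemma sinh_add_ratio_bound:
  fixes a b :: real
  assumes "0 < b" "b \<le> a" "a \<le> 1"
  shows "sinh (a + b) * a \<le> (1 + 3 * (a * b)) * ((a + b) * sinh a)"
proof -
  have ca: "cosh a \<le> 1 + a\<^sup>2" and cb: "cosh b \<le> 1 + b\<^sup>2"
    using assms by (auto intro!: cosh_le_1_plus)
  have sa: "a \<le> sinh a" using assms by (intro sinh_ge_self) auto
  have sb: "sinh b \<le> b * (1 + b\<^sup>2)"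
    using sinh_le_mult_cosh[of b] mult_left_mono[OF cb, of b] assms by linarith
  have "a * cosh a \<le> a * (1 + a\<^sup>2)" using ca assms by simp
  also have "\<dots> \<le> sinh a * (1 + a\<^sup>2)" using sa by (intro mult_right_mono) auto
  finally have "(a * cosh a) * sinh b \<le> (sinh a * (1 + a\<^sup>2)) * (b * (1 + b\<^sup>2))"
    using sb assms by (rule_tac mult_mono) auto
  moreover have "a * sinh a * cosh b \<le> a * sinh a * (1 + b\<^sup>2)"
    using cb assms by (intro mult_left_mono) auto
  ultimately have "sinh (a + b) * a \<le> sinh a * (a * (1 + b\<^sup>2) + (1 + a\<^sup>2) * (b * (1 + b\<^sup>2)))"
    by (simp add: sinh_add algebra_simps)
  also have "\<dots> \<le> sinh a * ((1 + 3 * (a * b)) * (a + b))"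
  proof (rule mult_left_mono)
    have "b * b * b \<le> a * b * b" using assms by (intro mult_mono) auto
    moreover have "a * a * b * b * b \<le> 1 * (a * a * b)"
    proof -
      have "b * b \<le> 1 * 1" using assms by (intro mult_mono) auto
      then have "a * a * b * (b * b) \<le> a * a * b * 1" using assms by (intro mult_left_mono) auto
      then show ?thesis by (simp add: mult_ac)
    qed
    moreover have "0 \<le> a * b * b" "0 \<le> a * a * b" using assms by auto
    ultimately show "a * (1 + b\<^sup>2) + (1 + a\<^sup>2) * (b * (1 + b\<^sup>2)) \<le> (1 + 3 * (a * b)) * (a + b)"
      by (simp add: algebra_simps power2_eq_square)
    show "0 \<le> sinh a" using assms by simp
  qed
  finally show ?thesis by (simp add: mult_ac)
qed

text \<open>\<open>P\<close> may exceed \<open>a\<close>, so monotonicity is used up to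
  \<open>a + b\<close>, and returning from there to \<open>a\<close> costs the factor
  \<open>1 + 3 * (a * b)\<close>. An error proportional to both sides is what later gives the
  Stewart error its factor \<open>dist y m * dist m z\<close>.\<close>

lemma hcos_le_ecos_1_aux:
  assumes "0 < b" "b \<le> a" "a \<le> 1" "\<bar>a - b\<bar> \<le> c" "c \<le> a + b"
  shows "1 + hcos 1 a b c \<le> (1 + ecos a b c) * (1 + 3 * (a * b))"
proof -
  define P where "P = (a + b + c) / 2"
  define Q where "Q = (a + b - c) / 2"
  have PQ: "0 \<le> P" "P \<le> a + b" "0 \<le> Q" "Q \<le> b" using assms by (auto simp: P_def Q_def)
  have pos: "0 < a" "0 < sinh a" "0 < sinh b" using assms by auto
  have "sinh P \<le> sinh (a + b) * P / (a + b)"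
    using sinh_ratio_mono[of P "a + b"] PQ assms by (simp add: field_simps)
  also have "\<dots> = (sinh (a + b) * a) * (P / ((a + b) * a))" using pos by simp
  also have "\<dots> \<le> ((1 + 3 * (a * b)) * ((a + b) * sinh a)) * (P / ((a + b) * a))"
    using PQ pos assms by (intro mult_right_mono sinh_add_ratio_bound) auto
  also have "\<dots> = ((1 + 3 * (a * b)) * (P / a)) * sinh a"
  proof -
    have "a + b \<noteq> 0" using pos assms by simp
    then show ?thesis using pos by (simp add: divide_simps)
  qed
  finally have 1: "sinh P / sinh a \<le> (1 + 3 * (a * b)) * (P / a)"
    using pos by (simp add: pos_divide_le_eq)
  have 2: "sinh Q / sinh b \<le> Q / b"
    using sinh_ratio_mono[of Q b] PQ assms by (simp add: field_simps)
  have "(sinh P / sinh a) * (sinh Q / sinh b) \<le> ((1 + 3 * (a * b)) * (P / a)) * (Q / b)"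
    using PQ pos assms by (intro mult_mono 1 2) auto
  moreover have "1 + hcos 1 a b c = 2 * ((sinh P / sinh a) * (sinh Q / sinh b))"
    using one_plus_hcos[of a b c] pos assms by (simp add: P_def Q_def)
  moreover have "2 * (((1 + 3 * (a * b)) * (P / a)) * (Q / b)) = 2 * P * Q / (a * b) * (1 + 3 * (a * b))"
    by (simp add: mult_ac)
  ultimately have "1 + hcos 1 a b c \<le> 2 * P * Q / (a * b) * (1 + 3 * (a * b))"
    by linarith
  also have "2 * P * Q / (a * b) = 1 + ecos a b c"
    using pos assms by (simp add: one_plus_ecos P_def Q_def field_simps power2_eq_square)
  finally show ?thesis .
qed

lemma hcos_le_ecos_1:
  assumes "0 < a" "0 < b" "a \<le> 1" "b \<le> 1" "\<bar>a - b\<bar> \<le> c" "c \<le> a + b"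
  shows "1 + hcos 1 a b c \<le> (1 + ecos a b c) * (1 + 3 * (a * b))"
proof (cases "b \<le> a")
  case True
  then show ?thesis using hcos_le_ecos_1_aux assms by blast
next
  case False
  have "hcos 1 a b c = hcos 1 b a c" "ecos a b c = ecos b a c"
    by (simp_all add: hcos_def ecos_def mult_ac add_ac)
  moreover have "1 + hcos 1 b a c \<le> (1 + ecos b a c) * (1 + 3 * (b * a))"
    using False assms by (intro hcos_le_ecos_1_aux) auto
  ultimately show ?thesis by (simp add: mult.commute)
qed

lemma hcos_facts:
  assumes "k > 0" "a > 0" "b > 0" "\<bar>a - b\<bar> \<le> c" "c \<le> a + b"
  shows "-1 \<le> hcos k a b c" "hcos k a b c \<le> 1" "ecos a b c \<le> hcos k a b c"
    and "k * a \<le> 1 \<Longrightarrow> k * b \<le> 1 \<Longrightarrow> 1 + hcos k a b c \<le> (1 + ecos a b c) * (1 + 3 * k\<^sup>2 * (a * b))"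
proof -
  have *: "0 < k * a" "0 < k * b" "\<bar>k * a - k * b\<bar> \<le> k * c" "k * c \<le> k * a + k * b"
    using assms by (auto simp: abs_mult simp flip: right_diff_distrib distrib_left)
  show "-1 \<le> hcos k a b c" "hcos k a b c \<le> 1"
    using hcos_bounds_1[OF *] by (simp_all add: hcos_scale[of k])
  show "ecos a b c \<le> hcos k a b c"
    using ecos_le_hcos_1[OF *] assms(1) by (simp add: hcos_scale[of k] ecos_scale)
  show "1 + hcos k a b c \<le> (1 + ecos a b c) * (1 + 3 * k\<^sup>2 * (a * b))" if "k * a \<le> 1" "k * b \<le> 1"
  proof -
    have "1 + hcos k a b c \<le> (1 + ecos a b c) * (1 + 3 * ((k * a) * (k * b)))"
      using hcos_le_ecos_1[OF *(1,2) that *(3,4)] assms(1) by (simp only: hcos_scale[of k] ecos_scale)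
    also have "3 * ((k * a) * (k * b)) = 3 * k\<^sup>2 * (a * b)" by (simp add: power2_eq_square)
    finally show ?thesis .
  qed
qed

section \<open>Relaxing the curvature bound to a hyperbolic one\<close>

definition hangle :: "real \<Rightarrow> real \<Rightarrow> real \<Rightarrow> real \<Rightarrow> real" where
  "hangle k a b c = arccos (hcos k a b c)"

lemma hangle_le_arccos_ecos:
  assumes "k > 0" "a > 0" "b > 0" "\<bar>a - b\<bar> \<le> c" "c \<le> a + b"
  shows "hangle k a b c \<le> arccos (ecos a b c)"
  unfolding hangle_def using hcos_facts[OF assms] ecos_bounds[OF assms(2-)]
  by (intro arccos_le_arccos) auto

text \<open>The same comparison of factors, now with \<open>sin x / x\<close> decreasing up to
  \<open>pi\<close>; the bound on \<open>a + b\<close> keeps all arguments in that range.\<close>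

lemma arccos_ecos_le_model_angle_pos:
  assumes "k > 0" "a > 0" "b > 0" "\<bar>a - b\<bar> \<le> c" "c \<le> a + b" "sqrt k * (a + b) < pi"
  shows "arccos (ecos a b c) \<le> model_angle k a b c"
proof -
  define s where "s = sqrt k"
  have s: "s > 0" using assms by (simp add: s_def)
  define P where "P = s * (c + a - b) / 2"
  define Q where "Q = s * (c - a + b) / 2"
  have le: "s * (c + a - b) \<le> s * (2 * a)" "s * (c - a + b) \<le> s * (2 * b)"
    using assms s by (auto intro!: mult_left_mono)
  have ab: "0 < s * a" "0 < s * b" "s * a + s * b < pi"
    using assms s by (auto simp: s_def distrib_left)
  have PQ: "0 \<le> P" "P \<le> s * a" "0 \<le> Q" "Q \<le> s * b" "s * a < pi" "s * b < pi"
    using assms s le ab by (auto simp: P_def Q_def simp del: mult_pos_pos)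
  define v where "v = (cos (s * c) - cos (s * a) * cos (s * b)) / (sin (s * a) * sin (s * b))"
  have pos: "0 < sin (s * a)" "0 < sin (s * b)" using ab by (auto intro!: sin_gt_zero)
  have "1 - v = (cos (s * a - s * b) - cos (s * c)) / (sin (s * a) * sin (s * b))"
    using pos by (simp add: v_def cos_diff field_simps)
  also have "cos (s * a - s * b) - cos (s * c) = 2 * sin P * sin Q"
    by (simp add: cos_diff_cos P_def Q_def algebra_simps)
  finally have v1: "1 - v = 2 * ((sin P / sin (s * a)) * (sin Q / sin (s * b)))" by simp
  have "P / (s * a) \<le> sin P / sin (s * a)" "Q / (s * b) \<le> sin Q / sin (s * b)"
    using PQ pos ab sin_ratio_antimono[of P "s * a"] sin_ratio_antimono[of Q "s * b"]
    by (simp_all add: field_simps)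
  then have "(P / (s * a)) * (Q / (s * b)) \<le> (sin P / sin (s * a)) * (sin Q / sin (s * b))"
    using PQ pos ab by (intro mult_mono) (auto intro!: divide_nonneg_pos sin_ge_zero)
  moreover have "2 * ((P / (s * a)) * (Q / (s * b))) = 1 - ecos a b c"
    using assms s by (simp add: one_minus_ecos P_def Q_def field_simps power2_eq_square)
  ultimately have "v \<le> ecos a b c" using v1 by linarith
  moreover have "-1 \<le> v"
  proof -
    have "cos (s * a + s * b) \<le> cos (s * c)"
      using assms ab s by (intro cos_monotone_0_pi_le) (auto simp flip: distrib_left)
    then show ?thesis using pos by (simp add: v_def cos_add field_simps)
  qed
  moreover have "model_angle k a b c = arccos v"
    using assms by (simp add: model_angle_def v_def s_def)
  ultimately show ?thesis using ecos_bounds[OF assms(2-5)] by (auto intro!: arccos_le_arccos)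
qed

text \<open>Smaller model curvature means smaller angles, so an upper bound on angle sums survives
  the passage to negative curvature. For \<open>k \<ge> 0\<close> the scale 1 is an arbitrary
  choice.\<close>

lemma hangle_le_model_angle:
  obtains \<kappa> r where "\<kappa> > 0" "r > 0"
    "\<And>a b c. 0 < a \<Longrightarrow> 0 < b \<Longrightarrow> a \<le> r \<Longrightarrow> b \<le> r \<Longrightarrow> \<bar>a - b\<bar> \<le> c \<Longrightarrow> c \<le> a + b \<Longrightarrow>
        hangle \<kappa> a b c \<le> model_angle k a b c"
proof -
  consider "k < 0" | "k = 0" | "k > 0" by linarith
  then show thesis
  proof cases
    case 1
    show thesis
      by (rule that[of "sqrt (- k)" 1]) (use 1 in \<open>auto simp: model_angle_def hangle_def hcos_def\<close>)
  next
    case 2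
    show thesis
      by (rule that[of 1 1])
        (use 2 hangle_le_arccos_ecos[of 1] in \<open>auto simp: model_angle_def ecos_def\<close>)
  next
    case 3
    have *: "hangle 1 a b c \<le> model_angle k a b c"
      if "0 < a" "0 < b" "a \<le> 1 / sqrt k" "b \<le> 1 / sqrt k" "\<bar>a - b\<bar> \<le> c" "c \<le> a + b" for a b c
    proof -
      have "sqrt k * a \<le> 1" "sqrt k * b \<le> 1"
        using that 3 by (auto simp: field_simps)
      then have "sqrt k * (a + b) < pi" using pi_gt3 by (simp add: distrib_left)
      then show ?thesis
        using that 3 hangle_le_arccos_ecos[of 1 a b c] arccos_ecos_le_model_angle_pos[of k a b c] by auto
    qed
    show thesis
      by (rule that[of 1 "1 / sqrt k"]) (use 3 * in auto)
  qed
qed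

text \<open>Hyperbolic comparison triangles exist for every perimeter, hence no clause like
  \<open>has_comparison_triangle\<close>.\<close>

definition quad_cond :: "real \<Rightarrow> 'a::metric_space set \<Rightarrow> bool" where
  "quad_cond k U \<longleftrightarrow> (\<forall>a\<in>U. \<forall>b\<in>U. \<forall>c\<in>U. \<forall>d\<in>U. distinct [a, b, c, d] \<longrightarrow>
     hangle k (dist a b) (dist a c) (dist b c) + hangle k (dist a b) (dist a d) (dist b d)
       + hangle k (dist a c) (dist a d) (dist c d) \<le> 2 * pi)"

lemma abs_dist_diff: "\<bar>dist a b - dist a c\<bar> \<le> dist b c"
  by (smt (verit) dist_commute dist_triangle)

lemma dist_triangle_base: "dist b c \<le> dist a b + dist a c"
  by (metis dist_commute dist_triangle)

text \<open>The scale \<open>\<kappa>\<close> is common to all points and only the radius varies, so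
  that one constant later serves the whole space. The clause
  \<open>\<kappa> * (2 * r) \<le> 1\<close> puts all distances in the ball into the range where
  \<open>cosh\<close> has a quadratic upper bound.\<close>

lemma curvature_ge_quad_cond:
  assumes "curvature_ge k TYPE('a::metric_space)"
  obtains \<kappa> where "\<kappa> > 0"
    "\<And>p::'a. \<exists>r>0. \<kappa> * (2 * r) \<le> 1 \<and> quad_cond \<kappa> (ball p r)"
proof -
  obtain \<kappa> R where kR: "\<kappa> > 0" "R > 0"
    "\<And>a b c. 0 < a \<Longrightarrow> 0 < b \<Longrightarrow> a \<le> R \<Longrightarrow> b \<le> R \<Longrightarrow> \<bar>a - b\<bar> \<le> c \<Longrightarrow> c \<le> a + b \<Longrightarrow>
        hangle \<kappa> a b c \<le> model_angle k a b c"
    using hangle_le_model_angle by blast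
  show thesis
  proof (rule that[OF kR(1)])
    fix p :: 'a
    obtain U where U: "open U" "p \<in> U" and
      cmp: "\<And>a b c d. a \<in> U \<Longrightarrow> b \<in> U \<Longrightarrow> c \<in> U \<Longrightarrow> d \<in> U \<Longrightarrow> distinct [a, b, c, d] \<Longrightarrow>
        has_comparison_triangle k a b c \<Longrightarrow> has_comparison_triangle k a b d \<Longrightarrow>
        has_comparison_triangle k a c d \<Longrightarrow>
        comparison_angle k a b c + comparison_angle k a b d + comparison_angle k a c d \<le> 2 * pi"
      using assms unfolding curvature_ge_def by metis
    obtain r0 where r0: "r0 > 0" "ball p r0 \<subseteq> U" using U by (meson open_contains_ball)
    \<comment> \<open>In order: stay inside \<open>U\<close>; scaled distances at most 1; sides,
      which are below \<open>2 * r\<close>, at most \<open>R\<close>; perimeters below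
      \<open>6 * r \<le> 3 / sqrt k\<close>.\<close>
    define r where "r = Min {r0, 1 / (2 * \<kappa>), R / 2, if k > 0 then 1 / (2 * sqrt k) else 1}"
    have r: "r > 0" "r \<le> r0" "r \<le> 1 / (2 * \<kappa>)" "r \<le> R / 2" "k > 0 \<Longrightarrow> r \<le> 1 / (2 * sqrt k)"
      using r0 kR by (auto simp: r_def min_le_iff_disj)
    have small: "dist a b < 2 * r" if "a \<in> ball p r" "b \<in> ball p r" for a b
      using that dist_triangle_base[of a b p] by simp
    have tri: "has_comparison_triangle k a b c" if "a \<in> ball p r" "b \<in> ball p r" "c \<in> ball p r" for a b c
      unfolding has_comparison_triangle_def
    proof
      assume k: "k > 0"
      have "dist a b + dist b c + dist c a < 6 * r" using small that by (smt (verit))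
      also have "\<dots> \<le> 6 * (1 / (2 * sqrt k))" using r(5)[OF k] by simp
      also have "\<dots> = 3 / sqrt k" by simp
      also have "\<dots> \<le> 2 * pi / sqrt k" using pi_gt3 k by (intro divide_right_mono) auto
      finally show "dist a b + dist b c + dist c a < 2 * pi / sqrt k" .
    qed
    have le: "hangle \<kappa> (dist a b) (dist a c) (dist b c) \<le> comparison_angle k a b c"
      if "a \<in> ball p r" "b \<in> ball p r" "c \<in> ball p r" "a \<noteq> b" "a \<noteq> c" for a b c
      unfolding comparison_angle_def
      using that small[of a b] small[of a c] r by (intro kR(3) abs_dist_diff dist_triangle_base) auto
    have "quad_cond \<kappa> (ball p r)"
      unfolding quad_cond_def
    proof (intro ballI impI)
      fix a b c d
      assume abcd: "a \<in> ball p r" "b \<in> ball p r" "c \<in> ball p r" "d \<in> ball p r" and dis: "distinct [a, b, c, d]"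
      have "ball p r \<subseteq> U" using r r0 by auto
      then have "comparison_angle k a b c + comparison_angle k a b d + comparison_angle k a c d \<le> 2 * pi"
        using abcd dis by (intro cmp tri) auto
      then show "hangle \<kappa> (dist a b) (dist a c) (dist b c) + hangle \<kappa> (dist a b) (dist a d) (dist b d)
       + hangle \<kappa> (dist a c) (dist a d) (dist c d) \<le> 2 * pi"
        using le[of a b c] le[of a b d] le[of a c d] abcd dis by auto
    qed
    moreover have "\<kappa> * (2 * r) \<le> 1" using r kR by (simp add: field_simps)
    ultimately show "\<exists>r>0. \<kappa> * (2 * r) \<le> 1 \<and> quad_cond \<kappa> (ball p r)" using r by blast
  qed
qed

section \<open>Almost geodesics and homotheties\<close>

lemma curve_length_ge_3:
  assumes "0 \<le> t1" "t1 \<le> t2" "t2 \<le> 1"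
  shows "ennreal (dist (\<gamma> 0) (\<gamma> t1) + dist (\<gamma> t1) (\<gamma> t2) + dist (\<gamma> t2) (\<gamma> 1)) \<le> curve_length \<gamma>"
proof -
  define t :: "nat \<Rightarrow> real" where "t n = (if n = 0 then 0 else if n = 1 then t1 else if n = 2 then t2 else 1)" for n
  have "mono t" by (rule incseq_SucI) (use assms in \<open>auto simp: t_def\<close>)
  moreover have "range t \<subseteq> {0..1}" using assms by (auto simp: t_def)
  ultimately have "(\<Sum>i<3. ennreal (dist (\<gamma> (t i)) (\<gamma> (t (Suc i))))) \<le> curve_length \<gamma>"
    unfolding curve_length_def by (intro SUP_upper2[of "(3, t)"]) auto
  also have "(\<Sum>i<3. ennreal (dist (\<gamma> (t i)) (\<gamma> (t (Suc i)))))
      = ennreal (dist (\<gamma> 0) (\<gamma> t1) + dist (\<gamma> t1) (\<gamma> t2) + dist (\<gamma> t2) (\<gamma> 1))"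
    by (simp add: numeral_3_eq_3 t_def ennreal_plus)
  finally show ?thesis .
qed

text \<open>A curve of length below \<open>dist x y + e\<close> is sampled at prescribed distances
  from \<open>x\<close>. A detour of more than \<open>e\<close> between two samples would show in
  the polygon through both. The samples need not depend continuously on \<open>s\<close>.\<close>

lemma intrinsic_almost_geodesic:
  fixes x y :: "'a::metric_space"
  assumes "intrinsic_metric TYPE('a)" and "e > 0"
  obtains \<sigma> where "\<sigma> 0 = x" "\<sigma> (dist x y) = y"
    "\<And>s. s \<in> {0..dist x y} \<Longrightarrow> dist x (\<sigma> s) = s"
    "\<And>s s'. s \<in> {0..dist x y} \<Longrightarrow> s' \<in> {0..dist x y} \<Longrightarrow> dist (\<sigma> s) (\<sigma> s') \<le> \<bar>s - s'\<bar> + e"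
proof (cases "x = y")
  case True
  show thesis by (rule that[of "\<lambda>_. x"]) (use True assms in auto)
next
  case False
  define d where "d = dist x y"
  have d: "d > 0" using False by (simp add: d_def)
  have "(INF \<gamma> \<in> {\<gamma>. path \<gamma> \<and> pathstart \<gamma> = x \<and> pathfinish \<gamma> = y}. curve_length \<gamma>) = ennreal d"
    using assms(1) unfolding intrinsic_metric_def d_def by metis
  also have "ennreal d < ennreal (d + e)" using assms(2) d by (simp add: ennreal_less_iff)
  finally obtain \<gamma> where \<gamma>: "path \<gamma>" "pathstart \<gamma> = x" "pathfinish \<gamma> = y" "curve_length \<gamma> < ennreal (d + e)"
    by (auto simp: INF_less_iff)
  have \<gamma>01: "\<gamma> 0 = x" "\<gamma> 1 = y" using \<gamma> by (auto simp: pathstart_def pathfinish_def)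
  have poly: "dist x (\<gamma> t1) + dist (\<gamma> t1) (\<gamma> t2) + dist (\<gamma> t2) y \<le> d + e"
    if "0 \<le> t1" "t1 \<le> t2" "t2 \<le> 1" for t1 t2
  proof -
    have "ennreal (dist x (\<gamma> t1) + dist (\<gamma> t1) (\<gamma> t2) + dist (\<gamma> t2) y) \<le> curve_length \<gamma>"
      using curve_length_ge_3[OF that, of \<gamma>] by (simp add: \<gamma>01)
    also note \<gamma>(4)
    finally have "ennreal (dist x (\<gamma> t1) + dist (\<gamma> t1) (\<gamma> t2) + dist (\<gamma> t2) y) < ennreal (d + e)" .
    then show ?thesis by (subst (asm) ennreal_less_iff) auto
  qed
  have "\<exists>\<tau>. 0 \<le> \<tau> \<and> \<tau> \<le> 1 \<and> dist x (\<gamma> \<tau>) = s" if "s \<in> {0..d}" for s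
  proof -
    have "continuous_on {0..1} (\<lambda>\<tau>. dist x (\<gamma> \<tau>))"
      using \<gamma>(1) unfolding path_def by (intro continuous_intros)
    then show ?thesis using IVT'[of "\<lambda>\<tau>. dist x (\<gamma> \<tau>)" 0 s 1] that by (auto simp: \<gamma>01 d_def)
  qed
  then obtain \<tau>0 where \<tau>0: "\<And>s. s \<in> {0..d} \<Longrightarrow> 0 \<le> \<tau>0 s \<and> \<tau>0 s \<le> 1 \<and> dist x (\<gamma> (\<tau>0 s)) = s"
    by metis
  \<comment> \<open>At distance \<open>d\<close> the intermediate value theorem may pick a point
    other than \<open>y\<close>, so both ends are fixed by hand.\<close>
  define \<tau> where "\<tau> s = (if s = 0 then 0 else if s = d then 1 else \<tau>0 s)" for s
  have \<tau>: "0 \<le> \<tau> s" "\<tau> s \<le> 1" "dist x (\<gamma> (\<tau> s)) = s" if "s \<in> {0..d}" for s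
    using \<tau>0[OF that] by (auto simp: \<tau>_def \<gamma>01 d_def)
  have *: "dist (\<gamma> (\<tau> s)) (\<gamma> (\<tau> s')) \<le> \<bar>s - s'\<bar> + e"
    if "s \<in> {0..d}" "s' \<in> {0..d}" "\<tau> s \<le> \<tau> s'" for s s'
  proof -
    have "dist x y \<le> dist x (\<gamma> (\<tau> s')) + dist (\<gamma> (\<tau> s')) y" by (rule dist_triangle)
    then show ?thesis
      using poly[of "\<tau> s" "\<tau> s'"] \<tau>[OF that(1)] \<tau>[OF that(2)] that(3) unfolding d_def by linarith
  qed
  show thesis
  proof (rule that[of "\<gamma> \<circ> \<tau>"])
    show "(\<gamma> \<circ> \<tau>) 0 = x" "(\<gamma> \<circ> \<tau>) (dist x y) = y" using d by (auto simp: \<tau>_def \<gamma>01 d_def)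
    show "dist x ((\<gamma> \<circ> \<tau>) s) = s" if "s \<in> {0..dist x y}" for s
      using \<tau>(3)[of s] that by (simp add: d_def)
    show "dist ((\<gamma> \<circ> \<tau>) s) ((\<gamma> \<circ> \<tau>) s') \<le> \<bar>s - s'\<bar> + e"
      if "s \<in> {0..dist x y}" "s' \<in> {0..dist x y}" for s s'
      using *[of s s'] *[of s' s] that linear[of "\<tau> s" "\<tau> s'"]
      by (auto simp: d_def dist_commute abs_minus_commute)
  qed
qed

lemma hcos_dist_bounds:
  fixes m x y :: "'a::metric_space"
  assumes "k > 0" "m \<noteq> x" "m \<noteq> y"
  shows "-1 \<le> hcos k (dist m x) (dist m y) (dist x y)" "hcos k (dist m x) (dist m y) (dist x y) \<le> 1"
  using assms hcos_facts(1,2)[OF assms(1), of "dist m x" "dist m y" "dist x y"]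
  by (auto simp: abs_dist_diff dist_triangle_base)

text \<open>The other two angles at \<open>m\<close> sum to at most \<open>pi\<close> plus the
  defect \<open>pi - \<Gamma>\<close>, and the cosine is 1-Lipschitz. The bound is of use when
  \<open>m\<close> is nearly between \<open>y\<close> and \<open>z\<close>, for then the defect is
  small.\<close>

lemma quad_cond_cos_sum:
  fixes m x y z :: "'a::metric_space"
  assumes "quad_cond k U" "k > 0" "m \<in> U" "x \<in> U" "y \<in> U" "z \<in> U" "distinct [m, x, y, z]"
  shows "- (pi - hangle k (dist m y) (dist m z) (dist y z)) \<le>
    hcos k (dist m x) (dist m y) (dist x y) + hcos k (dist m x) (dist m z) (dist x z)"
proof -
  define A where "A = hangle k (dist m x) (dist m y) (dist x y)"
  define B where "B = hangle k (dist m x) (dist m z) (dist x z)"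
  define \<Gamma> where "\<Gamma> = hangle k (dist m y) (dist m z) (dist y z)"
  have sum: "A + B + \<Gamma> \<le> 2 * pi"
    using assms unfolding quad_cond_def A_def B_def \<Gamma>_def by blast
  have b1: "-1 \<le> hcos k (dist m x) (dist m y) (dist x y)" "hcos k (dist m x) (dist m y) (dist x y) \<le> 1"
    and b2: "-1 \<le> hcos k (dist m x) (dist m z) (dist x z)" "hcos k (dist m x) (dist m z) (dist x z) \<le> 1"
    and b3: "-1 \<le> hcos k (dist m y) (dist m z) (dist y z)" "hcos k (dist m y) (dist m z) (dist y z) \<le> 1"
    using assms by (auto intro!: hcos_dist_bounds)
  have A: "0 \<le> A" "A \<le> pi" "cos A = hcos k (dist m x) (dist m y) (dist x y)"
    using b1 by (auto simp: A_def hangle_def arccos_lbound arccos_ubound)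
  have B: "0 \<le> B" "B \<le> pi" "cos B = hcos k (dist m x) (dist m z) (dist x z)"
    using b2 by (auto simp: B_def hangle_def arccos_lbound arccos_ubound)
  have \<Gamma>: "\<Gamma> \<le> pi" using b3 by (auto simp: \<Gamma>_def hangle_def arccos_ubound)
  have "- (pi - \<Gamma>) \<le> cos A + cos B"
  proof (cases "A \<le> pi - B")
    case True
    then have "cos (pi - B) \<le> cos A" using A B by (intro cos_monotone_0_pi_le) auto
    then show ?thesis using \<Gamma> by simp
  next
    case False
    have "\<bar>cos A - cos (pi - B)\<bar> \<le> \<bar>A - (pi - B)\<bar>"
    proof -
      have "\<bar>cos A - cos (pi - B)\<bar> = 2 * \<bar>sin ((A + (pi - B)) / 2)\<bar> * \<bar>sin ((pi - B - A) / 2)\<bar>"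
        by (simp only: cos_diff_cos abs_mult abs_numeral)
      also have "\<dots> \<le> 2 * 1 * \<bar>(pi - B - A) / 2\<bar>"
        by (intro mult_mono abs_sin_x_le_abs_x) auto
      finally show ?thesis by (simp add: abs_minus_commute)
    qed
    then show ?thesis using False sum by simp
  qed
  then show ?thesis using A B by (simp add: \<Gamma>_def)
qed

lemma pi_minus_arccos_le:
  assumes "-1 \<le> v" "v \<le> - cos w" "0 \<le> w" "w \<le> pi"
  shows "pi - arccos v \<le> w"
proof -
  have "v \<le> 1" using assms(2) cos_ge_minus_one[of w] by linarith
  then have "arccos (- cos w) \<le> arccos v" using assms by (intro arccos_le_arccos) auto
  moreover have "arccos (- cos w) = pi - w"
    using assms by (simp add: arccos_minus arccos_cos)
  ultimately show ?thesis by linarith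
qed

lemma cosh_mono: "0 \<le> x \<Longrightarrow> x \<le> y \<Longrightarrow> cosh x \<le> cosh (y::real)"
  by (simp add: cosh_real_nonneg_le_iff)

lemma hyp_stewart_degenerate:
  fixes b1 b2 :: real
  shows "cosh b1 * sinh (b1 + b2) = sinh b2 + sinh b1 * cosh (b1 + b2)"
proof -
  have "sinh b2 = sinh ((b1 + b2) - b1)" by simp
  then show ?thesis unfolding sinh_diff by (simp add: mult.commute)
qed

text \<open>Clearing denominators in \<open>quad_cond_cos_sum\<close> gives Stewart's theorem of the
  hyperbolic plane as an inequality. An excess \<open>e\<close> over betweenness is allowed, as only
  almost geodesics are at hand; \<open>e\<close> does not depend on the points.\<close>

lemma approx_hyp_stewart:
  fixes b1 b2 \<eta> k r :: real
  assumes pos: "k > 0" "b1 > 0" "b2 > 0" "\<eta> > 0"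
  obtains e where "e > 0"
    "\<And>(p::'a::metric_space) m x y z. quad_cond k (ball p r) \<Longrightarrow> {m, x, y, z} \<subseteq> ball p r \<Longrightarrow>
       dist y m = b1 \<Longrightarrow> b2 \<le> dist m z \<Longrightarrow> dist m z \<le> b2 + e \<Longrightarrow> dist y z = b1 + b2 \<Longrightarrow>
       sinh (k * b2) * cosh (k * dist x y) + sinh (k * b1) * cosh (k * dist x z) - \<eta>
         \<le> cosh (k * dist x m) * sinh (k * (b1 + b2))"
proof -
  define D where "D = 2 * r"
  \<comment> \<open>\<open>S\<close> bounds the common denominator on the whole ball, and
    \<open>w\<close> is the admissible angle defect, which contributes at most
    \<open>w * S \<le> \<eta> / 2\<close>.\<close>
  define S where "S = sinh (k * \<bar>D\<bar>) ^ 3 + 1"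
  have S: "S > 0" using pos by (simp add: S_def add_nonneg_pos)
  define w where "w = min (\<eta> / (2 * S)) 1"
  have w: "0 < w" "w \<le> pi" "w * S \<le> \<eta> / 2"
  proof -
    show "0 < w" using pos S by (simp add: w_def)
    show "w \<le> pi" using pi_gt3 by (simp add: w_def min_le_iff_disj)
    have "w * S \<le> (\<eta> / (2 * S)) * S" using S by (intro mult_right_mono) (auto simp: w_def)
    then show "w * S \<le> \<eta> / 2" using S by simp
  qed
  have cosw: "cos w < 1" using cos_monotone_0_pi[of 0 w] w by simp
  define s where "s = sinh (k * b1) * sinh (k * b2)"
  have s: "s > 0" using pos by (simp add: s_def)
  \<comment> \<open>The three limits serve the angle defect at \<open>m\<close>, the replacement of
    \<open>dist m z\<close> by \<open>b2\<close>, and the degenerate case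
    \<open>x = m\<close>.\<close>
  have lim: "((\<lambda>e. (cosh (k * (b1 + b2 + e)) - cosh (k * (b1 + b2))) / s) \<longlongrightarrow> 0) (at_right 0)"
    "((\<lambda>e. cosh (k * D) * (sinh (k * (b1 + b2 + e)) - sinh (k * (b1 + b2)))) \<longlongrightarrow> 0) (at_right 0)"
    "((\<lambda>e. sinh (k * b1) * (cosh (k * (b2 + e)) - cosh (k * b2))) \<longlongrightarrow> 0) (at_right 0)"
    by (rule tendsto_eq_intros refl | use s in force)+
  have "eventually (\<lambda>e. (cosh (k * (b1 + b2 + e)) - cosh (k * (b1 + b2))) / s < 1 - cos w \<and>
      cosh (k * D) * (sinh (k * (b1 + b2 + e)) - sinh (k * (b1 + b2))) < \<eta> / 2 \<and>
      sinh (k * b1) * (cosh (k * (b2 + e)) - cosh (k * b2)) < \<eta> \<and> e > 0) (at_right 0)"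
    using order_tendstoD(2)[OF lim(1), of "1 - cos w"] order_tendstoD(2)[OF lim(2), of "\<eta> / 2"]
      order_tendstoD(2)[OF lim(3), of \<eta>] eventually_at_right_less[of "0::real"] cosw pos
    by (auto simp: eventually_conj_iff)
  then obtain e where e: "e > 0"
      "(cosh (k * (b1 + b2 + e)) - cosh (k * (b1 + b2))) / s < 1 - cos w"
      "cosh (k * D) * (sinh (k * (b1 + b2 + e)) - sinh (k * (b1 + b2))) < \<eta> / 2"
      "sinh (k * b1) * (cosh (k * (b2 + e)) - cosh (k * b2)) < \<eta>"
    using eventually_happens by (metis (mono_tags, lifting) trivial_limit_at_right_real)
  show thesis
  proof (rule that[OF e(1)])
    fix p m x y z :: 'a
    assume quad: "quad_cond k (ball p r)" and ball: "{m, x, y, z} \<subseteq> ball p r"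
      and m: "dist y m = b1" "b2 \<le> dist m z" "dist m z \<le> b2 + e" "dist y z = b1 + b2"
    have U: "m \<in> ball p r" "x \<in> ball p r" "y \<in> ball p r" "z \<in> ball p r" using ball by auto
    have D: "dist u v \<le> D" if "u \<in> ball p r" "v \<in> ball p r" for u v
      using that dist_triangle_base[of u v p] by (simp add: D_def)
    have ne: "m \<noteq> y" "m \<noteq> z" "y \<noteq> z" using m pos by auto
    define a b c1 c2 where "a = k * dist x m" "b = k * dist m z" "c1 = k * dist x y" "c2 = k * dist x z"
    note abc = a_b_c1_c2_def
    define u1 u2 where "u1 = k * b1" "u2 = k * b2"
    note bb = u1_u2_def
    have b: "u2 \<le> b" "b \<le> k * (b2 + e)" "0 < u1" "0 < u2" "0 < b" "0 \<le> a" "0 \<le> c1" "0 \<le> c2"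
      using m pos by (auto simp: abc bb intro: mult_pos_pos less_le_trans)
    have kb: "k * (b1 + b2) = u1 + u2" by (simp add: bb distrib_left)
    show "sinh (k * b2) * cosh (k * dist x y) + sinh (k * b1) * cosh (k * dist x z) - \<eta>
         \<le> cosh (k * dist x m) * sinh (k * (b1 + b2))"
    \<comment> \<open>The quadruple condition speaks of distinct points only, so coincidences are
      settled by hand.\<close>
    proof (cases "x = m \<or> x = y \<or> x = z")
      case True
      then consider "x = m" | "x = y" | "x = z" by blast
      then show ?thesis
      proof cases
        case 1
        have "cosh (k * dist m z) \<le> cosh (k * (b2 + e))"
          using b abc by (intro cosh_mono) auto
        then have "sinh (k * b1) * cosh (k * dist m z) \<le> sinh (k * b1) * cosh (k * (b2 + e))"
          using pos by (intro mult_left_mono) auto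
        then show ?thesis using e(4) 1 m
          by (simp add: dist_commute distrib_left sinh_add algebra_simps)
      next
        case 2
        then show ?thesis using hyp_stewart_degenerate[of "k * b1" "k * b2"] pos m
          by (simp add: distrib_left)
      next
        case 3
        have "cosh (k * b2) * sinh (k * (b1 + b2)) \<le> cosh (k * dist z m) * sinh (k * (b1 + b2))"
          using pos m by (intro mult_right_mono cosh_mono) (auto simp: dist_commute)
        then show ?thesis using hyp_stewart_degenerate[of "k * b2" "k * b1"] pos m 3
          by (simp add: distrib_left dist_commute add_ac)
      qed
    next
      case False
      then have a: "0 < a" using pos by (simp add: abc)
      have Sle: "sinh a * sinh u1 * sinh b \<le> S"
      proof -
        have "a \<le> k * \<bar>D\<bar>" "u1 \<le> k * \<bar>D\<bar>" "b \<le> k * \<bar>D\<bar>"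
          using D[of x m] D[of y m] D[of m z] U pos m by (auto simp: abc bb)
        then have "sinh a * sinh u1 * sinh b \<le> sinh (k * \<bar>D\<bar>) * sinh (k * \<bar>D\<bar>) * sinh (k * \<bar>D\<bar>)"
          using a b by (intro mult_mono) auto
        then show ?thesis by (simp add: S_def power3_eq_cube)
      qed
      have "hcos k (dist m y) (dist m z) (dist y z) \<le> - cos w"
      proof -
        have "1 + hcos k (dist m y) (dist m z) (dist y z) = (cosh (u1 + b) - cosh (u1 + u2)) / (sinh u1 * sinh b)"
        proof -
          have "hcos k (dist m y) (dist m z) (dist y z) = (cosh u1 * cosh b - cosh (u1 + u2)) / (sinh u1 * sinh b)"
            using m by (simp add: hcos_def dist_commute abc bb distrib_left)
          then show ?thesis using b by (simp add: cosh_add[of u1 b] add_divide_distrib diff_divide_distrib)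
        qed
        also have "\<dots> \<le> (cosh (k * (b1 + b2 + e)) - cosh (k * (b1 + b2))) / s"
        proof (rule frac_le)
          have "u1 + b \<le> k * (b1 + b2 + e)" using b by (simp add: bb algebra_simps)
          then have "cosh (u1 + b) \<le> cosh (k * (b1 + b2 + e))"
            using b by (intro cosh_mono) auto
          then show "cosh (u1 + b) - cosh (u1 + u2) \<le> cosh (k * (b1 + b2 + e)) - cosh (k * (b1 + b2))"
            by (simp add: kb)
          have "cosh (u1 + u2) \<le> cosh (k * (b1 + b2 + e))"
            using \<open>u1 + b \<le> _\<close> b by (intro cosh_mono) auto
          then show "0 \<le> cosh (k * (b1 + b2 + e)) - cosh (k * (b1 + b2))" by (simp add: kb)
          show "0 < s" by fact
          show "s \<le> sinh u1 * sinh b" using b by (simp add: s_def bb)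
        qed
        also note e(2)
        finally show ?thesis by simp
      qed
      then have "pi - hangle k (dist m y) (dist m z) (dist y z) \<le> w"
        unfolding hangle_def using w ne pos by (intro pi_minus_arccos_le hcos_dist_bounds) auto
      moreover have "- (pi - hangle k (dist m y) (dist m z) (dist y z)) \<le>
          hcos k (dist m x) (dist m y) (dist x y) + hcos k (dist m x) (dist m z) (dist x z)"
        using U False ne pos by (intro quad_cond_cos_sum[OF quad]) auto
      ultimately have "- w \<le> (cosh a * cosh u1 - cosh c1) / (sinh a * sinh u1) + (cosh a * cosh b - cosh c2) / (sinh a * sinh b)"
        using m by (simp add: hcos_def dist_commute abc bb)
      then have "- w * (sinh a * sinh u1 * sinh b) \<le>
          ((cosh a * cosh u1 - cosh c1) / (sinh a * sinh u1) + (cosh a * cosh b - cosh c2) / (sinh a * sinh b)) * (sinh a * sinh u1 * sinh b)"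
        using a b by (intro mult_right_mono) auto
      also have "\<dots> = sinh b * (cosh a * cosh u1 - cosh c1) + sinh u1 * (cosh a * cosh b - cosh c2)"
        using a b by (simp add: field_simps)
      finally have 1: "- w * (sinh a * sinh u1 * sinh b) + sinh b * cosh c1 + sinh u1 * cosh c2 \<le> cosh a * sinh (u1 + b)"
        by (simp add: sinh_add algebra_simps)
      have 2: "w * (sinh a * sinh u1 * sinh b) \<le> \<eta> / 2"
        using mult_left_mono[OF Sle, of w] w by linarith
      have 3: "sinh u2 * cosh c1 \<le> sinh b * cosh c1" using b by (intro mult_right_mono) auto
      have 4: "cosh a * (sinh (u1 + b) - sinh (u1 + u2)) \<le> \<eta> / 2"
      proof -
        have "cosh a * (sinh (u1 + b) - sinh (u1 + u2))
            \<le> cosh (k * D) * (sinh (k * (b1 + b2 + e)) - sinh (k * (b1 + b2)))"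
        proof (rule mult_mono)
          have "u1 + b \<le> k * (b1 + b2 + e)" using b by (simp add: bb algebra_simps)
          then show "sinh (u1 + b) - sinh (u1 + u2) \<le> sinh (k * (b1 + b2 + e)) - sinh (k * (b1 + b2))"
            by (simp add: kb)
          have "a \<le> k * D" using D[of x m] U pos by (simp add: abc)
          then show "cosh a \<le> cosh (k * D)" using a by (intro cosh_mono) auto
        qed (use b in auto)
        then show ?thesis using e(3) by linarith
      qed
      show ?thesis
      proof -
        have "- (w * (sinh a * sinh u1 * sinh b)) + sinh b * cosh c1 + sinh u1 * cosh c2 \<le> cosh a * sinh (u1 + b)"
          using 1 by simp
        moreover have "cosh a * sinh (u1 + b) - cosh a * sinh (u1 + u2) \<le> \<eta> / 2"
          using 4 by (simp only: right_diff_distrib)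
        ultimately have "sinh u2 * cosh c1 + sinh u1 * cosh c2 - \<eta> \<le> cosh a * sinh (u1 + u2)"
          using 2 3 by linarith
        then show ?thesis unfolding kb by (simp only: abc bb)
      qed
    qed
  qed
qed

lemma cosh_ge_quadratic:
  fixes x :: real assumes "0 \<le> x" shows "1 + x\<^sup>2 / 2 \<le> cosh x"
proof -
  have "cosh 0 - 0\<^sup>2 / 2 \<le> cosh x - x\<^sup>2 / 2"
    by (rule le_of_deriv_nonneg_from_0[where f = "\<lambda>x. cosh x - x\<^sup>2 / 2" and f' = "\<lambda>x. sinh x - x"])
      (use assms sinh_ge_self in \<open>auto intro!: derivative_eq_intros\<close>)
  then show ?thesis by simp
qed

text \<open>Stewart is used twice: for \<open>x1'\<close> between \<open>y\<close> and
  \<open>x1\<close> seen from \<open>x2\<close>, then for \<open>x2'\<close> between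
  \<open>y\<close> and \<open>x2\<close> seen from \<open>x1'\<close>. The factor 1/4 collects the
  losses of \<open>cosh\<close> against quadratic polynomials, of
  \<open>sinh (k * R) \<le> 2 * k * R\<close>, and of the half of \<open>l\<^sup>2 * E\<close> given
  to the error.\<close>

lemma approx_homothety:
  fixes p :: "'a::metric_space"
  assumes quad: "quad_cond k (ball p r)" and k: "k > 0" "k * (2 * r) \<le> 1"
    and Rt: "R > 0" "k * R \<le> 1" "0 < t" "t < 1" "\<epsilon> > 0" "k * \<epsilon> \<le> 1"
  obtains e where "e > 0"
    "\<And>y x1 x2 x1' x2'. {y, x1, x2, x1', x2'} \<subseteq> ball p r \<Longrightarrow>
      dist y x1 = R \<Longrightarrow> dist y x2 = R \<Longrightarrow> dist y x1' = t * R \<Longrightarrow> dist y x2' = t * R \<Longrightarrow>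
      dist x1' x1 \<le> (1 - t) * R + e \<Longrightarrow> dist x2' x2 \<le> (1 - t) * R + e \<Longrightarrow>
      \<epsilon> \<le> dist x1 x2 \<Longrightarrow> t * \<epsilon> / 4 \<le> dist x1' x2'"
proof -
  define L where "L = sinh (k * R)"
  define l where "l = sinh (k * (t * R))"
  define q where "q = sinh (k * ((1 - t) * R))"
  have pos: "0 < L" "0 < l" "0 < q" using Rt k by (auto simp: L_def l_def q_def)
  define E where "E = cosh (k * \<epsilon>) - 1"
  have E: "(k * \<epsilon>)\<^sup>2 / 2 \<le> E" using cosh_ge_quadratic[of "k * \<epsilon>"] k Rt by (simp add: E_def)
  moreover have "0 < (k * \<epsilon>)\<^sup>2 / 2" using k Rt by simp
  ultimately have E0: "0 < E" by linarith
  define \<eta> where "\<eta> = l\<^sup>2 * E / (2 * (L + l))"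
  have \<eta>: "0 < \<eta>" "\<eta> * (L + l) = l\<^sup>2 * E / 2" using pos E0 by (auto simp: \<eta>_def field_simps)
  have t01: "0 < t * R" "0 < (1 - t) * R" using Rt by auto
  obtain e where e: "e > 0" and st: "\<And>m x y z. {m, x, y, z} \<subseteq> ball p r \<Longrightarrow> dist y m = t * R \<Longrightarrow>
       (1 - t) * R \<le> dist m z \<Longrightarrow> dist m z \<le> (1 - t) * R + e \<Longrightarrow> dist y z = t * R + (1 - t) * R \<Longrightarrow>
       sinh (k * ((1 - t) * R)) * cosh (k * dist x y) + sinh (k * (t * R)) * cosh (k * dist x z) - \<eta>
         \<le> cosh (k * dist x m) * sinh (k * (t * R + (1 - t) * R))"
    by (rule approx_hyp_stewart[of k "t * R" "(1 - t) * R" \<eta> r, where 'a = 'a, OF k(1) t01 \<eta>(1)], rule that, assumption)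
      (use quad in blast)
  note st = st[folded q_def l_def]
  have tR: "t * R + (1 - t) * R = R" by (simp add: algebra_simps)
  show thesis
  proof (rule that[OF e])
    fix y x1 x2 x1' x2' :: 'a
    assume U: "{y, x1, x2, x1', x2'} \<subseteq> ball p r"
      and R: "dist y x1 = R" "dist y x2 = R" "dist y x1' = t * R" "dist y x2' = t * R"
      and near: "dist x1' x1 \<le> (1 - t) * R + e" "dist x2' x2 \<le> (1 - t) * R + e"
      and \<epsilon>: "\<epsilon> \<le> dist x1 x2"
    have ge: "(1 - t) * R \<le> dist x1' x1" "(1 - t) * R \<le> dist x2' x2"
      using R dist_triangle[of y x1 x1'] dist_triangle[of y x2 x2'] by (auto simp: algebra_simps)
    define d' where "d' = dist x1' x2'"
    define A where "A = cosh (k * dist x1' x2)"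
    have "E + 1 \<le> cosh (k * dist x1 x2)"
      using \<epsilon> k Rt by (auto simp: E_def cosh_real_nonneg_le_iff)
    then have "l * (E + 1) \<le> l * cosh (k * dist x1 x2)" using pos by simp
    moreover have "q * cosh (k * R) + l * cosh (k * dist x1 x2) - \<eta> \<le> A * L"
      using st[of x1' x2 y x1] U R near ge by (simp add: tR A_def L_def dist_commute)
    ultimately have 1: "q * cosh (k * R) + l * (E + 1) - \<eta> \<le> A * L" by linarith
    have 2: "q * cosh (k * (t * R)) + l * A - \<eta> \<le> cosh (k * d') * L"
      using st[of x2' x1' y x2] U R near ge by (simp add: tR A_def L_def d'_def dist_commute)
    \<comment> \<open>What the two inequalities combine to, with equality, for
      \<open>E = \<eta> = 0\<close> and \<open>d' = 0\<close>.\<close>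
    have id: "q * cosh (k * (t * R)) * L + l * q * cosh (k * R) + l * l = L\<^sup>2"
    proof -
      have "k * ((1 - t) * R) = k * R - k * (t * R)" by (simp add: algebra_simps)
      then have q: "q = L * cosh (k * (t * R)) - cosh (k * R) * l"
        by (simp add: q_def L_def l_def sinh_diff)
      have c: "cosh (k * R) ^ 2 = 1 + L\<^sup>2" "cosh (k * (t * R)) ^ 2 = 1 + l\<^sup>2"
        by (simp_all add: L_def l_def cosh_square_eq)
      have "q * cosh (k * (t * R)) * L + l * q * cosh (k * R) + l * l
          = L\<^sup>2 * cosh (k * (t * R)) ^ 2 - l\<^sup>2 * cosh (k * R) ^ 2 + l\<^sup>2"
        unfolding q by (simp add: algebra_simps power2_eq_square)
      then show ?thesis unfolding c by (simp add: algebra_simps)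
    qed
    have "l * (q * cosh (k * R) + l * (E + 1) - \<eta>) \<le> l * (A * L)" using 1 pos by simp
    moreover have "(q * cosh (k * (t * R)) + l * A - \<eta>) * L \<le> cosh (k * d') * L * L" using 2 pos by simp
    ultimately have "L\<^sup>2 + l\<^sup>2 * E - \<eta> * (L + l) \<le> cosh (k * d') * L\<^sup>2"
      using id by (simp add: algebra_simps power2_eq_square)
    then have 3: "l\<^sup>2 * E / 2 \<le> (cosh (k * d') - 1) * L\<^sup>2" using \<eta> by (simp add: algebra_simps)
    have "d' \<le> 2 * r" using U dist_triangle_base[of x1' x2' p] by (simp add: d'_def)
    then have "k * d' \<le> 1" using k by (meson mult_left_mono order_trans less_imp_le)
    then have 4: "cosh (k * d') - 1 \<le> (k * d')\<^sup>2"
      using cosh_le_1_plus(1)[of "k * d'"] k by (simp add: d'_def)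
    have "L \<le> k * R * 2"
    proof -
      have "L \<le> k * R * cosh (k * R)" using sinh_le_mult_cosh[of "k * R"] k Rt by (simp add: L_def)
      also have "\<dots> \<le> k * R * 2" using cosh_le_1_plus(2)[of "k * R"] k Rt by (intro mult_left_mono) auto
      finally show ?thesis .
    qed
    then have "L\<^sup>2 \<le> (k * R * 2)\<^sup>2" using pos by (intro power_mono) auto
    moreover have "(k * (t * R))\<^sup>2 \<le> l\<^sup>2"
      using sinh_ge_self[of "k * (t * R)"] k Rt by (intro power_mono) (auto simp: l_def)
    ultimately have "(k * (t * R))\<^sup>2 * ((k * \<epsilon>)\<^sup>2 / 2) \<le> l\<^sup>2 * E"
      using E by (rule_tac mult_mono) auto
    moreover have "(cosh (k * d') - 1) * L\<^sup>2 \<le> (k * d')\<^sup>2 * (k * R * 2)\<^sup>2"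
      using 4 \<open>L\<^sup>2 \<le> _\<close> by (rule mult_mono) auto
    ultimately have "(k * (t * R))\<^sup>2 * ((k * \<epsilon>)\<^sup>2 / 2) / 2 \<le> (k * d')\<^sup>2 * (k * R * 2)\<^sup>2"
      using 3 by linarith
    moreover have "(k * (t * R))\<^sup>2 * ((k * \<epsilon>)\<^sup>2 / 2) / 2 = 4 * ((k * R * k)\<^sup>2 * (t * \<epsilon> / 4)\<^sup>2)"
      by (simp add: power_mult_distrib power_divide)
    moreover have "(k * d')\<^sup>2 * (k * R * 2)\<^sup>2 = 4 * ((k * R * k)\<^sup>2 * d'\<^sup>2)"
      by (simp add: power_mult_distrib)
    ultimately have "(k * R * k)\<^sup>2 * (t * \<epsilon> / 4)\<^sup>2 \<le> (k * R * k)\<^sup>2 * d'\<^sup>2" by linarith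
    then have "(t * \<epsilon> / 4)\<^sup>2 \<le> d'\<^sup>2" using k Rt by simp
    then show "t * \<epsilon> / 4 \<le> dist x1' x2'" unfolding d'_def by (rule power2_le_imp_le) simp
  qed
qed

section \<open>Local compactness and the existence of geodesics\<close>

text \<open>The limit point is found by derandomisation: with \<open>N\<close> children per ball, each covering set
  is charged its share \<open>N\<^sup>-\<^sup>m\<close> of the natural mass of the Cantor set inside the current ball, and
  one always descends to a child of below-average charge.\<close>

lemma hausdorff_dim_eq_top_if_packing:
  fixes x0 :: "'a::metric_space"
  assumes complete: "complete (UNIV :: 'a set)" and lam: "0 < c" "c \<le> 1 / 2" and r0: "r0 > 0"
    and pack: "\<And>N x \<rho>. x \<in> cball x0 r0 \<Longrightarrow> 0 < \<rho> \<Longrightarrow> \<rho> \<le> r0 \<Longrightarrow>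
      \<exists>S. finite S \<and> card S = N \<and> S \<subseteq> cball x (\<rho> / 2) \<and> (\<forall>u\<in>S. \<forall>v\<in>S. u \<noteq> v \<longrightarrow> 3 * c * \<rho> < dist u v)"
  shows "hausdorff_dim (UNIV :: 'a set) = \<infinity>"
proof (rule ccontr)
  assume "hausdorff_dim (UNIV :: 'a set) \<noteq> \<infinity>"
  then obtain d :: real where d: "d > 0" "hausdorff_measure d (UNIV :: 'a set) = 0"
    unfolding hausdorff_dim_def by (cases "{d::real. d > 0 \<and> hausdorff_measure d (UNIV :: 'a set) = 0} = {}") auto
  \<comment> \<open>\<open>K0\<close> bounds the share of a set of level \<open>l i\<close> by
    \<open>K0 * w i\<close>; \<open>\<theta>\<close> then keeps the total charge of the first ball
    below 1.\<close>
  define K0 where "K0 = r0 powr (-d) * c powr (-d)"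
  have K0: "K0 > 0" using r0 lam by (simp add: K0_def)
  define \<theta> where "\<theta> = 1 / (4 * K0)"
  have \<theta>: "\<theta> > 0" "K0 * (2 * \<theta>) < 1" using K0 by (auto simp: \<theta>_def)
  have \<theta>2: "2 * \<theta> < r0 powr d"
  proof -
    have "1 \<le> c powr (-d)" using lam d by (simp add: powr_minus one_le_inverse_iff powr_le1)
    then have "r0 powr (-d) * 1 \<le> K0" unfolding K0_def by (intro mult_left_mono) auto
    then have "r0 powr (-d) * (2 * \<theta>) < 1" using \<theta> by (smt (verit) mult_right_mono)
    then show ?thesis using r0 by (simp add: powr_minus field_simps)
  qed
  have "hausdorff_premeasure d 1 (UNIV :: 'a set) \<le> hausdorff_measure d (UNIV :: 'a set)"
    unfolding hausdorff_measure_def by (rule SUP_upper) simp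
  then have "hausdorff_premeasure d 1 (UNIV :: 'a set) < ennreal \<theta>" using d \<theta> by simp
  then obtain U :: "nat \<Rightarrow> 'a set" where U: "UNIV \<subseteq> (\<Union>i. U i)" "\<And>i. bounded (U i)"
    and Usum: "(\<Sum>i. ennreal (diameter (U i) powr d)) < ennreal \<theta>"
    unfolding hausdorff_premeasure_def by (auto simp: INF_less_iff)
  \<comment> \<open>The summable extra term makes every weight positive, so that sets of diameter 0
    get a level too.\<close>
  define w where "w i = diameter (U i) powr d + \<theta> * (1 / 2) ^ Suc i" for i
  have w: "w i > 0" for i using \<theta> by (simp add: w_def add_nonneg_pos)
  have "(\<lambda>i. \<theta> * (1 / 2) ^ Suc i) sums (\<theta> * 1)" by (intro sums_mult power_half_series)
  then have "(\<Sum>i. ennreal (\<theta> * (1 / 2) ^ Suc i)) = ennreal \<theta>"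
    using \<theta> by (intro suminf_ennreal_eq) auto
  then have wsum: "(\<Sum>i. ennreal (w i)) < ennreal (2 * \<theta>)"
  proof -
    assume *: "(\<Sum>i. ennreal (\<theta> * (1 / 2) ^ Suc i)) = ennreal \<theta>"
    have "(\<Sum>i. ennreal (w i)) = (\<Sum>i. ennreal (diameter (U i) powr d) + ennreal (\<theta> * (1 / 2) ^ Suc i))"
      using \<theta> by (intro suminf_cong) (simp add: w_def ennreal_plus)
    also have "\<dots> = (\<Sum>i. ennreal (diameter (U i) powr d)) + ennreal \<theta>"
      by (subst suminf_add[symmetric]) (simp_all add: * del: power_Suc)
    also have "\<dots> < ennreal \<theta> + ennreal \<theta>" using Usum by (simp add: ennreal_add_left_cancel_less add.commute)
    also have "\<dots> = ennreal (2 * \<theta>)" using \<theta> by (simp flip: ennreal_plus)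
    finally show ?thesis .
  qed
  define s where "s i = w i powr (1 / d)" for i
  have s: "s i > 0" "s i powr d = w i" for i using w[of i] d by (auto simp: s_def powr_powr)
  have diam: "diameter (U i) \<le> s i" for i
  proof -
    have "diameter (U i) \<ge> 0" using U(2) by (rule diameter_ge_0)
    moreover have "diameter (U i) powr d \<le> s i powr d" using \<theta> by (simp add: s w_def)
    ultimately show ?thesis using d s(1)[of i] powr_less_mono2[of d "s i" "diameter (U i)"] by linarith
  qed
  have wle: "w i < r0 powr d" for i
  proof -
    have "ennreal (w i) \<le> (\<Sum>i. ennreal (w i))"
      using sum_le_suminf[OF summableI, of "{i}" "\<lambda>i. ennreal (w i)"] by simp
    also note wsum
    finally have "w i < 2 * \<theta>" using w[of i] by (subst (asm) ennreal_less_iff) auto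
    then show ?thesis using \<theta>2 by simp
  qed
  have s\<rho>: "s i < r0" for i
    using wle[of i] s[of i] d r0 by (metis less_imp_le not_le powr_mono2)
  \<comment> \<open>The level of a covering set: the last radius still above
    \<open>s i\<close>.\<close>
  have "\<exists>n. s i < r0 * c ^ n \<and> r0 * c ^ Suc n \<le> s i" for i
  proof -
    have "(\<lambda>n. r0 * c ^ n) \<longlonglongrightarrow> r0 * 0" using lam by (intro tendsto_intros LIMSEQ_realpow_zero) auto
    then have "eventually (\<lambda>n. r0 * c ^ n < s i) sequentially" using s(1)[of i] by (intro order_tendstoD(2)) auto
    then obtain n where "r0 * c ^ n < s i" by (auto simp: eventually_sequentially)
    then have ex: "\<exists>n. r0 * c ^ n \<le> s i" by (intro exI[of _ n]) simp
    define n where "n = (LEAST n. r0 * c ^ n \<le> s i)"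
    have n: "r0 * c ^ n \<le> s i" unfolding n_def by (rule LeastI_ex[OF ex])
    have "n \<noteq> 0" using n s\<rho>[of i] by (intro notI) simp
    then obtain n' where n': "n = Suc n'" using not0_implies_Suc by blast
    then have "\<not> r0 * c ^ n' \<le> s i" using not_less_Least[of n' "\<lambda>n. r0 * c ^ n \<le> s i"] by (simp add: n_def)
    then show ?thesis using n n' by (intro exI[of _ n']) auto
  qed
  then obtain l where l: "\<And>i. s i < r0 * c ^ l i" "\<And>i. r0 * c ^ Suc (l i) \<le> s i" by metis
  \<comment> \<open>With this many children the Cantor set has dimension above \<open>d\<close>,
    because \<open>1 / N < c powr d\<close>.\<close>
  obtain N :: nat where N: "c powr (-d) < N" using reals_Archimedean2 by blast
  moreover have "0 < c powr (-d)" using lam by simp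
  ultimately have "0 < real N" by linarith
  then have N0: "N > 0" by simp
  have share: "(1 / real N) ^ l i \<le> K0 * w i" for i
  proof -
    have "1 / real N \<le> c powr d" using N N0 lam by (simp add: powr_minus field_simps)
    then have "(1 / real N) ^ l i \<le> (c powr d) ^ l i" by (intro power_mono) auto
    also have "\<dots> = (c ^ l i) powr d" using lam by (simp add: powr_power mult.commute flip: powr_realpow) (simp add: powr_powr mult.commute)
    also have "\<dots> = K0 * (r0 * c ^ Suc (l i)) powr d"
      using lam r0 by (simp add: K0_def powr_mult powr_minus field_simps)
    also have "\<dots> \<le> K0 * (s i) powr d"
      using l(2)[of i] K0 lam r0 d by (intro mult_left_mono powr_mono2) auto
    finally show ?thesis by (simp add: s)
  qed
  \<comment> \<open>A set coarser than the current ball is charged all of the ball's mass, a finer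
    one the mass of a single ball of its own level.\<close>
  define \<mu> where "\<mu> i n x = (if U i \<inter> cball x (r0 * c ^ n) = {} then 0 else (1 / real N) ^ max n (l i))" for i n x
  have \<mu>0: "0 \<le> \<mu> i n x" for i n x by (simp add: \<mu>_def)
  define P where "P n x \<longleftrightarrow> dist x0 x + r0 * c ^ n \<le> r0 \<and> (\<Sum>i. ennreal (\<mu> i n x)) < ennreal ((1 / real N) ^ n)" for n x
  have "P 0 x0"
  proof -
    have "(\<Sum>i. ennreal (\<mu> i 0 x0)) \<le> (\<Sum>i. ennreal (K0 * w i))"
      using share w K0 by (intro suminf_le ennreal_leI summableI) (auto simp: \<mu>_def less_imp_le)
    also have "\<dots> = ennreal K0 * (\<Sum>i. ennreal (w i))" using K0 w by (simp add: ennreal_mult less_imp_le)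
    also have "\<dots> \<le> ennreal K0 * ennreal (2 * \<theta>)" using wsum by (intro mult_left_mono) auto
    also have "\<dots> = ennreal (K0 * (2 * \<theta>))" using K0 \<theta> by (simp add: ennreal_mult)
    also have "\<dots> < ennreal 1" using K0 \<theta> by (subst ennreal_less_iff) auto
    finally show ?thesis by (simp add: P_def)
  qed
  have step: "\<exists>x'. P (Suc n) x' \<and> dist x x' + r0 * c ^ Suc n \<le> r0 * c ^ n" if P: "P n x" for n x
  proof -
    define \<rho> where "\<rho> = r0 * c ^ n"
    have \<rho>: "0 < \<rho>" "\<rho> \<le> r0" "c * \<rho> \<le> \<rho> / 2"
      using r0 lam by (auto simp: \<rho>_def power_le_one mult_left_le)
    have Suc\<rho>: "r0 * c ^ Suc n = c * \<rho>" by (simp add: \<rho>_def)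
    obtain S where S: "finite S" "card S = N" "S \<subseteq> cball x (\<rho> / 2)"
      and sep: "\<And>u v. u \<in> S \<Longrightarrow> v \<in> S \<Longrightarrow> u \<noteq> v \<Longrightarrow> 3 * c * \<rho> < dist u v"
      using pack[of x \<rho> N] P \<rho> r0 lam unfolding P_def
      by (metis add_increasing2 add_le_cancel_right dist_commute less_imp_le mem_cball order_trans \<rho>_def le_add_same_cancel1 add_le_same_cancel1)
    have sub: "cball u (c * \<rho>) \<subseteq> cball x \<rho>" if "u \<in> S" for u
    proof
      fix v assume "v \<in> cball u (c * \<rho>)"
      then have "dist u v \<le> c * \<rho>" by simp
      moreover have "dist x u \<le> \<rho> / 2" using S(3) that by auto
      ultimately show "v \<in> cball x \<rho>" using \<rho>(3) dist_triangle[of x v u] by simp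
    qed
    \<comment> \<open>A set of level above \<open>n\<close> has diameter at most
      \<open>c * \<rho>\<close> and meets one child only, as the centres are more than
      \<open>3 * c * \<rho>\<close> apart. A coarser set is charged at most the mass of each child,
      in sum the mass of the parent.\<close>
    have per_i: "(\<Sum>u\<in>S. \<mu> i (Suc n) u) \<le> \<mu> i n x" for i
    proof (cases "\<exists>u\<in>S. U i \<inter> cball u (c * \<rho>) \<noteq> {}")
      case False
      then have "(\<Sum>u\<in>S. \<mu> i (Suc n) u) = 0" by (intro sum.neutral) (auto simp: \<mu>_def mult_ac \<rho>_def)
      then show ?thesis using \<mu>0 by simp
    next
      case True
      then obtain u where u: "u \<in> S" "U i \<inter> cball u (c * \<rho>) \<noteq> {}" by blast
      then have ne: "U i \<inter> cball x \<rho> \<noteq> {}" using sub by blast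
      then have \<mu>x: "\<mu> i n x = (1 / real N) ^ max n (l i)" by (simp add: \<mu>_def \<rho>_def)
      show ?thesis
      proof (cases "Suc n \<le> l i")
        case True
        have "U i \<inter> cball v (c * \<rho>) = {}" if v: "v \<in> S - {u}" for v
        proof (rule ccontr)
          assume "U i \<inter> cball v (c * \<rho>) \<noteq> {}"
          then obtain a b where ab: "a \<in> U i" "dist u a \<le> c * \<rho>" "b \<in> U i" "dist v b \<le> c * \<rho>" using u by auto
          have "dist a b \<le> diameter (U i)" using U(2) ab by (intro diameter_bounded_bound) auto
          also have "\<dots> \<le> s i" by (rule diam)
          also have "\<dots> \<le> r0 * c ^ l i" using l(1)[of i] by simp
          also have "\<dots> \<le> r0 * c ^ Suc n" using True r0 lam by (intro mult_left_mono power_decreasing) auto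
          finally have "dist a b \<le> c * \<rho>" unfolding Suc\<rho> .
          then have "dist u v \<le> 3 * c * \<rho>"
            using ab dist_triangle[of u v a] dist_triangle[of a v b] by (simp add: dist_commute)
          then show False using sep[of u v] u v by auto
        qed
        then have "(\<Sum>v\<in>S - {u}. \<mu> i (Suc n) v) = 0" by (intro sum.neutral) (auto simp: \<mu>_def mult_ac \<rho>_def)
        then have "(\<Sum>v\<in>S. \<mu> i (Suc n) v) = \<mu> i (Suc n) u" using S(1) u by (simp add: sum.remove)
        also have "\<dots> \<le> \<mu> i n x" unfolding \<mu>x using True by (simp add: \<mu>_def max_def)
        finally show ?thesis .
      next
        case False
        have "(\<Sum>v\<in>S. \<mu> i (Suc n) v) \<le> (\<Sum>v\<in>S. (1 / real N) ^ Suc n)"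
          using False by (intro sum_mono) (auto simp: \<mu>_def max_def)
        also have "\<dots> = (1 / real N) ^ n" using S N0 by simp
        moreover have "max n (l i) = n" using False by simp
        ultimately show ?thesis unfolding \<mu>x by simp
      qed
    qed
    have "\<exists>u\<in>S. (\<Sum>i. ennreal (\<mu> i (Suc n) u)) < ennreal ((1 / real N) ^ Suc n)"
    proof (rule ccontr)
      assume "\<not> ?thesis"
      then have "(\<Sum>u\<in>S. ennreal ((1 / real N) ^ Suc n)) \<le> (\<Sum>u\<in>S. \<Sum>i. ennreal (\<mu> i (Suc n) u))"
        by (intro sum_mono) (auto simp: not_less)
      also have "\<dots> = (\<Sum>i. \<Sum>u\<in>S. ennreal (\<mu> i (Suc n) u))" by (subst suminf_sum) (auto intro: summableI)
      also have "\<dots> = (\<Sum>i. ennreal (\<Sum>u\<in>S. \<mu> i (Suc n) u))" using \<mu>0 by (simp add: sum_ennreal)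
      also have "\<dots> \<le> (\<Sum>i. ennreal (\<mu> i n x))" using per_i by (intro suminf_le ennreal_leI summableI) auto
      also have "\<dots> < ennreal ((1 / real N) ^ n)" using P by (simp add: P_def)
      also have "ennreal ((1 / real N) ^ n) = (\<Sum>u\<in>S. ennreal ((1 / real N) ^ Suc n))"
        using S N0 by (subst sum_ennreal) auto
      finally show False by simp
    qed
    then obtain u where u: "u \<in> S" "(\<Sum>i. ennreal (\<mu> i (Suc n) u)) < ennreal ((1 / real N) ^ Suc n)" by blast
    have "dist x u \<le> \<rho> / 2" using u S(3) by auto
    then have du: "dist x u + c * \<rho> \<le> \<rho>" using \<rho>(3) by linarith
    moreover have "dist x0 u + c * \<rho> \<le> r0" using du P dist_triangle[of x0 u x] by (simp add: P_def \<rho>_def)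
    ultimately show ?thesis using u unfolding P_def Suc\<rho> \<rho>_def[symmetric] by blast
  qed
  obtain f where f: "\<And>n. P n (f n)" "\<And>n. dist (f n) (f (Suc n)) + r0 * c ^ Suc n \<le> r0 * c ^ n"
    using dependent_nat_choice[of P "\<lambda>n x y. dist x y + r0 * c ^ Suc n \<le> r0 * c ^ n"] \<open>P 0 x0\<close> step by metis
  have nest: "dist (f n) (f (n + k)) + r0 * c ^ (n + k) \<le> r0 * c ^ n" for n k
  proof (induction k)
    case (Suc k)
    show ?case using Suc f(2)[of "n + k"] dist_triangle[of "f n" "f (n + Suc k)" "f (n + k)"] by simp
  qed simp
  have dle: "dist (f n) (f m) \<le> r0 * c ^ n" if "n \<le> m" for n m
  proof -
    have "0 \<le> r0 * c ^ m" using r0 lam by simp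
    then show ?thesis using nest[of n "m - n"] that by simp
  qed
  have "Cauchy f"
  proof (rule metric_CauchyI)
    fix e :: real assume "e > 0"
    have "(\<lambda>n. r0 * c ^ n) \<longlonglongrightarrow> r0 * 0" using lam by (intro tendsto_intros LIMSEQ_realpow_zero) auto
    then have "eventually (\<lambda>n. r0 * c ^ n < e / 2) sequentially" using \<open>e > 0\<close> by (intro order_tendstoD(2)) auto
    then obtain M where M: "r0 * c ^ M < e / 2" by (auto simp: eventually_sequentially)
    show "\<exists>M. \<forall>m\<ge>M. \<forall>n\<ge>M. dist (f m) (f n) < e"
      using M dle[of M] by (intro exI[of _ M]) (metis dist_commute dist_triangle_half_l le_less_trans)
  qed
  then obtain x where x: "f \<longlonglongrightarrow> x" using complete unfolding complete_def by auto
  have xin: "x \<in> cball (f n) (r0 * c ^ n)" for n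
  proof (rule Lim_in_closed_set[OF closed_cball _ _ x])
    show "eventually (\<lambda>m. f m \<in> cball (f n) (r0 * c ^ n)) sequentially"
      unfolding eventually_sequentially using dle[of n] by (intro exI[of _ n]) auto
  qed simp
  \<comment> \<open>The set containing the limit meets the ball of its own level and is charged all
    of its mass, against the strict bound in \<open>P\<close>.\<close>
  obtain i where i: "x \<in> U i" using U(1) by blast
  then have "\<mu> i (l i) (f (l i)) = (1 / real N) ^ l i" using xin[of "l i"] by (auto simp: \<mu>_def)
  then have "ennreal ((1 / real N) ^ l i) \<le> (\<Sum>j. ennreal (\<mu> j (l i) (f (l i))))"
    using sum_le_suminf[OF summableI, of "{i}" "\<lambda>j. ennreal (\<mu> j (l i) (f (l i)))"] by simp
  then show False using f(1)[of "l i"] unfolding P_def by (meson leD)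
qed

lemma not_compact_cball_separated:
  fixes p :: "'a::metric_space"
  assumes "complete (UNIV :: 'a set)" "\<not> compact (cball p R)"
  obtains \<epsilon> X where "\<epsilon> > 0" "infinite X" "X \<subseteq> cball p R" "\<And>u v. u \<in> X \<Longrightarrow> v \<in> X \<Longrightarrow> u \<noteq> v \<Longrightarrow> \<epsilon> \<le> dist u v"
proof -
  have "complete (cball p R)" using assms(1) by (metis closed_cball complete_closed_subset top_greatest)
  then obtain \<epsilon> where \<epsilon>: "\<epsilon> > 0" "\<And>k. finite k \<Longrightarrow> \<not> cball p R \<subseteq> (\<Union>x\<in>k. ball x \<epsilon>)"
    using assms(2) unfolding compact_eq_totally_bounded by metis
  have "\<exists>x. \<forall>n::nat. x n \<in> cball p R \<and> (\<forall>m<n. \<epsilon> \<le> dist (x m) (x n))"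
  proof (rule dependent_wellorder_choice)
    fix n and x :: "nat \<Rightarrow> 'a"
    have "\<not> cball p R \<subseteq> (\<Union>u\<in>x ` {..<n}. ball u \<epsilon>)" by (intro \<epsilon>(2)) simp
    then show "\<exists>r. r \<in> cball p R \<and> (\<forall>m<n. \<epsilon> \<le> dist (x m) r)" by (fastforce simp: not_less)
  qed auto
  then obtain x :: "nat \<Rightarrow> 'a" where x: "\<And>n. x n \<in> cball p R" "\<And>m n. m < n \<Longrightarrow> \<epsilon> \<le> dist (x m) (x n)"
    by blast
  have sep: "\<epsilon> \<le> dist (x m) (x n)" if "m \<noteq> n" for m n
    using that x(2)[of m n] x(2)[of n m] by (cases m n rule: linorder_cases) (auto simp: dist_commute)
  have "inj x" using sep \<epsilon>(1) by (intro injI) (metis dist_self not_le)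
  then have "infinite (range x)" by (rule range_inj_infinite)
  then show thesis
  proof (rule that[OF \<epsilon>(1)])
    show "range x \<subseteq> cball p R" using x(1) by auto
    fix u v assume "u \<in> range x" "v \<in> range x" "u \<noteq> v"
    then show "\<epsilon> \<le> dist u v" using sep by (metis rangeE)
  qed
qed

text \<open>Seen from \<open>y\<close>, infinitely many points of \<open>X\<close> lie in one thin
  shell; they are moved to a common distance \<open>R\<close> and contracted to distance
  \<open>t * R\<close>. The separation constant depends on neither \<open>y\<close>,
  \<open>\<rho>\<close> nor \<open>N\<close>, as the Cantor construction requires.\<close>

lemma quad_cond_packing:
  fixes p :: "'a::metric_space"
  assumes "intrinsic_metric TYPE('a)"
    and quad: "quad_cond k (ball p r)" and k: "k > 0" "k * (2 * r) \<le> 1"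
    and R0: "R0 > 0" "8 * R0 \<le> r"
    and X: "\<epsilon> > 0" "infinite X" "X \<subseteq> cball p R0" "\<And>u v. u \<in> X \<Longrightarrow> v \<in> X \<Longrightarrow> u \<noteq> v \<Longrightarrow> \<epsilon> \<le> dist u v"
    and y: "y \<in> cball p R0" and \<rho>: "0 < \<rho>" "\<rho> \<le> R0"
  shows "\<exists>S. finite S \<and> card S = N \<and> S \<subseteq> cball y (\<rho> / 2) \<and>
    (\<forall>u\<in>S. \<forall>v\<in>S. u \<noteq> v \<longrightarrow> 3 * (\<epsilon> / (128 * R0)) * \<rho> < dist u v)"
proof -
  have py: "dist p y \<le> R0" using y by simp
  have X2: "dist y x \<le> 2 * R0" if "x \<in> X" for x
    using X(3) that py dist_triangle_base[of y x p] by (auto simp: subset_iff)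
  \<comment> \<open>Shell width \<open>\<epsilon> / 16\<close> and path error at most
    \<open>\<epsilon> / 8\<close> move each point by at most \<open>3 * \<epsilon> / 16\<close>, so
    a separation of \<open>\<epsilon> / 2\<close> is left.\<close>
  define j where "j x = \<lfloor>dist y x / (\<epsilon> / 16)\<rfloor>" for x
  have "j x \<in> {0..\<lfloor>2 * R0 / (\<epsilon> / 16)\<rfloor>}" if "x \<in> X" for x
    using X2[OF that] X(1) by (auto simp: j_def intro!: floor_mono divide_right_mono)
  then have "j ` X \<subseteq> {0..\<lfloor>2 * R0 / (\<epsilon> / 16)\<rfloor>}" by blast
  then have "finite (j ` X)" by (rule finite_subset) simp
  then obtain a0 where a0: "a0 \<in> X" "infinite {a \<in> X. j a = j a0}" using pigeonhole_infinite[OF X(2)] by blast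
  define X' where "X' = {a \<in> X. j a = j a0}"
  have X': "infinite X'" "X' \<subseteq> X" using a0 by (auto simp: X'_def)
  define R where "R = of_int (j a0) * (\<epsilon> / 16)"
  have RX: "R \<le> dist y x" "dist y x < R + \<epsilon> / 16" if "x \<in> X'" for x
  proof -
    have "of_int (j a0) \<le> dist y x / (\<epsilon> / 16)" "dist y x / (\<epsilon> / 16) < of_int (j a0) + 1"
      using that floor_correct[of "dist y x / (\<epsilon> / 16)"] by (auto simp: X'_def j_def)
    then show "R \<le> dist y x" "dist y x < R + \<epsilon> / 16" using X(1) by (auto simp: R_def field_simps)
  qed
  have a0': "a0 \<in> X'" using a0 by (simp add: X'_def)
  obtain a1 where a1: "a1 \<in> X'" "a1 \<noteq> a0" using X'(1) by (metis finite.emptyI finite.insertI finite_subset singletonI subsetI insertCI)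
  have R: "R > 0" "R \<le> 2 * R0" "\<epsilon> \<le> 4 * R0"
  proof -
    have "\<epsilon> \<le> dist a1 a0" using a0 a1 X' X(4)[of a1 a0] by auto
    then have \<epsilon>le: "\<epsilon> \<le> dist y a1 + dist y a0" using dist_triangle_base[of a1 a0 y] by linarith
    then show "R > 0" using RX[OF a0'] RX[OF a1(1)] X(1) by linarith
    show "R \<le> 2 * R0" using RX(1)[OF a0'] X2[OF a0(1)] by linarith
    show "\<epsilon> \<le> 4 * R0" using \<epsilon>le X2[OF a0(1)] X2[of a1] X'(2) a1 by auto
  qed
  \<comment> \<open>As \<open>R \<le> 2 * R0\<close>, the contracted points lie within
    \<open>\<rho> / 2\<close> of \<open>y\<close>; their separation
    \<open>t * \<epsilon> / 8\<close> is \<open>4 * \<epsilon> * \<rho> / (128 * R0)\<close>, just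
    above the factor 3 demanded.\<close>
  define t where "t = \<rho> / (4 * R0)"
  have t: "0 < t" "t \<le> 1 / 4" using \<rho> R0 by (auto simp: t_def field_simps)
  have kr: "k * R \<le> 1" "k * (\<epsilon> / 2) \<le> 1"
  proof -
    have "k * R \<le> k * (2 * r)" "k * (\<epsilon> / 2) \<le> k * (2 * r)"
      using k(1) R R0 by (intro mult_left_mono; linarith)+
    then show "k * R \<le> 1" "k * (\<epsilon> / 2) \<le> 1" using k(2) by linarith+
  qed
  obtain e0 where e0: "e0 > 0" and hom: "\<And>y x1 x2 x1' x2'. {y, x1, x2, x1', x2'} \<subseteq> ball p r \<Longrightarrow>
      dist y x1 = R \<Longrightarrow> dist y x2 = R \<Longrightarrow> dist y x1' = t * R \<Longrightarrow> dist y x2' = t * R \<Longrightarrow>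
      dist x1' x1 \<le> (1 - t) * R + e0 \<Longrightarrow> dist x2' x2 \<le> (1 - t) * R + e0 \<Longrightarrow>
      \<epsilon> / 2 \<le> dist x1 x2 \<Longrightarrow> t * (\<epsilon> / 2) / 4 \<le> dist x1' x2'"
    using approx_homothety[OF quad k R(1) kr(1) t(1), of "\<epsilon> / 2"] t X(1) kr(2) by auto
  define e where "e = min e0 (\<epsilon> / 8)"
  have e: "e > 0" "e \<le> e0" "e \<le> \<epsilon> / 8" using e0 X(1) by (auto simp: e_def)
  have "\<exists>\<sigma>. (\<forall>s\<in>{0..dist y x}. dist y (\<sigma> s) = s) \<and> \<sigma> (dist y x) = x \<and>
      (\<forall>s\<in>{0..dist y x}. \<forall>s'\<in>{0..dist y x}. dist (\<sigma> s) (\<sigma> s') \<le> \<bar>s - s'\<bar> + e)" for x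
    using intrinsic_almost_geodesic[OF assms(1) e(1), of y x] by metis
  then obtain \<sigma> where \<sigma>: "\<And>x s. s \<in> {0..dist y x} \<Longrightarrow> dist y (\<sigma> x s) = s" "\<And>x. \<sigma> x (dist y x) = x"
      "\<And>x s s'. s \<in> {0..dist y x} \<Longrightarrow> s' \<in> {0..dist y x} \<Longrightarrow> dist (\<sigma> x s) (\<sigma> x s') \<le> \<bar>s - s'\<bar> + e"
    by metis
  have tR: "0 < t * R" "t * R \<le> R" "t * R \<le> \<rho> / 2"
  proof -
    show "0 < t * R" using t R by simp
    show "t * R \<le> R" using t R by (simp add: mult_le_cancel_right1)
    have "t * R \<le> t * (2 * R0)" using t R by (intro mult_left_mono) auto
    then show "t * R \<le> \<rho> / 2" using R0 by (simp add: t_def)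
  qed
  have sep: "3 * (\<epsilon> / (128 * R0)) * \<rho> < dist (\<sigma> u (t * R)) (\<sigma> v (t * R))"
    if uv: "u \<in> X'" "v \<in> X'" "u \<noteq> v" for u v
  proof -
    have in1: "R \<in> {0..dist y x}" "t * R \<in> {0..dist y x}" "dist y x \<in> {0..dist y x}" if "x \<in> X'" for x
      using RX[OF that] R tR by auto
    have d: "dist y (\<sigma> x R) = R" "dist y (\<sigma> x (t * R)) = t * R" if "x \<in> X'" for x
      using in1[OF that] \<sigma>(1) by auto
    have near: "dist (\<sigma> x (t * R)) (\<sigma> x R) \<le> (1 - t) * R + e0" if "x \<in> X'" for x
      using \<sigma>(3)[OF in1(2,1)[OF that]] tR e by (simp add: algebra_simps)
    have close: "dist (\<sigma> x R) x \<le> \<epsilon> / 16 + \<epsilon> / 8" if "x \<in> X'" for x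
      using \<sigma>(3)[OF in1(1,3)[OF that]] \<sigma>(2)[of x] RX[OF that] e by auto
    have "\<epsilon> \<le> dist u v" using X(4) X' uv by blast
    also have "\<dots> \<le> dist (\<sigma> u R) u + dist (\<sigma> u R) (\<sigma> v R) + dist (\<sigma> v R) v"
      using dist_triangle[of u v "\<sigma> u R"] dist_triangle[of "\<sigma> u R" v "\<sigma> v R"] by (simp add: dist_commute)
    finally have "\<epsilon> / 2 \<le> dist (\<sigma> u R) (\<sigma> v R)" using close[OF uv(1)] close[OF uv(2)] X(1) by linarith
    moreover have "{y, \<sigma> u R, \<sigma> v R, \<sigma> u (t * R), \<sigma> v (t * R)} \<subseteq> ball p r"
    proof -
      have "z \<in> ball p r" if "dist y z \<le> R" for z
        using that py R R0 dist_triangle[of p z y] by simp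
      then show ?thesis using d uv tR R by auto
    qed
    ultimately have "t * (\<epsilon> / 2) / 4 \<le> dist (\<sigma> u (t * R)) (\<sigma> v (t * R))"
      using hom[of y "\<sigma> u R" "\<sigma> v R" "\<sigma> u (t * R)" "\<sigma> v (t * R)"] d near uv by auto
    moreover have "3 * (\<epsilon> / (128 * R0)) * \<rho> < t * (\<epsilon> / 2) / 4"
      using X(1) \<rho> R0 by (simp add: t_def field_simps)
    ultimately show ?thesis by linarith
  qed
  obtain S0 where S0: "S0 \<subseteq> X'" "finite S0" "card S0 = N" using infinite_arbitrarily_large[OF X'(1)] by blast
  define S where "S = (\<lambda>x. \<sigma> x (t * R)) ` S0"
  have "0 < 3 * (\<epsilon> / (128 * R0)) * \<rho>" using X(1) \<rho> R0 by simp
  then have inj: "inj_on (\<lambda>x. \<sigma> x (t * R)) S0"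
    using sep S0 by (intro inj_onI) (metis dist_self less_asym subsetD)
  have "S \<subseteq> cball y (\<rho> / 2)"
  proof -
    have "dist y (\<sigma> x (t * R)) = t * R" if "x \<in> S0" for x
      using that S0 RX[of x] tR by (intro \<sigma>(1)) auto
    then show ?thesis using tR by (auto simp: S_def)
  qed
  moreover have "\<forall>u\<in>S. \<forall>v\<in>S. u \<noteq> v \<longrightarrow> 3 * (\<epsilon> / (128 * R0)) * \<rho> < dist u v"
    unfolding S_def using sep S0 by (auto simp: subset_iff)
  moreover have "finite S" "card S = N" using S0 inj by (auto simp: S_def card_image)
  ultimately show ?thesis by blast
qed

section \<open>Hopf-Rinow: compact balls and minimal geodesics\<close>

lemma intrinsic_near_smaller_ball:
  fixes p :: "'a::metric_space"
  assumes "intrinsic_metric TYPE('a)" "0 \<le> s" "0 \<le> d" "d < \<delta>" "dist p z \<le> s + d"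
  obtains x where "dist p x \<le> s" "dist x z < \<delta>"
proof -
  define e where "e = (\<delta> - d) / 2"
  have "\<delta> - d = 2 * e" by (simp add: e_def)
  then have e: "0 < e" "d + e < \<delta>" using assms(4) by linarith+
  then obtain \<sigma> where \<sigma>: "\<sigma> (dist p z) = z" "\<And>t. t \<in> {0..dist p z} \<Longrightarrow> dist p (\<sigma> t) = t"
    "\<And>t t'. t \<in> {0..dist p z} \<Longrightarrow> t' \<in> {0..dist p z} \<Longrightarrow> dist (\<sigma> t) (\<sigma> t') \<le> \<bar>t - t'\<bar> + e"
    using intrinsic_almost_geodesic[OF assms(1), of e p z] by metis
  define t where "t = min s (dist p z)"
  have t: "t \<in> {0..dist p z}" "t \<le> s" "dist p z \<le> t + d" using assms by (auto simp: t_def min_def)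
  have "dist (\<sigma> t) z \<le> (dist p z - t) + e" using \<sigma>(3)[OF t(1), of "dist p z"] \<sigma>(1) t(1) by simp
  then have "dist (\<sigma> t) z < \<delta>" using t(3) e(2) by linarith
  then show thesis using that[of "\<sigma> t"] \<sigma>(2)[OF t(1)] t(2) by simp
qed

text \<open>Finitely many compact balls cover a \<open>\<delta>\<close>-neighbourhood of the ball,
  and in an intrinsic metric that neighbourhood contains a larger concentric ball.\<close>

lemma cball_compact_extend:
  fixes p :: "'a::metric_space"
  assumes "intrinsic_metric TYPE('a)" and s: "s > 0"
    and c: "compact (cball p s)" and loc: "\<And>x::'a. \<exists>r>0. compact (cball x r)"
  shows "\<exists>s'>s. compact (cball p s')"
proof -
  obtain r where r: "\<And>x::'a. r x > 0" "\<And>x. compact (cball x (r x))" using loc by metis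
  have "cball p s \<subseteq> (\<Union>x\<in>cball p s. ball x (r x))"
  proof
    fix x assume "x \<in> cball p s"
    then show "x \<in> (\<Union>x\<in>cball p s. ball x (r x))" using r(1)[of x] by (intro UN_I[of x]) auto
  qed
  then obtain C where C: "C \<subseteq> cball p s" "finite C" "cball p s \<subseteq> (\<Union>x\<in>C. ball x (r x))"
    using compactE_image[OF c, of "cball p s" "\<lambda>x. ball x (r x)"] by (metis open_ball)
  obtain \<delta> where \<delta>: "\<delta> > 0" "(\<Union>x\<in>cball p s. ball x \<delta>) \<subseteq> (\<Union>x\<in>C. ball x (r x))"
    using compact_subset_open_imp_ball_epsilon_subset[OF c _ C(3)] by blast
  have "cball p (s + \<delta> / 2) \<subseteq> (\<Union>x\<in>C. cball x (r x))"
  proof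
    fix z assume z: "z \<in> cball p (s + \<delta> / 2)"
    then obtain x where "dist p x \<le> s" "dist x z < \<delta>"
      using intrinsic_near_smaller_ball[OF assms(1), of s "\<delta> / 2" \<delta> p z] s \<delta>(1) by auto
    then have "z \<in> (\<Union>x\<in>cball p s. ball x \<delta>)" by auto
    then have "z \<in> (\<Union>x\<in>C. ball x (r x))" using \<delta>(2) by blast
    then show "z \<in> (\<Union>x\<in>C. cball x (r x))" by (meson UN_iff mem_ball mem_cball less_imp_le)
  qed
  moreover have "compact (\<Union>x\<in>C. cball x (r x))" using C(2) r(2) by (intro compact_UN) auto
  ultimately have "compact (cball p (s + \<delta> / 2))"
    by (metis closed_cball compact_Int_closed inf.absorb_iff2)
  then show ?thesis using \<delta>(1) by (intro exI[of _ "s + \<delta> / 2"]) auto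
qed

lemma cball_compact_limit:
  fixes p :: "'a::metric_space"
  assumes "intrinsic_metric TYPE('a)" "complete (UNIV :: 'a set)" and s: "s > 0"
    and c: "\<And>R. 0 < R \<Longrightarrow> R < s \<Longrightarrow> compact (cball p R)"
  shows "compact (cball p s)"
  unfolding compact_eq_totally_bounded
proof (intro conjI allI impI)
  show "complete (cball p s)" using assms(2) by (metis closed_cball complete_closed_subset top_greatest)
  fix \<epsilon> :: real assume \<epsilon>: "\<epsilon> > 0"
  define R where "R = max (s / 2) (s - \<epsilon> / 3)"
  have R: "0 < R" "R < s" "s - R \<le> \<epsilon> / 3" using s \<epsilon> unfolding R_def by linarith+
  have "0 < \<epsilon> / 3" using \<epsilon> by simp
  then obtain K where K: "finite K" "cball p R \<subseteq> (\<Union>x\<in>K. ball x (\<epsilon> / 3))"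
    using c[OF R(1,2)] unfolding compact_eq_totally_bounded by blast
  have "cball p s \<subseteq> (\<Union>x\<in>K. ball x \<epsilon>)"
  proof
    fix z assume z: "z \<in> cball p s"
    then obtain u where u: "dist p u \<le> R" and d: "dist u z < \<epsilon> / 2"
      using intrinsic_near_smaller_ball[OF assms(1), of R "\<epsilon> / 3" "\<epsilon> / 2" p z] R \<epsilon> by auto
    then have "u \<in> cball p R" by simp
    then obtain x where x: "x \<in> K" "dist x u < \<epsilon> / 3" using K(2) by auto
    then have "dist x z < \<epsilon>" using d \<epsilon> dist_triangle[of x z u] by linarith
    then show "z \<in> (\<Union>x\<in>K. ball x \<epsilon>)" using x by auto
  qed
  then show "\<exists>K. finite K \<and> cball p s \<subseteq> (\<Union>x\<in>K. ball x \<epsilon>)" using K(1) by blast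
qed

text \<open>The supremum of the radii with compact ball, if finite, is attained by
  \<open>cball_compact_limit\<close> and exceeded by \<open>cball_compact_extend\<close>.\<close>

lemma hopf_rinow_proper:
  fixes p :: "'a::metric_space"
  assumes "intrinsic_metric TYPE('a)" "complete (UNIV :: 'a set)"
    and loc: "\<And>x::'a. \<exists>r>0. compact (cball x r)"
  shows "compact (cball p R)"
proof (rule ccontr)
  assume nc: "\<not> compact (cball p R)"
  have mono: "compact (cball p a)" if "compact (cball p b)" "a \<le> b" for a b
    using that by (metis closed_cball compact_Int_closed inf.absorb_iff2 subset_cball)
  define A where "A = {a. a > 0 \<and> compact (cball p a)}"
  obtain r where r: "r \<in> A" using loc[of p] by (auto simp: A_def)
  have ub: "a \<le> R" if "a \<in> A" for a using that nc mono[of a R] by (force simp: A_def)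
  then have bdd: "bdd_above A" by (rule bdd_aboveI)
  define s where "s = Sup A"
  have s: "r \<le> s" using cSup_upper[OF r bdd] by (simp add: s_def)
  have "compact (cball p s)"
  proof (rule cball_compact_limit[OF assms(1,2)])
    show "s > 0" using s r by (simp add: A_def)
    fix a assume "0 < a" "a < s"
    then obtain b where "b \<in> A" "a < b" using less_cSupD[of A a] r unfolding s_def by auto
    then show "compact (cball p a)" using mono[of b a] by (simp add: A_def)
  qed
  then obtain s' where "s' > s" "compact (cball p s')"
    using cball_compact_extend[OF assms(1) _ _ loc, of s p] s r by (auto simp: A_def)
  then have "s' \<in> A" using s r by (simp add: A_def)
  then show False using cSup_upper[OF _ bdd, of s'] \<open>s' > s\<close> by (simp add: s_def)
qed

text \<open>Almost geodesics need not be continuous, so compactness comes from Tychonoff's theorem,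
  and convergence is along a filter because the index type may be uncountable.\<close>

lemma pointwise_cluster_point:
  fixes f :: "nat \<Rightarrow> 'b \<Rightarrow> 'a::metric_space"
  assumes "compact K" "\<And>n s. f n s \<in> K"
  obtains G h where "G \<noteq> bot" "G \<le> sequentially" "\<And>s. ((\<lambda>n. f n s) \<longlongrightarrow> h s) G"
proof -
  have "compactin (product_topology (\<lambda>i::'b. euclidean :: 'a topology) UNIV) (PiE UNIV (\<lambda>_. K))"
    using assms(1) by (simp add: compactin_PiE)
  then have cpt: "compact (PiE (UNIV :: 'b set) (\<lambda>_. K))" by (simp add: euclidean_product_topology)
  have "eventually (\<lambda>x. x \<in> PiE UNIV (\<lambda>_. K)) (filtermap f sequentially)"
    using assms(2) by (simp add: eventually_filtermap PiE_def)
  moreover have "filtermap f sequentially \<noteq> bot" by (simp add: filtermap_bot_iff)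
  ultimately obtain h where h: "inf (nhds h) (filtermap f sequentially) \<noteq> bot"
    using cpt unfolding compact_filter by blast
  define G where "G = inf sequentially (filtercomap f (nhds h))"
  have lim: "(f \<longlongrightarrow> h) G"
    unfolding G_def by (meson filterlim_filtercomap filterlim_iff inf_le2 filterlim_mono order_refl)
  have "G \<noteq> bot"
  proof
    assume "G = bot"
    then have "eventually (\<lambda>_. False) G" by simp
    then obtain Q R where QR: "eventually Q sequentially" "eventually R (nhds h)" "\<And>n. Q n \<Longrightarrow> R (f n) \<Longrightarrow> False"
      unfolding G_def eventually_inf eventually_filtercomap by blast
    have "eventually (\<lambda>_. False) (inf (nhds h) (filtermap f sequentially))"
      unfolding eventually_inf
    proof (intro exI conjI allI impI)
      show "eventually R (nhds h)" by fact
      show "eventually (\<lambda>g. \<exists>n. Q n \<and> g = f n) (filtermap f sequentially)"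
        unfolding eventually_filtermap using QR(1) by (auto elim: eventually_mono)
    qed (use QR(3) in blast)
    then show False using h by (simp add: eventually_False)
  qed
  moreover have "G \<le> sequentially" by (simp add: G_def)
  moreover have "((\<lambda>n. f n s) \<longlongrightarrow> h s) G" for s
  proof -
    show ?thesis
      by (rule continuous_on_tendsto_compose[OF continuous_on_product_coordinates lim]) auto
  qed
  ultimately show thesis using that by blast
qed

text \<open>A pointwise cluster point of ever better almost geodesics: the error bounds give
  \<open>dist (h s) (h t) \<le> \<bar>s - t\<bar>\<close> in the limit, the exact distances from
  \<open>x\<close> the reverse.\<close>

lemma exists_minimal_geodesic:
  fixes x y :: "'a::metric_space"
  assumes "intrinsic_metric TYPE('a)" and proper: "\<And>R. compact (cball x R)"
  obtains \<gamma> where "minimal_geodesic x y \<gamma>"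
proof -
  define d where "d = dist x y"
  have "\<exists>\<sigma>. \<sigma> 0 = x \<and> \<sigma> d = y \<and> (\<forall>s\<in>{0..d}. dist x (\<sigma> s) = s) \<and>
      (\<forall>s\<in>{0..d}. \<forall>s'\<in>{0..d}. dist (\<sigma> s) (\<sigma> s') \<le> \<bar>s - s'\<bar> + 1 / real (Suc n))" for n
    using intrinsic_almost_geodesic[OF assms(1), of "1 / real (Suc n)" x y] unfolding d_def
    by (metis of_nat_0_less_iff zero_less_Suc zero_less_divide_1_iff)
  then obtain \<sigma> where \<sigma>: "\<And>n. \<sigma> n 0 = x" "\<And>n. \<sigma> n d = y" "\<And>n s. s \<in> {0..d} \<Longrightarrow> dist x (\<sigma> n s) = s"
      "\<And>n s s'. s \<in> {0..d} \<Longrightarrow> s' \<in> {0..d} \<Longrightarrow> dist (\<sigma> n s) (\<sigma> n s') \<le> \<bar>s - s'\<bar> + 1 / real (Suc n)"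
    by metis
  define f where "f n s = (if s \<in> {0..d} then \<sigma> n s else x)" for n s
  have d: "d \<ge> 0" by (simp add: d_def)
  have "f n s \<in> cball x d" for n s using \<sigma>(3) d by (auto simp: f_def)
  then obtain G h where G: "G \<noteq> bot" "G \<le> sequentially" and h: "\<And>s. ((\<lambda>n. f n s) \<longlongrightarrow> h s) G"
    using pointwise_cluster_point[OF proper[of d], of f] by blast
  have lim0: "((\<lambda>n. 1 / real (Suc n)) \<longlongrightarrow> 0) G"
    using LIMSEQ_Suc[OF lim_1_over_n] G(2) by (rule tendsto_mono[rotated])
  have *: "h 0 = x" "h d = y"
    using h[of 0] h[of d] \<sigma>(1,2) d G(1) by (auto simp: f_def tendsto_const_iff)
  have hx: "dist x (h s) = s" if "s \<in> {0..d}" for s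
  proof -
    have "((\<lambda>n. dist x (f n s)) \<longlongrightarrow> dist x (h s)) G" by (intro tendsto_intros h)
    moreover have "(\<lambda>n. dist x (f n s)) = (\<lambda>n. s)" using \<sigma>(3)[OF that] that by (auto simp: f_def)
    ultimately show ?thesis using G(1) by (simp add: tendsto_const_iff)
  qed
  have "dist (h s) (h t) = \<bar>s - t\<bar>" if st: "s \<in> {0..d}" "t \<in> {0..d}" for s t
  proof (rule antisym)
    have 1: "((\<lambda>n. dist (f n s) (f n t)) \<longlongrightarrow> dist (h s) (h t)) G" by (intro tendsto_intros h)
    have 2: "((\<lambda>n. \<bar>s - t\<bar> + 1 / real (Suc n)) \<longlongrightarrow> \<bar>s - t\<bar> + 0) G" by (intro tendsto_intros lim0)
    have "eventually (\<lambda>n. dist (f n s) (f n t) \<le> \<bar>s - t\<bar> + 1 / real (Suc n)) G"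
      using \<sigma>(4)[OF st] st by (auto simp: f_def)
    from tendsto_le[OF G(1) 2 1 this] show "dist (h s) (h t) \<le> \<bar>s - t\<bar>" by simp
    show "\<bar>s - t\<bar> \<le> dist (h s) (h t)"
      using abs_dist_diff[of x "h s" "h t"] hx st by simp
  qed
  then have "minimal_geodesic x y h" using * by (simp add: minimal_geodesic_def d_def)
  then show thesis by (rule that)
qed

section \<open>Approximate Stewart inequality and angles\<close>

text \<open>With \<open>C = 0\<close> and equality this is Stewart's theorem in the plane. As an
  inequality it bounds from below the distance of \<open>x\<close> to an inner point of a segment.
  Relative to \<open>dist y m * dist m z\<close> the error is quadratic in \<open>dist x m\<close>,
  so it vanishes for small triangles.\<close>

definition stewart_on :: "real \<Rightarrow> 'a::metric_space set \<Rightarrow> bool" where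
  "stewart_on C U \<longleftrightarrow> (\<forall>x\<in>U. \<forall>y\<in>U. \<forall>z\<in>U. \<forall>m\<in>U. dist y m + dist m z = dist y z \<longrightarrow>
     dist m z * (dist x y)\<^sup>2 + dist y m * (dist x z)\<^sup>2
       \<le> dist y z * ((dist x m)\<^sup>2 + (1 + C * (dist x m)\<^sup>2) * dist y m * dist m z))"

lemma stewart_onD:
  assumes "stewart_on C U" "x \<in> U" "y \<in> U" "z \<in> U" "m \<in> U" "dist y m + dist m z = dist y z"
  shows "dist m z * (dist x y)\<^sup>2 + dist y m * (dist x z)\<^sup>2
    \<le> dist y z * ((dist x m)\<^sup>2 + (1 + C * (dist x m)\<^sup>2) * dist y m * dist m z)"
  using assms unfolding stewart_on_def by blast

text \<open>For \<open>m\<close> on the segment the angle between its ends is \<open>pi\<close>, so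
  the two other cosines have nonnegative sum. Each exceeds the Euclidean one by at most
  \<open>6 * k\<^sup>2\<close> times its two sides; clearing denominators with
  \<open>2 * a * b1 * b2\<close> turns 6 into 12.\<close>

lemma stewart_of_quad_cond:
  fixes p :: "'a::metric_space"
  assumes quad: "quad_cond k (ball p r)" and k: "k > 0" "k * (2 * r) \<le> 1"
  shows "stewart_on (12 * k\<^sup>2) (ball p r)"
  unfolding stewart_on_def
proof (intro ballI impI)
  fix x y z m
  assume in_ball: "x \<in> ball p r" "y \<in> ball p r" "z \<in> ball p r" "m \<in> ball p r"
    and between: "dist y m + dist m z = dist y z"
  define a b1 b2 c1 c2 where "a = dist x m" "b1 = dist y m" "b2 = dist m z" "c1 = dist x y" "c2 = dist x z"
  note abc = a_b1_b2_c1_c2_def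
  have yz: "dist y z = b1 + b2" using between by (simp add: abc)
  have nn: "0 \<le> a" "0 \<le> b1" "0 \<le> b2" by (auto simp: abc)
  have extra: "0 \<le> 12 * k\<^sup>2 * a\<^sup>2 * b1 * b2 * (b1 + b2)" using nn by simp
  have "b2 * c1\<^sup>2 + b1 * c2\<^sup>2 \<le> (b1 + b2) * (a\<^sup>2 + b1 * b2) + 12 * k\<^sup>2 * a\<^sup>2 * b1 * b2 * (b1 + b2)"
  proof (cases "distinct [m, x, y, z]")
    case False
    then consider "m = y" | "m = z" | "y = z" | "x = m" | "x = y" | "x = z" by auto
    then have "b2 * c1\<^sup>2 + b1 * c2\<^sup>2 \<le> (b1 + b2) * (a\<^sup>2 + b1 * b2)"
    proof cases
      case 1
      then have "b1 = 0" "c1 = a" by (auto simp: abc)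
      then show ?thesis by simp
    next
      case 2
      then have "b2 = 0" "c2 = a" by (auto simp: abc)
      then show ?thesis by simp
    next
      case 3
      then have "b1 = 0" "b2 = 0" using yz nn by (auto simp: add_nonneg_eq_0_iff)
      then show ?thesis by simp
    next
      case 4
      then have "a = 0" "c1 = b1" "c2 = b2" by (auto simp: abc dist_commute)
      then show ?thesis by (simp add: algebra_simps power2_eq_square)
    next
      case 5
      then have "a = b1" "c1 = 0" "c2 = b1 + b2" using yz by (auto simp: abc dist_commute)
      then show ?thesis by (simp add: algebra_simps power2_eq_square)
    next
      case 6
      then have "a = b2" "c2 = 0" "c1 = b1 + b2" using yz by (auto simp: abc dist_commute)
      then show ?thesis by (simp add: algebra_simps power2_eq_square)
    qed
    then show ?thesis using extra by linarith
  next
    case True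
    then have pos: "0 < a" "0 < b1" "0 < b2" by (auto simp: abc)
    have small: "k * dist u v \<le> 1" if "u \<in> ball p r" "v \<in> ball p r" for u v
    proof -
      have "dist u v \<le> 2 * r" using that dist_triangle_base[of u v p] by simp
      then have "k * dist u v \<le> k * (2 * r)" using k(1) by (intro mult_left_mono) auto
      then show ?thesis using k(2) by linarith
    qed
    have "hcos k (dist m y) (dist m z) (dist y z) = -1"
    proof -
      have "sinh (k * b1) * sinh (k * b2) \<noteq> 0" using pos k by simp
      moreover have "dist m y = b1" "dist m z = b2" by (auto simp: abc dist_commute)
      ultimately show ?thesis unfolding hcos_def yz by (simp add: distrib_left cosh_add field_simps)
    qed
    then have "0 \<le> hcos k (dist m x) (dist m y) (dist x y) + hcos k (dist m x) (dist m z) (dist x z)"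
      using quad_cond_cos_sum[OF quad k(1) in_ball(4,1,2,3) True] by (simp add: hangle_def)
    then have sum: "0 \<le> hcos k a b1 c1 + hcos k a b2 c2" by (simp add: abc dist_commute)
    have le: "hcos k a b c \<le> ecos a b c + 6 * k\<^sup>2 * (a * b)"
      if "0 < b" "\<bar>a - b\<bar> \<le> c" "c \<le> a + b" "k * a \<le> 1" "k * b \<le> 1" for b c
    proof -
      have "(1 + ecos a b c) * (1 + 3 * k\<^sup>2 * (a * b)) \<le> (1 + ecos a b c) + 2 * (3 * k\<^sup>2 * (a * b))"
        using mult_right_mono[OF ecos_bounds(2)[OF pos(1) that(1,2,3)], of "3 * k\<^sup>2 * (a * b)"] pos that(1)
        by (simp add: algebra_simps)
      then show ?thesis using hcos_facts(4)[OF k(1) pos(1) that(1,2,3,4,5)] by linarith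
    qed
    have "hcos k a b1 c1 \<le> ecos a b1 c1 + 6 * k\<^sup>2 * (a * b1)"
      using pos small[OF in_ball(1,4)] small[OF in_ball(2,4)] abs_dist_diff[of m x y] dist_triangle_base[of x y m]
      by (intro le) (auto simp: abc dist_commute)
    moreover have "hcos k a b2 c2 \<le> ecos a b2 c2 + 6 * k\<^sup>2 * (a * b2)"
      using pos small[OF in_ball(1,4)] small[OF in_ball(4,3)] abs_dist_diff[of m x z] dist_triangle_base[of x z m]
      by (intro le) (auto simp: abc dist_commute)
    ultimately have "0 \<le> ecos a b1 c1 + ecos a b2 c2 + 6 * k\<^sup>2 * a * (b1 + b2)"
      using sum by (simp add: algebra_simps)
    then have "0 \<le> (ecos a b1 c1 + ecos a b2 c2 + 6 * k\<^sup>2 * a * (b1 + b2)) * (2 * a * b1 * b2)"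
      using pos by (intro mult_nonneg_nonneg) auto
    also have "\<dots> = b2 * (2 * a * b1 * ecos a b1 c1) + b1 * (2 * a * b2 * ecos a b2 c2)
        + 12 * k\<^sup>2 * a\<^sup>2 * b1 * b2 * (b1 + b2)"
      by (simp add: algebra_simps power2_eq_square)
    also have "2 * a * b1 * ecos a b1 c1 = a\<^sup>2 + b1\<^sup>2 - c1\<^sup>2" using pos by (simp add: ecos_def)
    also have "2 * a * b2 * ecos a b2 c2 = a\<^sup>2 + b2\<^sup>2 - c2\<^sup>2" using pos by (simp add: ecos_def)
    finally show ?thesis by (simp add: algebra_simps power2_eq_square)
  qed
  then show "dist m z * (dist x y)\<^sup>2 + dist y m * (dist x z)\<^sup>2
      \<le> dist y z * ((dist x m)\<^sup>2 + (1 + 12 * k\<^sup>2 * (dist x m)\<^sup>2) * dist y m * dist m z)"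
    unfolding yz abc[symmetric] by (simp add: algebra_simps)
qed

text \<open>Inside the locale only these facts about the space enter. \<open>C\<close> is global,
  while the radius of the Stewart ball depends on its centre.\<close>

locale stewart_space =
  fixes C :: real
  assumes C_nonneg: "0 \<le> C"
    and geodesic_exists: "\<exists>\<gamma>. minimal_geodesic (x::'a::metric_space) y \<gamma>"
    and proper: "compact (cball (x::'a) R)"
    and stewart_ex: "\<exists>r>0. stewart_on C (ball (p::'a) r)"
begin

text \<open>Unlike \<open>minimal_geodesic\<close> it leaves the endpoint unnamed, which eases
  restriction, and it excludes constant paths.\<close>

definition geo :: "'a \<Rightarrow> real \<Rightarrow> (real \<Rightarrow> 'a) \<Rightarrow> bool" where
  "geo p T \<gamma> \<longleftrightarrow> 0 < T \<and> \<gamma> 0 = p \<and> (\<forall>s\<in>{0..T}. \<forall>t\<in>{0..T}. dist (\<gamma> s) (\<gamma> t) = \<bar>s - t\<bar>)"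

lemma geo_dist: "geo p T \<gamma> \<Longrightarrow> 0 \<le> s \<Longrightarrow> s \<le> T \<Longrightarrow> 0 \<le> t \<Longrightarrow> t \<le> T \<Longrightarrow> dist (\<gamma> s) (\<gamma> t) = \<bar>s - t\<bar>"
  by (auto simp: geo_def)

lemma geo_pos: "geo p T \<gamma> \<Longrightarrow> 0 < T" and geo_0: "geo p T \<gamma> \<Longrightarrow> \<gamma> 0 = p"
  by (auto simp: geo_def)

lemma geo_dist0:
  assumes "geo p T \<gamma>" "0 \<le> s" "s \<le> T" shows "dist p (\<gamma> s) = s" "dist (\<gamma> s) p = s"
  using geo_dist[OF assms(1), of 0 s] geo_0[OF assms(1)] assms by (auto simp: dist_commute)

lemma geo_minimal: "minimal_geodesic p q \<gamma> \<Longrightarrow> p \<noteq> q \<Longrightarrow> geo p (dist p q) \<gamma>"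
  by (auto simp: geo_def minimal_geodesic_def)

lemma geo_exists:
  assumes "p \<noteq> q" obtains \<gamma> where "geo p (dist p q) \<gamma>" "\<gamma> (dist p q) = q"
  using geodesic_exists[of p q] geo_minimal assms unfolding minimal_geodesic_def by metis

section \<open>Comparison cosines and angles\<close>

definition ccos :: "(real \<Rightarrow> 'a) \<Rightarrow> (real \<Rightarrow> 'a) \<Rightarrow> real \<Rightarrow> real \<Rightarrow> real" where
  "ccos \<gamma> \<sigma> s t = ecos s t (dist (\<gamma> s) (\<sigma> t))"

lemma ccos_sym: "ccos \<gamma> \<sigma> s t = ccos \<sigma> \<gamma> t s"
  by (simp add: ccos_def ecos_def dist_commute mult_ac add_ac)

lemma ccos_bounds:
  assumes "geo p T \<gamma>" "geo p T' \<sigma>" "0 < s" "s \<le> T" "0 < t" "t \<le> T'"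
  shows "-1 \<le> ccos \<gamma> \<sigma> s t" "ccos \<gamma> \<sigma> s t \<le> 1"
proof -
  have "dist p (\<gamma> s) = s" "dist p (\<sigma> t) = t" using assms by (auto intro: geo_dist0)
  then have "\<bar>s - t\<bar> \<le> dist (\<gamma> s) (\<sigma> t)" "dist (\<gamma> s) (\<sigma> t) \<le> s + t"
    using abs_dist_diff[of p "\<gamma> s" "\<sigma> t"] dist_triangle_base[of "\<gamma> s" "\<sigma> t" p] by auto
  then show "-1 \<le> ccos \<gamma> \<sigma> s t" "ccos \<gamma> \<sigma> s t \<le> 1"
    unfolding ccos_def using ecos_bounds assms by blast+
qed

text \<open>Stewart on the segment from \<open>p\<close> to \<open>\<gamma> s\<close>, seen from
  \<open>\<sigma> t\<close>: up to an error, comparison angles do not decrease when a side is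
  shortened. The error is quadratic in the scale only while \<open>s'\<close> is at most of the
  order of \<open>t\<close>.\<close>

lemma ccos_shrink:
  assumes st: "stewart_on C (ball p r)" and \<gamma>: "geo p T \<gamma>" and \<sigma>: "geo p T' \<sigma>"
    and s: "0 < s'" "s' \<le> s" "s < r" "s \<le> T" and t: "0 < t" "t < r" "t \<le> T'"
  shows "ccos \<gamma> \<sigma> s' t \<le> ccos \<gamma> \<sigma> s t + C * (s' + t)\<^sup>2 * s / (2 * t)"
proof -
  define a c where "a = dist (\<sigma> t) (\<gamma> s')" "c = dist (\<sigma> t) (\<gamma> s)"
  note ac = a_c_def
  have d: "dist p (\<gamma> s') = s'" "dist p (\<gamma> s) = s" "dist p (\<sigma> t) = t" "dist (\<gamma> s') (\<gamma> s) = s - s'"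
    using \<gamma> \<sigma> s t by (auto simp: geo_dist0 geo_dist)
  have "dist (\<gamma> s') (\<gamma> s) * (dist (\<sigma> t) p)\<^sup>2 + dist p (\<gamma> s') * (dist (\<sigma> t) (\<gamma> s))\<^sup>2
      \<le> dist p (\<gamma> s) * ((dist (\<sigma> t) (\<gamma> s'))\<^sup>2 + (1 + C * (dist (\<sigma> t) (\<gamma> s'))\<^sup>2) * dist p (\<gamma> s') * dist (\<gamma> s') (\<gamma> s))"
    using d s t by (intro stewart_onD[OF st]) auto
  then have 1: "(s - s') * t\<^sup>2 + s' * c\<^sup>2 \<le> s * (a\<^sup>2 + (1 + C * a\<^sup>2) * s' * (s - s'))"
    using d by (simp add: ac dist_commute)
  have "a \<le> s' + t" using dist_triangle_base[of "\<sigma> t" "\<gamma> s'" p] d by (simp add: ac)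
  then have a2: "C * a\<^sup>2 \<le> C * (s' + t)\<^sup>2" using C_nonneg by (intro mult_left_mono power_mono) (auto simp: ac)
  have "C * a\<^sup>2 * (s * s' * (s - s')) \<le> C * (s' + t)\<^sup>2 * (s * s' * s)"
    by (rule mult_mono[OF a2]) (use s C_nonneg in auto)
  then have "s * (s'\<^sup>2 + t\<^sup>2 - a\<^sup>2) \<le> s' * (s\<^sup>2 + t\<^sup>2 - c\<^sup>2) + C * (s' + t)\<^sup>2 * s\<^sup>2 * s'"
    using 1 by (simp add: algebra_simps power2_eq_square)
  then have "s * (s'\<^sup>2 + t\<^sup>2 - a\<^sup>2) / (2 * s * s' * t) \<le> (s' * (s\<^sup>2 + t\<^sup>2 - c\<^sup>2) + C * (s' + t)\<^sup>2 * s\<^sup>2 * s') / (2 * s * s' * t)"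
    using s t by (intro divide_right_mono) auto
  also have "s * (s'\<^sup>2 + t\<^sup>2 - a\<^sup>2) / (2 * s * s' * t) = ccos \<gamma> \<sigma> s' t"
    using s t by (simp add: ccos_def ecos_def ac dist_commute)
  also have "(s' * (s\<^sup>2 + t\<^sup>2 - c\<^sup>2) + C * (s' + t)\<^sup>2 * s\<^sup>2 * s') / (2 * s * s' * t)
      = ccos \<gamma> \<sigma> s t + C * (s' + t)\<^sup>2 * s / (2 * t)"
    using s t by (simp add: ccos_def ecos_def ac dist_commute add_divide_distrib power2_eq_square)
  finally show ?thesis .
qed

text \<open>All values are squeezed between the diagonal values \<open>g\<close> at the larger and
  the smaller parameter, and \<open>g\<close> is monotone up to \<open>4 * C * s\<^sup>2\<close>;
  its corrected infimum is then the double limit.\<close>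

lemma ccos_converges:
  assumes \<gamma>: "geo p T \<gamma>" and \<sigma>: "geo p T' \<sigma>"
  obtains L where "-1 \<le> L" "L \<le> 1"
    "\<And>e. e > 0 \<Longrightarrow> \<exists>\<delta>>0. \<forall>s t. 0 < s \<and> s < \<delta> \<and> 0 < t \<and> t < \<delta> \<longrightarrow> \<bar>ccos \<gamma> \<sigma> s t - L\<bar> < e"
proof -
  obtain r where r: "r > 0" "stewart_on C (ball p r)" using stewart_ex by blast
  define s0 where "s0 = min r (min T T')"
  have s0: "s0 > 0" "s0 \<le> r" "s0 \<le> T" "s0 \<le> T'" using r geo_pos[OF \<gamma>] geo_pos[OF \<sigma>] by (auto simp: s0_def)
  define g where "g s = ccos \<gamma> \<sigma> s s" for s
  have shr1: "ccos \<gamma> \<sigma> s' t \<le> ccos \<gamma> \<sigma> s t + C * (s' + t)\<^sup>2 * s / (2 * t)"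
    if "0 < s'" "s' \<le> s" "s < s0" "0 < t" "t < s0" for s s' t
    using that s0 by (intro ccos_shrink[OF r(2) \<gamma> \<sigma>]) auto
  have shr2: "ccos \<gamma> \<sigma> t s' \<le> ccos \<gamma> \<sigma> t s + C * (s' + t)\<^sup>2 * s / (2 * t)"
    if "0 < s'" "s' \<le> s" "s < s0" "0 < t" "t < s0" for s s' t
    using ccos_shrink[OF r(2) \<sigma> \<gamma>, of s' s t] that s0 by (simp add: ccos_sym[of \<gamma>])
  have up: "C * (s' + s)\<^sup>2 * s / (2 * s) \<le> 2 * C * s\<^sup>2" if "0 < s'" "s' \<le> s" for s s'
  proof -
    have "C * (s' + s)\<^sup>2 \<le> C * (2 * s)\<^sup>2" using that C_nonneg by (intro mult_left_mono power_mono) auto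
    then show ?thesis using that by simp
  qed
  have eqd: "C * (t + t)\<^sup>2 * s / (2 * t) = 2 * C * (s * t)" if "0 < t" for s t
    using that by (simp add: power2_eq_square)
  \<comment> \<open>In each use the shortened side ends no longer than the other one, which keeps
    the error quadratic.\<close>
  have bnd: "ccos \<gamma> \<sigma> s t \<le> g (max s t) + 2 * C * (max s t)\<^sup>2" "g (min s t) - 2 * C * (s * t) \<le> ccos \<gamma> \<sigma> s t"
    if st: "0 < s" "s < s0" "0 < t" "t < s0" for s t
  proof -
    show "ccos \<gamma> \<sigma> s t \<le> g (max s t) + 2 * C * (max s t)\<^sup>2"
    proof (cases "s \<le> t")
      case True
      then show ?thesis using shr1[of s t t] up[of s t] st by (simp add: g_def max_def)
    next
      case False
      then show ?thesis using shr2[of t s s] up[of t s] st by (simp add: g_def max_def)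
    qed
    show "g (min s t) - 2 * C * (s * t) \<le> ccos \<gamma> \<sigma> s t"
    proof (cases "t \<le> s")
      case True
      then have "min s t = t" by simp
      then show ?thesis using True shr1[of t s t] eqd[of t s] st by (simp add: g_def)
    next
      case False
      then have "min s t = s" by simp
      then show ?thesis using False shr2[of s t s] eqd[of s t] st by (simp add: g_def mult.commute)
    qed
  qed
  have gmono: "g s' \<le> g s + 4 * C * s\<^sup>2" if s: "0 < s'" "s' \<le> s" "s < s0" for s s'
  proof -
    have "ccos \<gamma> \<sigma> s' s \<le> g s + 2 * C * s\<^sup>2" using shr1[of s' s s] up[of s' s] s by (simp add: g_def)
    moreover have "g s' \<le> ccos \<gamma> \<sigma> s' s + 2 * C * (s * s')" using shr2[of s' s s'] eqd[of s' s] s by (simp add: g_def)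
    moreover have "2 * C * (s * s') \<le> 2 * C * s\<^sup>2"
      using s C_nonneg by (intro mult_left_mono) (auto simp: power2_eq_square)
    ultimately show ?thesis by linarith
  qed
  have gb: "-1 \<le> g s" "g s \<le> 1" if "0 < s" "s < s0" for s
    unfolding g_def using that s0 by (auto intro!: ccos_bounds[OF \<gamma> \<sigma>])
  define A where "A = (\<lambda>s. g s + 4 * C * s\<^sup>2) ` {0<..<s0}"
  define L where "L = Inf A"
  have Ane: "A \<noteq> {}" using s0 by (auto simp: A_def dense)
  have bdd: "bdd_below A"
    using gb C_nonneg by (intro bdd_belowI[of _ "-1"]) (auto simp: A_def intro!: add_increasing2)
  have Lle: "L \<le> g s + 4 * C * s\<^sup>2" if "0 < s" "s < s0" for s
    unfolding L_def using that bdd by (intro cInf_lower) (auto simp: A_def)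
  have conv: "\<exists>\<delta>>0. \<forall>s t. 0 < s \<and> s < \<delta> \<and> 0 < t \<and> t < \<delta> \<longrightarrow> \<bar>ccos \<gamma> \<sigma> s t - L\<bar> < e" if "e > 0" for e
  proof -
    have "Inf A < L + e / 2" using that by (simp add: L_def)
    then obtain a where "a \<in> A" "a < L + e / 2" using cInf_lessD[OF Ane] by blast
    then obtain s1 where s1: "0 < s1" "s1 < s0" "g s1 + 4 * C * s1\<^sup>2 < L + e / 2" by (auto simp: A_def)
    define \<delta> where "\<delta> = min s1 (min 1 (e / (12 * (C + 1))))"
    have \<delta>: "0 < \<delta>" "\<delta> \<le> s1" "\<delta> \<le> 1" "\<delta> \<le> e / (12 * (C + 1))" using s1 that C_nonneg by (auto simp: \<delta>_def)
    have "6 * C * \<delta>\<^sup>2 < e / 2"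
    proof -
      have "\<delta>\<^sup>2 \<le> \<delta>" using \<delta> by (simp add: power2_eq_square mult_left_le)
      then have "6 * C * \<delta>\<^sup>2 \<le> 6 * C * \<delta>" using C_nonneg by (intro mult_left_mono) auto
      also have "\<dots> < 6 * (C + 1) * \<delta>" using \<delta> by simp
      also have "\<dots> \<le> 6 * (C + 1) * (e / (12 * (C + 1)))" using \<delta> C_nonneg by (intro mult_left_mono) auto
      also have "\<dots> = e / 2"
      proof -
        have "6 * c * (e / (12 * c)) = e / 2" if "c > 0" for c using that by simp
        from this[of "C + 1"] show ?thesis using C_nonneg by simp
      qed
      finally show ?thesis .
    qed
    show ?thesis
    proof (intro exI[of _ \<delta>] conjI allI impI \<delta>(1))
      fix s t assume "0 < s \<and> s < \<delta> \<and> 0 < t \<and> t < \<delta>"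
      then have st: "0 < s" "s < \<delta>" "0 < t" "t < \<delta>" by auto
      have M: "0 < max s t" "max s t < \<delta>" "0 < min s t" "min s t < \<delta>" using st by auto
      have "C * (max s t)\<^sup>2 \<le> C * \<delta>\<^sup>2" "C * (min s t)\<^sup>2 \<le> C * \<delta>\<^sup>2" "C * (s * t) \<le> C * \<delta>\<^sup>2"
        using M st C_nonneg by (auto intro!: mult_left_mono power_mono mult_mono simp: power2_eq_square)
      moreover have "g (max s t) \<le> g s1 + 4 * C * s1\<^sup>2" using gmono[of "max s t" s1] M \<delta> s1 by auto
      moreover have "L \<le> g (min s t) + 4 * C * (min s t)\<^sup>2" using Lle M \<delta> s1 by auto
      moreover note bnd[of s t]
      ultimately show "\<bar>ccos \<gamma> \<sigma> s t - L\<bar> < e"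
        using st \<delta> s1 \<open>6 * C * \<delta>\<^sup>2 < e / 2\<close> by (simp add: abs_less_iff)
    qed
  qed
  have "-1 \<le> L"
    unfolding L_def using gb C_nonneg by (intro cInf_greatest[OF Ane]) (auto simp: A_def intro!: add_increasing2)
  moreover have "L \<le> 1"
  proof (rule ccontr)
    assume "\<not> L \<le> 1"
    then have "0 < L - 1" by simp
    then obtain \<delta> where \<delta>: "\<delta> > 0" "\<And>s t. 0 < s \<Longrightarrow> s < \<delta> \<Longrightarrow> 0 < t \<Longrightarrow> t < \<delta> \<Longrightarrow> \<bar>ccos \<gamma> \<sigma> s t - L\<bar> < L - 1"
      using conv by meson
    define s where "s = min \<delta> s0 / 2"
    have "0 < s" "s < \<delta>" "s < s0" using \<delta> s0 by (auto simp: s_def)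
    then show False using \<delta>(2)[of s s] gb[of s] by (simp add: g_def)
  qed
  ultimately show thesis using that conv by blast
qed

text \<open>The \<open>Lim\<close> in the definition is a true limit, since \<open>arccos\<close> is
  continuous on [-1, 1] including the ends.\<close>

lemma geodesic_angle_eps:
  assumes \<gamma>: "geo p T \<gamma>" and \<sigma>: "geo p T' \<sigma>"
  shows geodesic_angle_nonneg: "0 \<le> geodesic_angle \<gamma> \<sigma>"
    and geodesic_angle_le_pi: "geodesic_angle \<gamma> \<sigma> \<le> pi"
    and ccos_tendsto_cos_angle: "\<And>e. e > 0 \<Longrightarrow> \<exists>\<delta>>0. \<forall>s t. 0 < s \<and> s < \<delta> \<and> 0 < t \<and> t < \<delta> \<longrightarrow>
      \<bar>ccos \<gamma> \<sigma> s t - cos (geodesic_angle \<gamma> \<sigma>)\<bar> < e"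
proof -
  obtain L where L: "-1 \<le> L" "L \<le> 1"
    "\<And>e. e > 0 \<Longrightarrow> \<exists>\<delta>>0. \<forall>s t. 0 < s \<and> s < \<delta> \<and> 0 < t \<and> t < \<delta> \<longrightarrow> \<bar>ccos \<gamma> \<sigma> s t - L\<bar> < e"
    by (rule ccos_converges[OF \<gamma> \<sigma>]) (rule that; blast)
  have ev: "eventually (\<lambda>(s, t). Q s t) (at_right 0 \<times>\<^sub>F at_right 0)"
    if "\<delta> > 0" "\<And>s t. 0 < s \<Longrightarrow> s < \<delta> \<Longrightarrow> 0 < t \<Longrightarrow> t < \<delta> \<Longrightarrow> Q s t" for Q and \<delta> :: real
    unfolding eventually_prod_filter
  proof (intro exI conjI allI impI)
    show "eventually (\<lambda>s. s \<in> {0<..<\<delta>}) (at_right 0)" "eventually (\<lambda>s. s \<in> {0<..<\<delta>}) (at_right 0)"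
      by (rule eventually_at_right_real[OF that(1)])+
  qed (use that in auto)
  have "((\<lambda>(s, t). ccos \<gamma> \<sigma> s t) \<longlongrightarrow> L) (at_right 0 \<times>\<^sub>F at_right 0)"
  proof (rule tendstoI)
    fix e :: real assume "e > 0"
    then obtain \<delta> where "\<delta> > 0" "\<And>s t. 0 < s \<Longrightarrow> s < \<delta> \<Longrightarrow> 0 < t \<Longrightarrow> t < \<delta> \<Longrightarrow> \<bar>ccos \<gamma> \<sigma> s t - L\<bar> < e"
      using L(3) by meson
    then show "eventually (\<lambda>x. dist (case x of (s, t) \<Rightarrow> ccos \<gamma> \<sigma> s t) L < e) (at_right 0 \<times>\<^sub>F at_right 0)"
      using ev[of \<delta> "\<lambda>s t. \<bar>ccos \<gamma> \<sigma> s t - L\<bar> < e"] by (simp add: dist_real_def case_prod_unfold)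
  qed
  moreover have pos: "0 < min T T'" using geo_pos[OF \<gamma>] geo_pos[OF \<sigma>] by simp
  then have "eventually (\<lambda>x. (case x of (s, t) \<Rightarrow> ccos \<gamma> \<sigma> s t) \<in> {-1..1}) (at_right 0 \<times>\<^sub>F at_right 0)"
    using ev[of "min T T'" "\<lambda>s t. ccos \<gamma> \<sigma> s t \<in> {-1..1}"] ccos_bounds[OF \<gamma> \<sigma>] by (simp add: case_prod_unfold)
  ultimately have lim: "((\<lambda>x. arccos (case x of (s, t) \<Rightarrow> ccos \<gamma> \<sigma> s t)) \<longlongrightarrow> arccos L) (at_right 0 \<times>\<^sub>F at_right 0)"
    using continuous_on_tendsto_compose[OF continuous_on_arccos' _ _ , of "\<lambda>x. case x of (s, t) \<Rightarrow> ccos \<gamma> \<sigma> s t" L] L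
    by auto
  have eq: "comparison_angle 0 (\<gamma> 0) (\<gamma> s) (\<sigma> t) = arccos (ccos \<gamma> \<sigma> s t)"
    if "0 < s" "s < min T T'" "0 < t" "t < min T T'" for s t
    using that geo_0[OF \<gamma>] geo_0[OF \<sigma>] geo_dist0[OF \<gamma>, of s] geo_dist0[OF \<sigma>, of t]
    by (simp add: comparison_angle_def model_angle_def ccos_def ecos_def)
  have "((\<lambda>(s, t). comparison_angle 0 (\<gamma> 0) (\<gamma> s) (\<sigma> t)) \<longlongrightarrow> arccos L) (at_right 0 \<times>\<^sub>F at_right 0)"
    by (rule Lim_transform_eventually[OF lim])
      (use ev[OF pos, of "\<lambda>s t. arccos (ccos \<gamma> \<sigma> s t) = comparison_angle 0 (\<gamma> 0) (\<gamma> s) (\<sigma> t)"] eq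
        in \<open>simp add: case_prod_unfold\<close>)
  then have "geodesic_angle \<gamma> \<sigma> = arccos L"
    unfolding geodesic_angle_def by (intro tendsto_Lim) (auto simp: prod_filter_eq_bot)
  moreover have "0 \<le> arccos L" "arccos L \<le> pi" "cos (arccos L) = L"
    using L by (auto intro: arccos_lbound arccos_ubound)
  ultimately show "0 \<le> geodesic_angle \<gamma> \<sigma>" "geodesic_angle \<gamma> \<sigma> \<le> pi"
    "\<And>e. e > 0 \<Longrightarrow> \<exists>\<delta>>0. \<forall>s t. 0 < s \<and> s < \<delta> \<and> 0 < t \<and> t < \<delta> \<longrightarrow>
      \<bar>ccos \<gamma> \<sigma> s t - cos (geodesic_angle \<gamma> \<sigma>)\<bar> < e"
    using L(3) by simp_all
qed

abbreviation cos_angle :: "(real \<Rightarrow> 'a) \<Rightarrow> (real \<Rightarrow> 'a) \<Rightarrow> real" where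
  "cos_angle \<gamma> \<sigma> \<equiv> cos (geodesic_angle \<gamma> \<sigma>)"

lemma scaled_ccos_tendsto:
  assumes \<gamma>: "geo p T \<gamma>" and \<sigma>: "geo p T' \<sigma>" and ab: "0 < a" "0 < b"
  shows "((\<lambda>t. ccos \<gamma> \<sigma> (a * t) (b * t)) \<longlongrightarrow> cos_angle \<gamma> \<sigma>) (at_right 0)"
proof (rule tendstoI)
  fix e :: real assume "e > 0"
  then obtain \<delta> where \<delta>: "\<delta> > 0" "\<And>s t. 0 < s \<Longrightarrow> s < \<delta> \<Longrightarrow> 0 < t \<Longrightarrow> t < \<delta> \<Longrightarrow>
      \<bar>ccos \<gamma> \<sigma> s t - cos_angle \<gamma> \<sigma>\<bar> < e"
    using ccos_tendsto_cos_angle[OF \<gamma> \<sigma>] by meson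
  define d where "d = min (\<delta> / a) (\<delta> / b)"
  have "d > 0" using \<delta> ab by (simp add: d_def)
  then have "eventually (\<lambda>t. t \<in> {0<..<d}) (at_right 0)" by (rule eventually_at_right_real)
  then show "eventually (\<lambda>t. dist (ccos \<gamma> \<sigma> (a * t) (b * t)) (cos_angle \<gamma> \<sigma>) < e) (at_right 0)"
  proof (rule eventually_mono)
    fix t assume "t \<in> {0<..<d}"
    then have "0 < a * t" "a * t < \<delta>" "0 < b * t" "b * t < \<delta>" using ab by (auto simp: d_def field_simps)
    then show "dist (ccos \<gamma> \<sigma> (a * t) (b * t)) (cos_angle \<gamma> \<sigma>) < e"
      using \<delta>(2) by (simp add: dist_real_def)
  qed
qed

text \<open>Blow-up at \<open>p\<close>: rescaled distances tend to those of the Euclidean cone, by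
  the law of cosines solved for the third side.\<close>

lemma scaled_dist2_tendsto:
  assumes \<gamma>: "geo p T \<gamma>" and \<sigma>: "geo p T' \<sigma>" and ab: "0 < a" "0 < b"
  shows "((\<lambda>t. (dist (\<gamma> (a * t)) (\<sigma> (b * t)))\<^sup>2 / t\<^sup>2)
    \<longlongrightarrow> a\<^sup>2 + b\<^sup>2 - 2 * a * b * cos_angle \<gamma> \<sigma>) (at_right 0)"
proof (rule Lim_transform_eventually)
  show "((\<lambda>t. a\<^sup>2 + b\<^sup>2 - 2 * a * b * ccos \<gamma> \<sigma> (a * t) (b * t))
      \<longlongrightarrow> a\<^sup>2 + b\<^sup>2 - 2 * a * b * cos_angle \<gamma> \<sigma>) (at_right 0)"
    by (intro tendsto_intros scaled_ccos_tendsto[OF assms])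
  have "eventually (\<lambda>t::real. 0 < t) (at_right 0)" by (rule eventually_at_right_less)
  then show "eventually (\<lambda>t. a\<^sup>2 + b\<^sup>2 - 2 * a * b * ccos \<gamma> \<sigma> (a * t) (b * t)
      = (dist (\<gamma> (a * t)) (\<sigma> (b * t)))\<^sup>2 / t\<^sup>2) (at_right 0)"
  proof (rule eventually_mono)
    fix t :: real assume "0 < t"
    then show "a\<^sup>2 + b\<^sup>2 - 2 * a * b * ccos \<gamma> \<sigma> (a * t) (b * t) = (dist (\<gamma> (a * t)) (\<sigma> (b * t)))\<^sup>2 / t\<^sup>2"
      using ab by (simp add: ccos_def ecos_def field_simps power2_eq_square)
  qed
qed

lemma scaled_dist_tendsto:
  assumes \<gamma>: "geo p T \<gamma>" and \<sigma>: "geo p T' \<sigma>" and ab: "0 < a" "0 < b"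
  shows "((\<lambda>t. dist (\<gamma> (a * t)) (\<sigma> (b * t)) / t)
    \<longlongrightarrow> sqrt (a\<^sup>2 + b\<^sup>2 - 2 * a * b * cos_angle \<gamma> \<sigma>)) (at_right 0)"
proof (rule Lim_transform_eventually[OF tendsto_real_sqrt[OF scaled_dist2_tendsto[OF assms]]])
  have "eventually (\<lambda>t::real. 0 < t) (at_right 0)" by (rule eventually_at_right_less)
  then show "eventually (\<lambda>t. sqrt ((dist (\<gamma> (a * t)) (\<sigma> (b * t)))\<^sup>2 / t\<^sup>2)
      = dist (\<gamma> (a * t)) (\<sigma> (b * t)) / t) (at_right 0)"
    by (rule eventually_mono) (simp add: real_sqrt_divide)
qed

lemma geodesic_angle_sym:
  assumes \<gamma>: "geo p T \<gamma>" and \<sigma>: "geo p T' \<sigma>"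
  shows "geodesic_angle \<gamma> \<sigma> = geodesic_angle \<sigma> \<gamma>"
proof -
  have "(\<lambda>t. ccos \<gamma> \<sigma> (1 * t) (1 * t)) = (\<lambda>t. ccos \<sigma> \<gamma> (1 * t) (1 * t))" by (simp add: ccos_sym[of \<gamma>])
  then have "cos_angle \<gamma> \<sigma> = cos_angle \<sigma> \<gamma>"
    using scaled_ccos_tendsto[OF \<gamma> \<sigma>, of 1 1] scaled_ccos_tendsto[OF \<sigma> \<gamma>, of 1 1]
    by (metis tendsto_unique trivial_limit_at_right_real zero_less_one)
  then show ?thesis
    using geodesic_angle_nonneg geodesic_angle_le_pi \<gamma> \<sigma> by (metis cos_inj_pi)
qed

lemma geodesic_angle_self:
  assumes \<gamma>: "geo p T \<gamma>"
  shows "geodesic_angle \<gamma> \<gamma> = 0"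
proof -
  have "((\<lambda>t. ccos \<gamma> \<gamma> (1 * t) (1 * t)) \<longlongrightarrow> 1) (at_right 0)"
  proof (rule tendsto_eventually)
    have "eventually (\<lambda>t::real. 0 < t) (at_right 0)" by (rule eventually_at_right_less)
    then show "eventually (\<lambda>t. ccos \<gamma> \<gamma> (1 * t) (1 * t) = 1) (at_right 0)"
      by (rule eventually_mono) (simp add: ccos_def ecos_def power2_eq_square)
  qed
  then have "cos_angle \<gamma> \<gamma> = cos 0"
    using scaled_ccos_tendsto[OF \<gamma> \<gamma>, of 1 1] by (metis cos_zero tendsto_unique trivial_limit_at_right_real zero_less_one)
  then show ?thesis
    using geodesic_angle_nonneg[OF \<gamma> \<gamma>] geodesic_angle_le_pi[OF \<gamma> \<gamma>] by (metis cos_inj_pi order_refl pi_ge_zero)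
qed

text \<open>In the plane, the segment between the unit vectors at angles \<open>\<theta>\<^sub>1\<close> and \<open>-\<theta>\<^sub>2\<close> meets the
  positive real axis in a point \<open>b\<close>; comparing rescaled triangles with apex at \<open>p\<close> with this
  configuration turns the triangle inequality of the metric into that of the angles.\<close>

lemma geodesic_angle_triangle:
  assumes c1: "geo p T1 c1" and c2: "geo p T2 c2" and c3: "geo p T3 c3"
  shows "geodesic_angle c1 c3 \<le> geodesic_angle c1 c2 + geodesic_angle c2 c3"
proof -
  define \<theta>1 \<theta>2 \<theta> where "\<theta>1 = geodesic_angle c1 c2" "\<theta>2 = geodesic_angle c2 c3" "\<theta> = geodesic_angle c1 c3"
  note \<theta>_def = \<theta>1_\<theta>2_\<theta>_def
  have rng: "0 \<le> \<theta>1" "0 \<le> \<theta>2" "0 \<le> \<theta>" "\<theta> \<le> pi" "\<theta>1 \<le> pi" "\<theta>2 \<le> pi"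
    using geodesic_angle_nonneg geodesic_angle_le_pi assms by (auto simp: \<theta>_def)
  show ?thesis
  proof (cases "\<theta>1 + \<theta>2 < pi")
    case False
    then show ?thesis using rng by (simp add: \<theta>_def)
  next
    case True
    obtain u b where u: "0 \<le> u" "u \<le> 1" and b: "b > 0"
      and eq: "complex_of_real b = of_real u * cis \<theta>1 + of_real (1 - u) * cis (- \<theta>2)"
    proof (cases "\<theta>1 + \<theta>2 = 0")
      case True
      then have "\<theta>1 = 0" "\<theta>2 = 0" using rng by auto
      then show thesis using that[of 0 1] by simp
    next
      case False
      then have s12: "0 < sin (\<theta>1 + \<theta>2)" using rng True by (intro sin_gt_zero) auto
      have s: "0 \<le> sin \<theta>1" "0 \<le> sin \<theta>2" using rng by (auto intro: sin_ge_zero)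
      have sum: "0 < sin \<theta>1 + sin \<theta>2"
      proof (rule ccontr)
        assume "\<not> ?thesis"
        then have "sin \<theta>1 = 0" "sin \<theta>2 = 0" using s by auto
        then show False using s12 by (simp add: sin_add)
      qed
      define u where "u = sin \<theta>2 / (sin \<theta>1 + sin \<theta>2)"
      have u': "1 - u = sin \<theta>1 / (sin \<theta>1 + sin \<theta>2)" using sum by (simp add: u_def field_simps)
      show thesis
      proof (rule that[of u "sin (\<theta>1 + \<theta>2) / (sin \<theta>1 + sin \<theta>2)"])
        show "0 \<le> u" "u \<le> 1" using s sum by (auto simp: u_def)
        show "0 < sin (\<theta>1 + \<theta>2) / (sin \<theta>1 + sin \<theta>2)" using s12 sum by simp
        show "complex_of_real (sin (\<theta>1 + \<theta>2) / (sin \<theta>1 + sin \<theta>2)) = of_real u * cis \<theta>1 + of_real (1 - u) * cis (- \<theta>2)"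
          unfolding u' unfolding u_def
          by (rule complex_eqI) (simp_all add: sin_add add_divide_distrib mult.commute)
      qed
    qed
    have nrm: "sqrt (x\<^sup>2 + y\<^sup>2 - 2 * x * y * cos t) = cmod (of_real x * cis t - of_real y)" for x y t
    proof -
      have "(cmod (of_real x * cis t - of_real y))\<^sup>2 = x\<^sup>2 * ((cos t)\<^sup>2 + (sin t)\<^sup>2) + y\<^sup>2 - 2 * x * y * cos t"
      proof -
        have "(cmod (of_real x * cis t - of_real y))\<^sup>2 = (x * cos t - y)\<^sup>2 + (x * sin t)\<^sup>2"
          by (simp add: cmod_power2)
        then show ?thesis by algebra
      qed
      then have "(cmod (of_real x * cis t - of_real y))\<^sup>2 = x\<^sup>2 + y\<^sup>2 - 2 * x * y * cos t" by simp
      then show ?thesis by (metis norm_ge_zero real_sqrt_unique)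
    qed
    have lim13: "((\<lambda>t. dist (c1 (1 * t)) (c3 (1 * t)) / t) \<longlongrightarrow> sqrt (1\<^sup>2 + 1\<^sup>2 - 2 * 1 * 1 * cos \<theta>)) (at_right 0)"
      unfolding \<theta>_def by (rule scaled_dist_tendsto[OF c1 c3]) auto
    have lim12: "((\<lambda>t. dist (c1 (1 * t)) (c2 (b * t)) / t) \<longlongrightarrow> sqrt (1\<^sup>2 + b\<^sup>2 - 2 * 1 * b * cos \<theta>1)) (at_right 0)"
      unfolding \<theta>_def by (rule scaled_dist_tendsto[OF c1 c2]) (use b in auto)
    have lim23: "((\<lambda>t. dist (c2 (b * t)) (c3 (1 * t)) / t) \<longlongrightarrow> sqrt (b\<^sup>2 + 1\<^sup>2 - 2 * b * 1 * cos \<theta>2)) (at_right 0)"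
      unfolding \<theta>_def by (rule scaled_dist_tendsto[OF c2 c3]) (use b in auto)
    have "sqrt (1\<^sup>2 + 1\<^sup>2 - 2 * 1 * 1 * cos \<theta>)
        \<le> sqrt (1\<^sup>2 + b\<^sup>2 - 2 * 1 * b * cos \<theta>1) + sqrt (b\<^sup>2 + 1\<^sup>2 - 2 * b * 1 * cos \<theta>2)"
    proof (rule tendsto_le[OF _ tendsto_add[OF lim12 lim23] lim13])
      have "eventually (\<lambda>t::real. 0 < t) (at_right 0)" by (rule eventually_at_right_less)
      then show "eventually (\<lambda>t. dist (c1 (1 * t)) (c3 (1 * t)) / t
          \<le> dist (c1 (1 * t)) (c2 (b * t)) / t + dist (c2 (b * t)) (c3 (1 * t)) / t) (at_right 0)"
        by (rule eventually_mono) (simp add: dist_triangle divide_right_mono flip: add_divide_distrib)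
    qed simp
    also have "sqrt (1\<^sup>2 + b\<^sup>2 - 2 * 1 * b * cos \<theta>1) = cmod (cis \<theta>1 - of_real b)"
      using nrm[of 1 b \<theta>1] by simp
    also have "sqrt (b\<^sup>2 + 1\<^sup>2 - 2 * b * 1 * cos \<theta>2) = cmod (of_real b - cis (- \<theta>2))"
      using nrm[of 1 b "- \<theta>2"] by (simp add: norm_minus_commute add.commute)
    also have "cis \<theta>1 - of_real b = of_real (1 - u) * (cis \<theta>1 - cis (- \<theta>2))" unfolding eq by (simp add: algebra_simps)
    also have "of_real b - cis (- \<theta>2) = of_real u * (cis \<theta>1 - cis (- \<theta>2))" unfolding eq by (simp add: algebra_simps)
    also have "cmod (of_real (1 - u) * (cis \<theta>1 - cis (- \<theta>2))) + cmod (of_real u * (cis \<theta>1 - cis (- \<theta>2)))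
        = cmod (cis \<theta>1 - cis (- \<theta>2))"
      using u unfolding norm_mult norm_of_real by (simp add: algebra_simps)
    also have "\<dots> = cmod (cis (- \<theta>2) * (cis (\<theta>1 + \<theta>2) - 1))"
      by (simp add: right_diff_distrib cis_mult)
    also have "\<dots> = sqrt (1\<^sup>2 + 1\<^sup>2 - 2 * 1 * 1 * cos (\<theta>1 + \<theta>2))"
      unfolding nrm by (simp add: norm_mult)
    finally have "cos (\<theta>1 + \<theta>2) \<le> cos \<theta>" by simp
    then have "\<theta> \<le> \<theta>1 + \<theta>2" using rng True by (subst (asm) cos_mono_le_eq) auto
    then show ?thesis by (simp add: \<theta>_def)
  qed
qed

section \<open>Distances between directions\<close>

lemma direction_sequences_geo:
  fixes p :: 'a
  assumes "c \<in> direction_sequences p" obtains T where "geo p T (c n)"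
proof -
  have "\<forall>n. \<exists>q. q \<noteq> p \<and> minimal_geodesic p q (c n)" using assms by (simp add: direction_sequences_def)
  then obtain q where "q \<noteq> p" "minimal_geodesic p q (c n)" by blast
  then show thesis using that geo_minimal[of p q "c n"] by simp
qed

text \<open>The triangle inequality for angles gives the same limit for all representatives, and the
  constant sequences make it unique, as the \<open>THE\<close> in \<open>direction_dist\<close>
  requires.\<close>

lemma direction_dist_direction:
  fixes p :: 'a
  assumes \<gamma>: "minimal_geodesic p q \<gamma>" "p \<noteq> q" and \<sigma>: "minimal_geodesic p r \<sigma>" "p \<noteq> r"
  shows "direction_dist (direction p \<gamma>) (direction p \<sigma>) = geodesic_angle \<gamma> \<sigma>"
proof -
  note g\<gamma> = geo_minimal[OF \<gamma>]
  note g\<sigma> = geo_minimal[OF \<sigma>]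
  have const: "(\<lambda>_. \<gamma>) \<in> direction_sequences p" if "minimal_geodesic p q \<gamma>" "p \<noteq> q" for \<gamma> q
    using that geodesic_angle_self[OF geo_minimal[OF that]] unfolding direction_sequences_def by auto
  have self: "(\<lambda>_. \<gamma>) \<in> direction p \<gamma>" if "minimal_geodesic p q \<gamma>" "p \<noteq> q" for \<gamma> q
    using const[OF that] geodesic_angle_self[OF geo_minimal[OF that]]
    by (simp add: direction_def direction_rel_def)
  have lim: "(\<lambda>n. geodesic_angle (c n) (d n)) \<longlonglongrightarrow> geodesic_angle \<gamma> \<sigma>"
    if c: "c \<in> direction p \<gamma>" and d: "d \<in> direction p \<sigma>" for c d
  proof -
    have c': "c \<in> direction_sequences p" "(\<lambda>n. geodesic_angle \<gamma> (c n)) \<longlonglongrightarrow> 0"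
      and d': "d \<in> direction_sequences p" "(\<lambda>n. geodesic_angle \<sigma> (d n)) \<longlonglongrightarrow> 0"
      using c d by (auto simp: direction_def direction_rel_def)
    have "(\<lambda>n. geodesic_angle (c n) (d n) - geodesic_angle \<gamma> \<sigma>) \<longlonglongrightarrow> 0"
    proof (rule tendsto_rabs_zero_cancel, rule tendsto_sandwich[OF _ _ tendsto_const])
      show "(\<lambda>n. geodesic_angle \<gamma> (c n) + geodesic_angle \<sigma> (d n)) \<longlonglongrightarrow> 0"
        using tendsto_add[OF c'(2) d'(2)] by simp
      show "eventually (\<lambda>n. \<bar>geodesic_angle (c n) (d n) - geodesic_angle \<gamma> \<sigma>\<bar>
          \<le> geodesic_angle \<gamma> (c n) + geodesic_angle \<sigma> (d n)) sequentially"
      proof (rule always_eventually, rule allI)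
        fix n
        obtain T T' where g: "geo p T (c n)" "geo p T' (d n)"
          using direction_sequences_geo[OF c'(1)] direction_sequences_geo[OF d'(1)] by meson
        show "\<bar>geodesic_angle (c n) (d n) - geodesic_angle \<gamma> \<sigma>\<bar> \<le> geodesic_angle \<gamma> (c n) + geodesic_angle \<sigma> (d n)"
          using geodesic_angle_triangle[OF g(1) g\<gamma> g(2)] geodesic_angle_triangle[OF g\<gamma> g\<sigma> g(2)]
            geodesic_angle_triangle[OF g\<gamma> g(1) g\<sigma>] geodesic_angle_triangle[OF g(1) g(2) g\<sigma>]
            geodesic_angle_sym[OF g\<gamma> g(1)] geodesic_angle_sym[OF g\<sigma> g(2)] by linarith
      qed
    qed simp
    then show ?thesis by (simp add: LIM_zero_iff)
  qed
  show ?thesis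
    unfolding direction_dist_def
  proof (rule the_equality)
    show "\<forall>c\<in>direction p \<gamma>. \<forall>d\<in>direction p \<sigma>. (\<lambda>n. geodesic_angle (c n) (d n)) \<longlonglongrightarrow> geodesic_angle \<gamma> \<sigma>"
      using lim by blast
    fix l assume "\<forall>c\<in>direction p \<gamma>. \<forall>d\<in>direction p \<sigma>. (\<lambda>n. geodesic_angle (c n) (d n)) \<longlonglongrightarrow> l"
    from bspec[OF bspec[OF this self[OF \<gamma>]] self[OF \<sigma>]]
    have "(\<lambda>n::nat. geodesic_angle \<gamma> \<sigma>) \<longlonglongrightarrow> l" .
    then show "l = geodesic_angle \<gamma> \<sigma>" by (simp add: LIMSEQ_const_iff)
  qed
qed

lemma direction_in_directions_to:
  fixes p :: 'a
  assumes "minimal_geodesic p q \<gamma>" "p \<noteq> q"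
  shows "direction p \<gamma> \<in> directions_to p q"
proof -
  have "(\<lambda>_. \<gamma>) \<in> direction_sequences p"
    using assms geodesic_angle_self[OF geo_minimal[OF assms]] unfolding direction_sequences_def by auto
  then show ?thesis
    using assms(1) by (auto simp: directions_to_def space_of_directions_def direction_def intro: quotientI)
qed

lemma direction_setdist_le:
  fixes p :: 'a
  assumes "minimal_geodesic p q \<gamma>" "p \<noteq> q" "minimal_geodesic p r \<sigma>" "p \<noteq> r"
  shows "direction_setdist (directions_to p q) (directions_to p r) \<le> ereal (geodesic_angle \<gamma> \<sigma>)"
  unfolding direction_setdist_def
  by (rule INF_lower2[OF direction_in_directions_to[OF assms(1,2)]],
      rule INF_lower2[OF direction_in_directions_to[OF assms(3,4)]])
    (simp add: direction_dist_direction[OF assms])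

section \<open>Gradient directions of distance functions\<close>

text \<open>Along segments, \<open>f\<close> minus \<open>L\<close> times the squared arc length is
  concave; the condition is put in terms of triples with \<open>m\<close> in between, without
  geodesics.\<close>

definition semiconcave_on :: "'a set \<Rightarrow> real \<Rightarrow> ('a \<Rightarrow> real) \<Rightarrow> bool" where
  "semiconcave_on U L f \<longleftrightarrow> (\<forall>x\<in>U. \<forall>y\<in>U. \<forall>m\<in>U. dist x m + dist m y = dist x y \<longrightarrow>
     dist m y * f x + dist x m * f y \<le> dist x y * (f m + L * dist x m * dist m y))"

lemma semiconcave_onD:
  assumes "semiconcave_on U L f" "x \<in> U" "y \<in> U" "m \<in> U" "dist x m + dist m y = dist x y"
  shows "dist m y * f x + dist x m * f y \<le> dist x y * (f m + L * dist x m * dist m y)"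
  using assms unfolding semiconcave_on_def by blast

lemma semiconcave_on_subset: "semiconcave_on U L f \<Longrightarrow> V \<subseteq> U \<Longrightarrow> semiconcave_on V L f"
  unfolding semiconcave_on_def by blast

text \<open>Near a point \<open>m\<close>, \<open>dist q\<close> is bounded above by \<open>dist q z + dist z\<close> with equality at \<open>m\<close>,
  where \<open>z\<close> lies on a geodesic from \<open>m\<close> to \<open>q\<close> at a fixed small distance from \<open>m\<close>.\<close>

lemma dist_semiconcave:
  assumes "p \<noteq> q"
  obtains \<rho> L where "\<rho> > 0" "0 \<le> L" "semiconcave_on (ball p \<rho>) L (dist q)"
proof -
  obtain R where R: "R > 0" "stewart_on C (ball p R)" using stewart_ex by blast
  \<comment> \<open>\<open>s\<close> and \<open>\<rho>\<close> keep all points in the Stewart ball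
    and \<open>z\<close> strictly before \<open>q\<close>.\<close>
  define s where "s = min (R / 4) (dist p q / 4)"
  define \<rho> where "\<rho> = min (R / 2) (dist p q / 2)"
  define K where "K = 1 + C * s\<^sup>2"
  define L where "L = K / (2 * s)"
  have s: "s > 0" "\<rho> > 0" "\<rho> + s < R" "s + \<rho> < dist p q" using R assms by (auto simp: s_def \<rho>_def min_def)
  have K: "K \<ge> 1" using C_nonneg by (simp add: K_def)
  have L: "L \<ge> 0" "2 * s * L = K" using K s by (auto simp: L_def)
  have "semiconcave_on (ball p \<rho>) L (dist q)"
    unfolding semiconcave_on_def
  proof (intro ballI impI)
    fix x y m assume xym: "x \<in> ball p \<rho>" "y \<in> ball p \<rho>" "m \<in> ball p \<rho>" and btw: "dist x m + dist m y = dist x y"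
    define b1 b2 where "b1 = dist x m" "b2 = dist m y"
    note bb = b1_b2_def
    have l: "dist x y = b1 + b2" using btw by (simp add: bb)
    have nn: "0 \<le> b1" "0 \<le> b2" by (auto simp: bb)
    have mq: "s < dist m q" using xym s dist_triangle[of p q m] by simp
    then have "m \<noteq> q" using s by auto
    then obtain \<zeta> where \<zeta>: "geo m (dist m q) \<zeta>" "\<zeta> (dist m q) = q" by (rule geo_exists)
    define z where "z = \<zeta> s"
    have z: "dist m z = s" "dist z q = dist m q - s"
      using geo_dist0[OF \<zeta>(1), of s] geo_dist[OF \<zeta>(1), of s "dist m q"] \<zeta>(2) s mq by (auto simp: z_def)
    have "z \<in> ball p R" using z xym s dist_triangle[of p z m] by simp
    then have "dist m y * (dist z x)\<^sup>2 + dist x m * (dist z y)\<^sup>2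
        \<le> dist x y * ((dist z m)\<^sup>2 + (1 + C * (dist z m)\<^sup>2) * dist x m * dist m y)"
      using xym s btw by (intro stewart_onD[OF R(2)]) auto
    then have 1: "b2 * (dist z x)\<^sup>2 + b1 * (dist z y)\<^sup>2 \<le> (b1 + b2) * (s\<^sup>2 + K * b1 * b2)"
      unfolding l using z(1) by (simp add: bb K_def dist_commute)
    \<comment> \<open>Weighted Cauchy-Schwarz passes from squares to distances;
      \<open>2 * s * L = K\<close> completes the square.\<close>
    have "b2 * dist z x + b1 * dist z y \<le> (b1 + b2) * (s + L * b1 * b2)"
    proof (rule power2_le_imp_le)
      have "(b2 * dist z x + b1 * dist z y)\<^sup>2 + b1 * b2 * (dist z x - dist z y)\<^sup>2
          = (b1 + b2) * (b2 * (dist z x)\<^sup>2 + b1 * (dist z y)\<^sup>2)"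
        by (simp add: power2_eq_square algebra_simps)
      then have "(b2 * dist z x + b1 * dist z y)\<^sup>2 \<le> (b1 + b2) * (b2 * (dist z x)\<^sup>2 + b1 * (dist z y)\<^sup>2)"
        using nn by (smt (verit) mult_nonneg_nonneg zero_le_power2)
      also have "\<dots> \<le> (b1 + b2) * ((b1 + b2) * (s\<^sup>2 + K * b1 * b2))" using 1 nn by (intro mult_left_mono) auto
      also have "\<dots> = (b1 + b2)\<^sup>2 * (s\<^sup>2 + 2 * s * (L * b1 * b2))"
        using L(2) by (simp add: power2_eq_square mult.assoc[symmetric])
      also have "\<dots> \<le> (b1 + b2)\<^sup>2 * (s + L * b1 * b2)\<^sup>2"
      proof (rule mult_left_mono)
        show "s\<^sup>2 + 2 * s * (L * b1 * b2) \<le> (s + L * b1 * b2)\<^sup>2" by (simp add: power2_sum)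
      qed simp
      finally show "(b2 * dist z x + b1 * dist z y)\<^sup>2 \<le> ((b1 + b2) * (s + L * b1 * b2))\<^sup>2"
        by (simp add: power_mult_distrib)
      show "0 \<le> (b1 + b2) * (s + L * b1 * b2)" using nn L s by simp
    qed
    moreover have "b2 * dist q x \<le> b2 * (dist z x + dist z q)" "b1 * dist q y \<le> b1 * (dist z y + dist z q)"
      using nn dist_triangle_base[of q x z] dist_triangle_base[of q y z]
      by (auto intro!: mult_left_mono simp: add.commute)
    ultimately have "b2 * dist q x + b1 * dist q y \<le> (b1 + b2) * (s + dist z q + L * b1 * b2)"
      by (simp add: algebra_simps)
    moreover have "dist q m = s + dist z q" using z(2) by (simp add: dist_commute)
    ultimately show "dist m y * dist q x + dist x m * dist q y
        \<le> dist x y * (dist q m + L * dist x m * dist m y)"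
      unfolding l bb[symmetric] by simp
  qed
  then show thesis using that s L by blast
qed

text \<open>Semiconcavity costs at most \<open>L * T\<close> of the chord slope; hence the
  correction \<open>- L * dist x y\<close> in the slopes used for gradients.\<close>

lemma semiconcave_along_geo:
  assumes sc: "semiconcave_on (ball x \<rho>) L f" and L: "0 \<le> L" and \<eta>: "geo x T \<eta>" "T < \<rho>" and t: "0 \<le> t" "t \<le> T"
  shows "f x + ((f (\<eta> T) - f x) / T - L * T) * t \<le> f (\<eta> t)"
proof -
  have T: "T > 0" using geo_pos[OF \<eta>(1)] .
  have d: "dist x (\<eta> t) = t" "dist (\<eta> t) (\<eta> T) = T - t" "dist x (\<eta> T) = T"
    using geo_dist0[OF \<eta>(1)] geo_dist[OF \<eta>(1), of t T] T t by auto
  have "dist (\<eta> t) (\<eta> T) * f x + dist x (\<eta> t) * f (\<eta> T)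
      \<le> dist x (\<eta> T) * (f (\<eta> t) + L * dist x (\<eta> t) * dist (\<eta> t) (\<eta> T))"
    by (rule semiconcave_onD[OF sc]) (use d \<eta> T t in auto)
  then have "(T - t) * f x + t * f (\<eta> T) \<le> T * (f (\<eta> t) + L * t * (T - t))" by (simp only: d)
  also have "\<dots> \<le> T * (f (\<eta> t) + L * t * T)" using T t L by (intro mult_left_mono add_left_mono) auto
  finally have le: "(T - t) * f x + t * f (\<eta> T) \<le> T * (f (\<eta> t) + L * t * T)" .
  define q where "q = (f (\<eta> T) - f x) / T"
  have "f (\<eta> T) = f x + T * q" using T by (simp add: q_def)
  then have "T * (f x + (q - L * T) * t) \<le> T * f (\<eta> t)"
    using le by (simp add: algebra_simps)
  then show ?thesis using T by (simp add: q_def)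
qed

text \<open>If \<open>\<eta>\<close> nearly realises the maximal slope \<open>A\<close> of \<open>f\<close> at \<open>x\<close>, it is nearly the gradient direction:
  its scalar product with any other direction dominates the slope of \<open>f\<close> in that direction.
  The point \<open>y\<close> dividing the segment from \<open>\<eta> t\<close> to \<open>\<xi> t\<close> is compared with \<open>x\<close>; the upper bound on
  \<open>dist x y\<close> comes from the lower bound at the point \<open>\<eta> (2 * t)\<close> beyond \<open>\<eta> t\<close>.\<close>

lemma near_gradient_inner:
  assumes sc: "semiconcave_on (ball x \<rho>) L f" and L: "0 \<le> L" and \<rho>: "\<rho> > 0"
    and \<eta>: "geo x T \<eta>" and \<xi>: "geo x T' \<xi>" and A: "0 \<le> A"
    and up: "\<And>y. y \<in> ball x \<rho> \<Longrightarrow> f y \<le> f x + A * dist x y + L * (dist x y)\<^sup>2"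
    and lo\<eta>: "\<And>t. 0 \<le> t \<Longrightarrow> t \<le> T \<Longrightarrow> f x + (A - \<delta>) * t \<le> f (\<eta> t)"
    and lo\<xi>: "\<And>t. 0 \<le> t \<Longrightarrow> t \<le> T' \<Longrightarrow> f x + D * t \<le> f (\<xi> t)"
    and \<mu>: "0 < \<mu>" "\<mu> \<le> 1"  and \<delta>: "0 \<le> \<delta>"
  shows "D - \<delta> / \<mu> - 2 * A * \<mu> \<le> A * cos_angle \<eta> \<xi>"
proof -
  define c where "c = cos_angle \<eta> \<xi>"
  obtain R where R: "R > 0" "stewart_on C (ball x R)" using stewart_ex by blast
  define t0 where "t0 = min (min (T / 2) T') (min (R / 4) (\<rho> / 4))"
  have t0: "t0 > 0" using R \<rho> geo_pos[OF \<eta>] geo_pos[OF \<xi>] by (simp add: t0_def)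
  \<comment> \<open>\<open>h t\<close> bounds \<open>(dist x y)\<^sup>2 / t\<^sup>2\<close>, and its
    limit \<open>Z\<close> is the squared length of the combination of the two unit vectors with
    weights \<open>1 - \<mu>\<close> and \<open>\<mu>\<close>. The 72 covers Stewart errors of 8 and
    36.\<close>
  define h where "h t = (\<mu> + \<mu>\<^sup>2) * ((dist (\<eta> (1 * t)) (\<xi> (1 * t)))\<^sup>2 / t\<^sup>2) + 1 + \<mu>
      - \<mu> * ((dist (\<eta> (2 * t)) (\<xi> (1 * t)))\<^sup>2 / t\<^sup>2) + 72 * C * t\<^sup>2" for t
  define Z where "Z = 1 - 2 * \<mu> + 2 * \<mu> * c + 2 * \<mu>\<^sup>2 * (1 - c)"
  have "(h \<longlongrightarrow> (\<mu> + \<mu>\<^sup>2) * (1\<^sup>2 + 1\<^sup>2 - 2 * 1 * 1 * c) + 1 + \<mu> - \<mu> * (2\<^sup>2 + 1\<^sup>2 - 2 * 2 * 1 * c) + 72 * C * 0\<^sup>2) (at_right 0)"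
    unfolding h_def c_def
    by (intro tendsto_intros scaled_dist2_tendsto[OF \<eta> \<xi>]) auto
  also have "(\<mu> + \<mu>\<^sup>2) * (1\<^sup>2 + 1\<^sup>2 - 2 * 1 * 1 * c) + 1 + \<mu> - \<mu> * (2\<^sup>2 + 1\<^sup>2 - 2 * 2 * 1 * c) + 72 * C * 0\<^sup>2 = Z"
    by (simp add: Z_def algebra_simps)
  finally have hlim: "(h \<longlongrightarrow> Z) (at_right 0)" .
  \<comment> \<open>13 = 4 + 9: the semiconcavity loss on a segment of length at most
    \<open>2 * t\<close>, and the quadratic term of \<open>up\<close> at distance at most
    \<open>3 * t\<close>.\<close>
  have key: "(1 - \<mu>) * (A - \<delta>) + \<mu> * D - 13 * L * t \<le> A * ((1 + h t) / 2)" if t: "0 < t" "t < t0" for t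
  proof -
    have t': "2 * t \<le> T" "t \<le> T'" "4 * t < R" "4 * t < \<rho>" using t by (auto simp: t0_def)
    define w w2 v where "w = \<eta> t" "w2 = \<eta> (2 * t)" "v = \<xi> t"
    note wv = w_w2_v_def
    have d: "dist x w = t" "dist x w2 = 2 * t" "dist x v = t" "dist w w2 = t"
      using geo_dist0[OF \<eta>, of t] geo_dist0[OF \<eta>, of "2 * t"] geo_dist0[OF \<xi>, of t] geo_dist[OF \<eta>, of t "2 * t"] t t'
      by (auto simp: wv)
    define e where "e = dist w v"
    have e: "0 \<le> e" "e \<le> 2 * t" using dist_triangle_base[of w v x] d by (auto simp: e_def)
    obtain y where y: "dist w y = \<mu> * e" "dist y v = (1 - \<mu>) * e"
    proof (cases "w = v")
      case True
      then show thesis using that[of w] by (simp add: e_def)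
    next
      case False
      then obtain \<zeta> where \<zeta>: "geo w e \<zeta>" "\<zeta> e = v" unfolding e_def by (rule geo_exists)
      have "0 \<le> \<mu> * e" "\<mu> * e \<le> e" using \<mu> e by (auto simp: mult_left_le_one_le)
      then show thesis
        using that[of "\<zeta> (\<mu> * e)"] geo_dist0[OF \<zeta>(1), of "\<mu> * e"] geo_dist[OF \<zeta>(1), of "\<mu> * e" e] \<zeta>(2) e
        by (auto simp: algebra_simps)
    qed
    have \<mu>e: "\<mu> * e \<le> 2 * t" using \<mu> e by (smt (verit) mult_left_le_one_le)
    have xy: "dist x y \<le> 3 * t" using dist_triangle[of x y w] y d \<mu>e by linarith
    have w2y: "dist w2 y \<le> 3 * t" using dist_triangle[of w2 y w] y d \<mu>e by (simp add: dist_commute)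
    have inR: "x \<in> ball x R" "w \<in> ball x R" "w2 \<in> ball x R" "v \<in> ball x R" "y \<in> ball x R"
      using d t t' xy R by auto
    have in\<rho>: "w \<in> ball x \<rho>" "v \<in> ball x \<rho>" "y \<in> ball x \<rho>" using d t t' xy by auto
    \<comment> \<open>Stewart bounds the distance to an inner point only from below. To bound
      \<open>dist x y\<close> from above, \<open>x\<close> is made one end of a segment through
      \<open>w\<close>, and a second use bounds \<open>dist w2 y\<close> from below.\<close>
    have "dist w w2 * (dist y x)\<^sup>2 + dist x w * (dist y w2)\<^sup>2
        \<le> dist x w2 * ((dist y w)\<^sup>2 + (1 + C * (dist y w)\<^sup>2) * dist x w * dist w w2)"
      by (rule stewart_onD[OF R(2)]) (use inR d in auto)
    then have "t * ((dist x y)\<^sup>2 + (dist w2 y)\<^sup>2) \<le> t * (2 * (dist w y)\<^sup>2 + 2 * t\<^sup>2 + 2 * (C * (dist w y)\<^sup>2 * t\<^sup>2))"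
      unfolding d by (simp add: dist_commute algebra_simps power2_eq_square)
    then have S1: "(dist x y)\<^sup>2 + (dist w2 y)\<^sup>2 \<le> 2 * (dist w y)\<^sup>2 + 2 * t\<^sup>2 + 2 * (C * (dist w y)\<^sup>2 * t\<^sup>2)"
      using t by simp
    have S2: "(1 - \<mu>) * t\<^sup>2 + \<mu> * (dist w2 v)\<^sup>2 \<le> (dist w2 y)\<^sup>2 + \<mu> * (1 - \<mu>) * e\<^sup>2 + C * (dist w2 y)\<^sup>2 * e\<^sup>2"
    proof (cases "e = 0")
      case True
      then have "w = v" "y = w" using y by (auto simp: e_def)
      then show ?thesis using True d by (simp add: dist_commute algebra_simps)
    next
      case False
      have "dist y v * (dist w2 w)\<^sup>2 + dist w y * (dist w2 v)\<^sup>2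
          \<le> dist w v * ((dist w2 y)\<^sup>2 + (1 + C * (dist w2 y)\<^sup>2) * dist w y * dist y v)"
        by (rule stewart_onD[OF R(2)]) (use inR y in \<open>auto simp: e_def algebra_simps\<close>)
      then have "e * ((1 - \<mu>) * t\<^sup>2 + \<mu> * (dist w2 v)\<^sup>2) \<le> e * ((dist w2 y)\<^sup>2 + (1 + C * (dist w2 y)\<^sup>2) * (\<mu> * (1 - \<mu>) * e\<^sup>2))"
        unfolding y e_def[symmetric] using d by (simp add: dist_commute algebra_simps power2_eq_square)
      then have "(1 - \<mu>) * t\<^sup>2 + \<mu> * (dist w2 v)\<^sup>2 \<le> (dist w2 y)\<^sup>2 + (1 + C * (dist w2 y)\<^sup>2) * (\<mu> * (1 - \<mu>) * e\<^sup>2)"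
        using False e by simp
      moreover have "C * (dist w2 y)\<^sup>2 * (\<mu> * (1 - \<mu>) * e\<^sup>2) \<le> C * (dist w2 y)\<^sup>2 * (1 * e\<^sup>2)"
        using \<mu> C_nonneg by (intro mult_left_mono mult_right_mono) (auto simp: mult_le_one)
      ultimately show ?thesis by (simp add: algebra_simps)
    qed
    have E1: "C * (dist w y)\<^sup>2 * t\<^sup>2 \<le> C * (2 * t)\<^sup>2 * t\<^sup>2"
      using C_nonneg \<mu>e y(1) e \<mu> by (intro mult_right_mono mult_left_mono power_mono) auto
    have E2: "C * (dist w2 y)\<^sup>2 * e\<^sup>2 \<le> C * (3 * t)\<^sup>2 * (2 * t)\<^sup>2"
      using C_nonneg w2y e by (intro mult_mono mult_left_mono power_mono) auto
    have wv': "(dist w v)\<^sup>2 = e\<^sup>2" "(dist w y)\<^sup>2 = \<mu>\<^sup>2 * e\<^sup>2" by (simp_all add: e_def y(1) power_mult_distrib)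
    have E3: "0 \<le> C * t\<^sup>2 * t\<^sup>2" using C_nonneg by simp
    have "(dist x y)\<^sup>2 \<le> (\<mu> + \<mu>\<^sup>2) * e\<^sup>2 + t\<^sup>2 + \<mu> * t\<^sup>2 - \<mu> * (dist w2 v)\<^sup>2 + 72 * C * t\<^sup>2 * t\<^sup>2"
      using S1 S2 E1 E2 E3 wv'(2) by (simp add: algebra_simps power2_eq_square)
    also have "\<dots> = t\<^sup>2 * h t"
      using t by (simp add: h_def e_def wv field_simps)
    finally have "(dist x y)\<^sup>2 \<le> t\<^sup>2 * h t" .
    define u where "u = dist x y / t"
    have "u\<^sup>2 \<le> h t" using t \<open>_ \<le> t\<^sup>2 * h t\<close> by (simp add: u_def power_divide field_simps)
    moreover have "2 * u \<le> u\<^sup>2 + 1" using zero_le_power2[of "u - 1"] by (simp add: power2_diff)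
    ultimately have "2 * u \<le> h t + 1" by (meson add_right_mono order_trans)
    then have "u \<le> (1 + h t) / 2" by (simp add: add.commute)
    then have "dist x y / t \<le> (1 + h t) / 2" by (simp add: u_def)
    then have dxy: "dist x y \<le> t * ((1 + h t) / 2)" using t by (simp add: field_simps)
    have fy: "(1 - \<mu>) * f w + \<mu> * f v - 4 * L * t\<^sup>2 \<le> f y"
    proof (cases "e = 0")
      case True
      then have "w = v" "y = w" using y by (auto simp: e_def)
      then show ?thesis using L by (simp add: algebra_simps)
    next
      case False
      have "dist y v * f w + dist w y * f v \<le> dist w v * (f y + L * dist w y * dist y v)"
        by (rule semiconcave_onD[OF sc]) (use in\<rho> y in \<open>auto simp: e_def algebra_simps\<close>)
      then have "e * ((1 - \<mu>) * f w + \<mu> * f v) \<le> e * (f y + L * (\<mu> * (1 - \<mu>) * e\<^sup>2))"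
        unfolding y e_def[symmetric] by (simp add: algebra_simps power2_eq_square)
      then have "(1 - \<mu>) * f w + \<mu> * f v \<le> f y + L * (\<mu> * (1 - \<mu>) * e\<^sup>2)" using False e by simp
      moreover have "L * (\<mu> * (1 - \<mu>) * e\<^sup>2) \<le> L * (1 * (2 * t)\<^sup>2)"
        using \<mu> L e by (intro mult_left_mono mult_mono power_mono) (auto simp: mult_le_one)
      ultimately show ?thesis by simp
    qed
    have "(1 - \<mu>) * (f x + (A - \<delta>) * t) \<le> (1 - \<mu>) * f w" "\<mu> * (f x + D * t) \<le> \<mu> * f v"
      using lo\<eta>[of t] lo\<xi>[of t] t t' \<mu> by (auto intro!: mult_left_mono simp: wv)
    moreover have "f y \<le> f x + A * dist x y + L * (3 * t)\<^sup>2"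
    proof -
      have "L * (dist x y)\<^sup>2 \<le> L * (3 * t)\<^sup>2" using xy L by (intro mult_left_mono power_mono) auto
      then show ?thesis using up[OF in\<rho>(3)] by linarith
    qed
    moreover have "A * dist x y \<le> A * (t * ((1 + h t) / 2))" using dxy A by (rule mult_left_mono)
    ultimately have "t * ((1 - \<mu>) * (A - \<delta>) + \<mu> * D - 13 * L * t) \<le> t * (A * ((1 + h t) / 2))"
      using fy by (simp add: algebra_simps power2_eq_square)
    then show ?thesis using t by simp
  qed
  \<comment> \<open>Since \<open>(1 + Z) / 2 = 1 - \<mu> + \<mu> * c + \<mu>\<^sup>2 * (1 -
    c)\<close>, the terms \<open>A * (1 - \<mu>)\<close> cancel and the rest can be divided by
    \<open>\<mu>\<close>.\<close>
  have "(1 - \<mu>) * (A - \<delta>) + \<mu> * D - 13 * L * 0 \<le> A * ((1 + Z) / 2)"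
  proof (rule tendsto_le[of "at_right (0::real)"])
    show "((\<lambda>t. A * ((1 + h t) / 2)) \<longlongrightarrow> A * ((1 + Z) / 2)) (at_right 0)"
      by (intro tendsto_intros hlim) auto
    show "((\<lambda>t. (1 - \<mu>) * (A - \<delta>) + \<mu> * D - 13 * L * t) \<longlongrightarrow> (1 - \<mu>) * (A - \<delta>) + \<mu> * D - 13 * L * 0) (at_right 0)"
      by (intro tendsto_intros)
    show "eventually (\<lambda>t. (1 - \<mu>) * (A - \<delta>) + \<mu> * D - 13 * L * t \<le> A * ((1 + h t) / 2)) (at_right 0)"
      by (rule eventually_mono[OF eventually_at_right_real[OF t0]]) (use key in auto)
  qed simp
  then have "\<mu> * D - \<delta> + \<mu> * \<delta> \<le> \<mu> * (A * c + A * \<mu> * (1 - c))"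
    by (simp add: Z_def algebra_simps power2_eq_square)
  moreover have "A * \<mu> * (1 - c) \<le> A * \<mu> * 2" using A \<mu> by (intro mult_left_mono) (auto simp: c_def)
  then have "\<mu> * (A * c + A * \<mu> * (1 - c)) \<le> \<mu> * (A * c + 2 * A * \<mu>)" using \<mu> by (intro mult_left_mono) auto
  moreover have "0 \<le> \<mu> * \<delta>" using \<mu> \<delta> by simp
  ultimately have "\<mu> * D - \<delta> \<le> \<mu> * (A * c + 2 * A * \<mu>)" by linarith
  then have "D - \<delta> / \<mu> \<le> A * c + 2 * A * \<mu>" using \<mu> by (simp add: field_simps)
  then show ?thesis by (simp add: c_def)
qed

text \<open>A detour over \<open>\<xi> (M * t)\<close>: for large \<open>M\<close>, the limit
  \<open>sqrt (1 + M\<^sup>2 - 2 * M * c)\<close> of the rescaled distance exceeds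
  \<open>M - c\<close> by at most \<open>1 / (2 * M)\<close>, and the rest of \<open>\<xi>\<close>
  is traversed exactly.\<close>

lemma first_variation_upper:
  assumes \<eta>: "geo x T \<eta>" and \<xi>: "geo x T' \<xi>" and \<epsilon>: "\<epsilon> > 0"
  shows "eventually (\<lambda>t. dist (\<xi> T') (\<eta> t) \<le> T' - t * (cos_angle \<eta> \<xi> - \<epsilon>)) (at_right 0)"
proof -
  define c where "c = cos_angle \<eta> \<xi>"
  define M where "M = 1 / \<epsilon> + 1"
  have M: "M > 0" "1 / (2 * M) \<le> \<epsilon> / 2" "M \<ge> 1" using \<epsilon> by (auto simp: M_def field_simps add_pos_pos)
  have "sqrt (1\<^sup>2 + M\<^sup>2 - 2 * 1 * M * c) \<le> M - c + 1 / (2 * M)"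
  proof (rule real_le_lsqrt)
    have c1: "\<bar>c\<bar> \<le> 1" by (simp add: c_def)
    then show "0 \<le> M - c + 1 / (2 * M)" using M by (smt (verit) zero_le_divide_1_iff)
    have "(M - c + 1 / (2 * M))\<^sup>2 = M\<^sup>2 - 2 * M * c + 1 + (c - 1 / (2 * M))\<^sup>2"
      using M by (simp add: power2_eq_square field_simps)
    then show "1\<^sup>2 + M\<^sup>2 - 2 * 1 * M * c \<le> (M - c + 1 / (2 * M))\<^sup>2" by simp
  qed
  also have "\<dots> < M - c + \<epsilon>" using M \<epsilon> by simp
  finally have "eventually (\<lambda>t. dist (\<eta> (1 * t)) (\<xi> (M * t)) / t < M - c + \<epsilon>) (at_right 0)"
    using order_tendstoD(2)[OF scaled_dist_tendsto[OF \<eta> \<xi>, of 1 M]] M unfolding c_def by simp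
  moreover have "0 < T' / M" using M geo_pos[OF \<xi>] by simp
  note eventually_at_right_real[OF this]
  ultimately show ?thesis
  proof eventually_elim
    case (elim t)
    then have t: "0 < t" "M * t < T'" using M by (auto simp: field_simps)
    then have "dist (\<eta> t) (\<xi> (M * t)) \<le> t * (M - c + \<epsilon>)" using elim by (simp add: field_simps)
    moreover have "dist (\<xi> T') (\<xi> (M * t)) = T' - M * t" using geo_dist[OF \<xi>, of T' "M * t"] t M by simp
    ultimately show ?case
      using dist_triangle[of "\<xi> T'" "\<eta> t" "\<xi> (M * t)"] by (simp add: c_def[symmetric] dist_commute algebra_simps)
  qed
qed

text \<open>All geodesics to \<open>r\<close> must be controlled: those from
  \<open>\<gamma> (t n)\<close> to \<open>r\<close> cluster at a geodesic \<open>h\<close> from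
  \<open>p\<close> to \<open>r\<close> that cannot be prescribed. At a fixed small distance
  \<open>s\<close>, Stewart on the segment from \<open>p\<close> to \<open>\<gamma> s\<close>
  transfers the angle of \<open>h\<close> to the nearby geodesics.\<close>

lemma first_variation_lower:
  assumes \<gamma>: "geo p T \<gamma>" and pr: "p \<noteq> r" and e: "e > 0"
    and \<beta>: "\<And>\<sigma>. minimal_geodesic p r \<sigma> \<Longrightarrow> cos_angle \<gamma> \<sigma> \<le> \<beta>"
  shows "eventually (\<lambda>t. dist r p - t * (\<beta> + e) \<le> dist r (\<gamma> t)) (at_right 0)"
proof (rule ccontr)
  assume ne: "\<not> ?thesis"
  define d where "d = dist p r"
  have d: "d > 0" using pr by (simp add: d_def)
  have T: "T > 0" using geo_pos[OF \<gamma>] .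
  have "\<exists>t. 0 < t \<and> t < min T (1 / real (Suc n)) \<and> dist r (\<gamma> t) < d - t * (\<beta> + e)" for n
  proof -
    have "0 < min T (1 / real (Suc n))" using T by simp
    then show ?thesis using ne unfolding eventually_at_right_field d_def by (metis dist_commute not_le)
  qed
  then obtain t where t: "\<And>n. 0 < t n" "\<And>n. t n < T" "\<And>n. t n < 1 / real (Suc n)"
    "\<And>n. dist r (\<gamma> (t n)) < d - t n * (\<beta> + e)"
    by (metis min_less_iff_conj)
  define l where "l n = dist (\<gamma> (t n)) r" for n
  have "\<forall>n. \<exists>\<sigma>. minimal_geodesic (\<gamma> (t n)) r \<sigma>" using geodesic_exists by blast
  then obtain \<sigma> where "\<And>n. minimal_geodesic (\<gamma> (t n)) r (\<sigma> n)" by metis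
  then have \<sigma>: "\<And>n. \<sigma> n 0 = \<gamma> (t n)" "\<And>n. \<sigma> n (l n) = r"
    "\<And>n u v. 0 \<le> u \<Longrightarrow> u \<le> l n \<Longrightarrow> 0 \<le> v \<Longrightarrow> v \<le> l n \<Longrightarrow> dist (\<sigma> n u) (\<sigma> n v) = \<bar>u - v\<bar>"
    by (auto simp: minimal_geodesic_def l_def)
  have l0: "0 \<le> l n" for n by (simp add: l_def)
  have p\<gamma>: "dist p (\<gamma> (t n)) = t n" for n using geo_dist0[OF \<gamma>, of "t n"] t[of n] by (simp add: less_imp_le)
  have ld: "\<bar>l n - d\<bar> \<le> t n" for n
    using abs_dist_diff[of r "\<gamma> (t n)" p] p\<gamma>[of n] by (simp add: l_def d_def dist_commute)
  \<comment> \<open>The lengths \<open>l n\<close> vary; clamping the parameter makes all paths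
    total with values in one compact ball.\<close>
  define cl where "cl n s = min (max s 0) (l n)" for n s
  have cl: "0 \<le> cl n s" "cl n s \<le> l n" for n s using l0 by (auto simp: cl_def)
  define f where "f n s = \<sigma> n (cl n s)" for n s
  have fr: "dist (f n s) r = l n - cl n s" for n s
    using \<sigma>(3)[of "cl n s" n "l n"] cl l0 \<sigma>(2) by (simp add: f_def)
  have "f n s \<in> cball r (d + T)" for n s
    using fr[of n s] cl[of n s] ld[of n] t(2)[of n] by (simp add: dist_commute)
  then obtain G h where G: "G \<noteq> bot" "G \<le> sequentially" and h: "\<And>s. ((\<lambda>n. f n s) \<longlongrightarrow> h s) G"
    using pointwise_cluster_point[OF proper[of r "d + T"], of f] by blast
  have t_lim: "(t \<longlongrightarrow> 0) G"
  proof (rule tendsto_mono[OF G(2)], rule tendsto_sandwich[OF _ _ tendsto_const LIMSEQ_Suc[OF lim_1_over_n]])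
    show "eventually (\<lambda>n. 0 \<le> t n) sequentially" "eventually (\<lambda>n. t n \<le> 1 / real (Suc n)) sequentially"
      by (intro always_eventually allI less_imp_le t)+
  qed
  have "((\<lambda>n. l n - d) \<longlongrightarrow> 0) G"
    by (rule Lim_null_comparison[OF _ t_lim]) (use ld in auto)
  then have l_lim: "(l \<longlongrightarrow> d) G" by (simp add: LIM_zero_iff)
  have dh: "dist (h s) (h s') = \<bar>s - s'\<bar>" if s: "s \<in> {0..d}" "s' \<in> {0..d}" for s s'
  proof -
    have "((\<lambda>n. \<bar>cl n s - cl n s'\<bar>) \<longlongrightarrow> \<bar>min (max s 0) d - min (max s' 0) d\<bar>) G"
      unfolding cl_def by (intro tendsto_intros l_lim)
    moreover have "((\<lambda>n. dist (f n s) (f n s')) \<longlongrightarrow> dist (h s) (h s')) G" by (intro tendsto_intros h)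
    moreover have "(\<lambda>n. dist (f n s) (f n s')) = (\<lambda>n. \<bar>cl n s - cl n s'\<bar>)"
      using \<sigma>(3) cl by (auto simp: f_def)
    ultimately have "dist (h s) (h s') = \<bar>min (max s 0) d - min (max s' 0) d\<bar>"
      using tendsto_unique[OF G(1)] by metis
    then show ?thesis using s by simp
  qed
  have h0: "h 0 = p"
  proof -
    have "((\<lambda>n. dist (f n 0) p) \<longlongrightarrow> dist (h 0) p) G" by (intro tendsto_intros h)
    moreover have "(\<lambda>n. dist (f n 0) p) = t" using \<sigma>(1) p\<gamma> l0 by (auto simp: f_def cl_def dist_commute)
    ultimately have "dist (h 0) p = 0" using t_lim tendsto_unique[OF G(1)] by metis
    then show ?thesis by simp
  qed
  have hd: "h d = r"
  proof -
    have "((\<lambda>n. dist (f n d) r) \<longlongrightarrow> dist (h d) r) G" by (intro tendsto_intros h)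
    moreover have "((\<lambda>n. dist (f n d) r) \<longlongrightarrow> d - min (max d 0) d) G"
      unfolding fr cl_def by (intro tendsto_intros l_lim)
    ultimately have "dist (h d) r = d - min (max d 0) d" using tendsto_unique[OF G(1)] by metis
    then show ?thesis using d by simp
  qed
  have hmin: "minimal_geodesic p r h" using dh h0 hd by (simp add: minimal_geodesic_def d_def)
  then have hg: "geo p d h" using geo_minimal pr by (simp add: d_def)
  have \<beta>1: "-1 \<le> \<beta>" using \<beta>[OF hmin] cos_ge_minus_one order_trans by blast
  have "0 < e / 4" using e by simp
  then obtain \<delta> where \<delta>: "\<delta> > 0" "\<And>s t. 0 < s \<Longrightarrow> s < \<delta> \<Longrightarrow> 0 < t \<Longrightarrow> t < \<delta> \<Longrightarrow>
      \<bar>ccos \<gamma> h s t - cos_angle \<gamma> h\<bar> < e / 4"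
    using ccos_tendsto_cos_angle[OF \<gamma> hg] by meson
  obtain R where R: "R > 0" "stewart_on C (ball p R)" using stewart_ex by blast
  \<comment> \<open>Two scales: \<open>s\<close> is fixed first, and only then is \<open>n\<close>
    chosen with \<open>t n < s\<close>.\<close>
  define s where "s = Min {\<delta> / 2, T / 2, d / 2, R / 4, 1, e / (4 * (C + 1))}"
  have "s \<le> \<delta> / 2" "s \<le> T / 2" "s \<le> d / 2" "s \<le> R / 4" "s \<le> 1" "s \<le> e / (4 * (C + 1))"
    unfolding s_def by (rule Min_le; simp)+
  moreover have "0 < s" using \<delta>(1) T d R(1) e C_nonneg by (auto simp: s_def)
  ultimately have s: "0 < s" "s \<le> \<delta> / 2" "s \<le> T / 2" "s \<le> d / 2" "s \<le> R / 4" "s \<le> 1" "s \<le> e / (4 * (C + 1))"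
    by auto
  have Cs: "C * s\<^sup>2 \<le> e / 4"
  proof -
    have "C * s\<^sup>2 \<le> C * s" using s C_nonneg by (intro mult_left_mono) (auto simp: power2_eq_square mult_left_le)
    also have "\<dots> \<le> (C + 1) * s" using s by simp
    also have "\<dots> \<le> e / 4" using s(7) C_nonneg by (simp add: field_simps)
    finally show ?thesis .
  qed
  \<comment> \<open>The coefficient of \<open>t n\<close> in the Stewart bound for
    \<open>(dist z p)\<^sup>2\<close>; its limit is \<open>2 * s\<close> times the comparison cosine
    of \<open>\<gamma>\<close> and \<open>h\<close>, plus \<open>C * s ^ 3\<close>.\<close>
  define B where "B n = s * (1 + C * s\<^sup>2) + ((dist (f n s) p)\<^sup>2 - (dist (f n s) (\<gamma> s))\<^sup>2) / s" for n
  have "(B \<longlongrightarrow> s * (1 + C * s\<^sup>2) + ((dist (h s) p)\<^sup>2 - (dist (h s) (\<gamma> s))\<^sup>2) / s) G"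
    unfolding B_def using s by (intro tendsto_intros h) auto
  moreover have "s * (1 + C * s\<^sup>2) + ((dist (h s) p)\<^sup>2 - (dist (h s) (\<gamma> s))\<^sup>2) / s < 2 * s * (\<beta> + e / 2)"
  proof -
    have hp: "dist (h s) p = s" using geo_dist0[OF hg, of s] s d by simp
    have cc: "ccos \<gamma> h s s < \<beta> + e / 4" 
    proof -
      have "\<bar>ccos \<gamma> h s s - cos_angle \<gamma> h\<bar> < e / 4" using s \<delta>(1) by (intro \<delta>(2)) auto
      then show ?thesis using \<beta>[OF hmin] by linarith
    qed
    have "s * (1 + C * s\<^sup>2) + (s\<^sup>2 - (dist (h s) (\<gamma> s))\<^sup>2) / s = s * (2 * ccos \<gamma> h s s + C * s\<^sup>2)"
      using s by (simp add: ccos_def ecos_def field_simps power2_eq_square dist_commute)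
    also have "\<dots> < s * (2 * (\<beta> + e / 2))" using cc Cs s e by (intro mult_strict_left_mono) auto
    finally show ?thesis using hp by (simp add: mult_ac)
  qed
  ultimately have ev1: "eventually (\<lambda>n. B n < 2 * s * (\<beta> + e / 2)) G" by (rule order_tendstoD(2))
  have ev2: "eventually (\<lambda>n. t n < s) G" using order_tendstoD(2)[OF t_lim s(1)] .
  have ev3: "eventually (\<lambda>n. s < l n) G" using order_tendstoD(1)[OF l_lim, of s] s d by simp
  have "eventually (\<lambda>n. B n < 2 * s * (\<beta> + e / 2) \<and> t n < s \<and> s < l n) G"
    using ev1 ev2 ev3 by eventually_elim auto
  then obtain n where n: "B n < 2 * s * (\<beta> + e / 2)" "t n < s" "s < l n"
    using eventually_happens'[OF G(1)] by blast
  define z where "z = f n s"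
  have cls: "cl n s = s" using n s by (simp add: cl_def)
  have z\<gamma>: "dist z (\<gamma> (t n)) = s" using \<sigma>(1)[of n] \<sigma>(3)[of s n 0] n s by (simp add: z_def f_def cls)
  have zr: "dist z r = l n - s" using fr[of n s] by (simp add: z_def cls)
  have pos: "0 < t n" using t(1) .
  have d3: "dist p (\<gamma> (t n)) = t n" "dist p (\<gamma> s) = s" "dist (\<gamma> (t n)) (\<gamma> s) = s - t n"
    using geo_dist0[OF \<gamma>, of s] geo_dist[OF \<gamma>, of "t n" s] p\<gamma>[of n] n s pos T by auto
  have "dist p z \<le> t n + s" using dist_triangle[of p z "\<gamma> (t n)"] z\<gamma> d3 by (simp add: dist_commute)
  then have "dist (\<gamma> (t n)) (\<gamma> s) * (dist z p)\<^sup>2 + dist p (\<gamma> (t n)) * (dist z (\<gamma> s))\<^sup>2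
      \<le> dist p (\<gamma> s) * ((dist z (\<gamma> (t n)))\<^sup>2 + (1 + C * (dist z (\<gamma> (t n)))\<^sup>2) * dist p (\<gamma> (t n)) * dist (\<gamma> (t n)) (\<gamma> s))"
    using d3 n s R by (intro stewart_onD[OF R(2)]) auto
  then have st: "(s - t n) * (dist z p)\<^sup>2 + t n * (dist z (\<gamma> s))\<^sup>2 \<le> s * (s\<^sup>2 + (1 + C * s\<^sup>2) * t n * (s - t n))"
    unfolding d3 z\<gamma> .
  have "(1 + C * s\<^sup>2) * t n * (s - t n) \<le> (1 + C * s\<^sup>2) * t n * s"
    using pos C_nonneg by (intro mult_left_mono) auto
  then have "s * (s\<^sup>2 + (1 + C * s\<^sup>2) * t n * (s - t n)) \<le> s * (s\<^sup>2 + (1 + C * s\<^sup>2) * t n * s)"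
    using s(1) by (simp only: mult_le_cancel_left_pos add_le_cancel_left)
  then have "s * (dist z p)\<^sup>2 \<le> s * (s\<^sup>2 + t n * (s * (1 + C * s\<^sup>2))) + t n * ((dist z p)\<^sup>2 - (dist z (\<gamma> s))\<^sup>2)"
    using st by (simp add: algebra_simps)
  also have "(dist z p)\<^sup>2 - (dist z (\<gamma> s))\<^sup>2 = s * (B n - s * (1 + C * s\<^sup>2))"
    using s by (simp add: B_def z_def)
  finally have "s * (dist z p)\<^sup>2 \<le> s * (s\<^sup>2 + t n * B n)" by (simp add: algebra_simps)
  then have "(dist z p)\<^sup>2 \<le> s\<^sup>2 + t n * B n" using s by simp
  also have "\<dots> \<le> s\<^sup>2 + t n * (2 * s * (\<beta> + e / 2))" using n pos by simp
  also have "\<dots> \<le> (s + t n * (\<beta> + e / 2))\<^sup>2" by (simp add: power2_sum)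
  finally have "(dist z p)\<^sup>2 \<le> (s + t n * (\<beta> + e / 2))\<^sup>2" .
  moreover have "0 \<le> s + t n * (\<beta> + e / 2)"
  proof -
    have "t n * (-1) \<le> t n * (\<beta> + e / 2)" using \<beta>1 e pos by (intro mult_left_mono) auto
    then show ?thesis using n by simp
  qed
  ultimately have "dist z p \<le> s + t n * (\<beta> + e / 2)" by (rule power2_le_imp_le)
  moreover have "d \<le> dist z p + dist z r" using dist_triangle_base[of p r z] by (simp add: d_def)
  ultimately have "d \<le> l n + t n * (\<beta> + e / 2)" using zr by linarith
  moreover have "l n < d - t n * (\<beta> + e)" using t(4)[of n] by (simp add: l_def dist_commute)
  moreover have "t n * (\<beta> + e / 2) < t n * (\<beta> + e)" using pos e by simp
  ultimately show False by linarith
qed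

lemma geo_restrict: "geo x T \<gamma> \<Longrightarrow> 0 < T' \<Longrightarrow> T' \<le> T \<Longrightarrow> geo x T' \<gamma>"
  by (auto simp: geo_def)

lemma geo_reverse:
  assumes "geo x T \<gamma>" "\<gamma> T = y" shows "geo y T (\<lambda>s. \<gamma> (T - s))"
  using assms by (auto simp: geo_def)

text \<open>One Euler step of the gradient flow of \<open>dist r\<close>. Since the flow commutes with \<open>g\<close>, the
  displacement grows only at a rate proportional to itself.\<close>

lemma gradient_step:
  assumes iso: "\<And>x y. dist (g x) (g y) = dist (x::'a) y" and surj: "surj g" and gr: "g r = r"
    and sc: "semiconcave_on (ball x \<rho>) L (dist r)" "semiconcave_on (ball (g x) \<rho>) L (dist r)" and L: "0 \<le> L"
    and q: "q \<in> ball x \<rho>" "q \<noteq> x" and gx: "dist x (g x) < \<rho>"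
    and D: "D \<le> (dist r q - dist r x) / dist x q - L * dist x q" and e: "0 < e" "e < D"
  obtains T \<eta> where "geo x T \<eta>"
    "eventually (\<lambda>t. dist q (\<eta> t) \<le> dist q x - t * (D - e)) (at_right 0)"
    "x \<noteq> g x \<Longrightarrow> eventually (\<lambda>t. dist (\<eta> t) (g (\<eta> t))
        \<le> dist x (g x) + t * ((2 * L * dist x (g x) + e) / D + e)) (at_right 0)"
proof -
  define f where "f = dist r"
  have fg: "f (g y) = f y" for y using iso[of r y] gr by (simp add: f_def)
  have \<rho>: "\<rho> > 0" using q(1) by (metis mem_ball order_le_less_trans zero_le_dist)
  define slope where "slope y = (f y - f x) / dist x y - L * dist x y" for y
  \<comment> \<open>A stand-in for the norm of the gradient; the correction in \<open>slope\<close>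
    yields both the bound \<open>up\<close> on the whole ball and linear growth towards a nearly
    optimal point. The supremum may not be attained, hence \<open>\<delta>\<close>.\<close>
  define A where "A = (SUP y\<in>ball x \<rho> - {x}. slope y)"
  have slope1: "slope y \<le> 1" if "y \<noteq> x" for y
  proof -
    have "f y - f x \<le> dist x y" using dist_triangle[of r y x] by (simp add: f_def)
    then have "(f y - f x) / dist x y \<le> 1" using that by simp
    moreover have "0 \<le> L * dist x y" using L by simp
    ultimately show ?thesis by (simp add: slope_def)
  qed
  have bdd: "bdd_above (slope ` (ball x \<rho> - {x}))" using slope1 by (intro bdd_aboveI[of _ 1]) auto
  have slopeA: "slope y \<le> A" if "y \<in> ball x \<rho>" "y \<noteq> x" for y
    unfolding A_def using that bdd by (intro cSUP_upper) auto
  have DA: "D \<le> slope q" using D by (simp add: slope_def f_def)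
  then have A: "D \<le> A" "0 < A" using slopeA[OF q] e by auto
  have "A \<le> 1" unfolding A_def using slope1 q by (intro cSUP_least) auto
  note A = A this
  have up: "f y \<le> f x + A * dist x y + L * (dist x y)\<^sup>2" if "y \<in> ball x \<rho>" for y
  proof (cases "y = x")
    case False
    then have "slope y * dist x y \<le> A * dist x y" using slopeA that by (intro mult_right_mono) auto
    moreover have "(f y - f x) / dist x y * dist x y = f y - f x" using False by simp
    moreover have "slope y * dist x y = (f y - f x) / dist x y * dist x y - L * (dist x y)\<^sup>2"
      unfolding slope_def by (simp only: left_diff_distrib power2_eq_square mult.assoc)
    ultimately show ?thesis by linarith
  qed simp
  \<comment> \<open>Chosen so that the error \<open>\<delta> / \<mu> + 2 * A * \<mu>\<close> of
    \<open>near_gradient_inner\<close> is at most \<open>e / 2\<close>, given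
    \<open>A \<le> 1\<close>.\<close>
  define \<tau> where "\<tau> = e / 2"
  define \<mu> where "\<mu> = min 1 (\<tau> / 4)"
  define \<delta> where "\<delta> = \<mu> * \<tau> / 2"
  have \<mu>: "0 < \<mu>" "\<mu> \<le> 1" "0 < \<delta>" "0 < \<tau>" "\<delta> / \<mu> = \<tau> / 2" "2 * \<mu> \<le> \<tau> / 2"
    using e by (auto simp: \<mu>_def \<delta>_def \<tau>_def min_def)
  have err: "\<delta> / \<mu> + 2 * A * \<mu> \<le> \<tau>"
  proof -
    have "A * (2 * \<mu>) \<le> 1 * (2 * \<mu>)" using A \<mu> by (intro mult_right_mono) auto
    moreover have "2 * A * \<mu> = A * (2 * \<mu>)" by simp
    ultimately show ?thesis using \<mu>(5,6) by linarith
  qed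
  have "A - \<delta> < (SUP y\<in>ball x \<rho> - {x}. slope y)" using \<mu>(3) by (simp add: A_def)
  moreover have "ball x \<rho> - {x} \<noteq> {}" using q by auto
  ultimately have "\<exists>y\<in>ball x \<rho> - {x}. A - \<delta> < slope y" using less_cSUP_iff[OF _ bdd] by blast
  then obtain y0 where y0: "y0 \<in> ball x \<rho>" "y0 \<noteq> x" "A - \<delta> < slope y0"
    by (metis Diff_iff singletonI)
  obtain \<eta> where \<eta>: "geo x (dist x y0) \<eta>" "\<eta> (dist x y0) = y0" using geo_exists y0(2) by metis
  define T where "T = dist x y0"
  have lo\<eta>: "f x + (A - \<delta>) * t \<le> f (\<eta> t)" if t: "0 \<le> t" "t \<le> T" for t
  proof -
    have "(A - \<delta>) * t \<le> slope y0 * t" using y0(3) t by (intro mult_right_mono) auto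
    then show ?thesis
      using semiconcave_along_geo[OF sc(1) L \<eta>(1), of t] y0(1) t \<eta>(2) by (simp add: f_def T_def slope_def)
  qed
  have inner: "Dx - \<tau> \<le> A * cos_angle \<eta> \<xi>"
    if "geo x T' \<xi>" "\<And>t. 0 \<le> t \<Longrightarrow> t \<le> T' \<Longrightarrow> f x + Dx * t \<le> f (\<xi> t)" for T' \<xi> Dx
    using near_gradient_inner[OF sc(1) L \<rho> \<eta>(1) that(1), of A \<delta> Dx \<mu>] up lo\<eta> that(2) A \<mu> err
    by (auto simp: f_def T_def)
  have g\<eta>: "geo (g x) T (g \<circ> \<eta>)" using \<eta>(1) iso by (auto simp: geo_def T_def)
  have up': "f y \<le> f (g x) + A * dist (g x) y + L * (dist (g x) y)\<^sup>2" if "y \<in> ball (g x) \<rho>" for y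
  proof -
    obtain y' where y': "y = g y'" using surj by (metis surjD)
    then show ?thesis using up[of y'] that by (simp add: fg iso)
  qed
  have inner': "Dx - \<tau> \<le> A * cos_angle (g \<circ> \<eta>) \<xi>"
    if "geo (g x) T' \<xi>" "\<And>t. 0 \<le> t \<Longrightarrow> t \<le> T' \<Longrightarrow> f (g x) + Dx * t \<le> f (\<xi> t)" for T' \<xi> Dx
    using near_gradient_inner[OF sc(2) L \<rho> g\<eta> that(1), of A \<delta> Dx \<mu>] up' lo\<eta> that(2) A \<mu> err fg
    by (auto simp: f_def T_def)
  show thesis
  proof (rule that[OF \<eta>(1)])
    have "x \<noteq> q" using q by simp
    then obtain \<xi> where \<xi>: "geo x (dist x q) \<xi>" "\<xi> (dist x q) = q" by (rule geo_exists)
    have "slope q - \<tau> \<le> A * cos_angle \<eta> \<xi>"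
      using semiconcave_along_geo[OF sc(1) L \<xi>(1)] \<xi>(2) q
      by (intro inner[OF \<xi>(1)]) (simp add: f_def slope_def)
    then have Ac: "D - \<tau> \<le> A * cos_angle \<eta> \<xi>" using DA by linarith
    \<comment> \<open>A positive scalar product with a vector of length \<open>A \<le> 1\<close> is
      at most the cosine.\<close>
    have "D - \<tau> \<le> cos_angle \<eta> \<xi>"
    proof -
      have "0 < A * cos_angle \<eta> \<xi>" using Ac e by (simp add: \<tau>_def)
      then have "0 < cos_angle \<eta> \<xi>" using A by (simp add: zero_less_mult_iff)
      then have "A * cos_angle \<eta> \<xi> \<le> 1 * cos_angle \<eta> \<xi>"
        using A by (intro mult_right_mono) auto
      then show ?thesis using Ac by simp
    qed
    then have c: "D - e \<le> cos_angle \<eta> \<xi> - \<tau>" by (simp add: \<tau>_def)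
    show "eventually (\<lambda>t. dist q (\<eta> t) \<le> dist q x - t * (D - e)) (at_right 0)"
      using first_variation_upper[OF \<eta>(1) \<xi>(1) \<mu>(4)] eventually_at_right_less[of "0::real"]
    proof eventually_elim
      case (elim t)
      have "t * (D - e) \<le> t * (cos_angle \<eta> \<xi> - \<tau>)" using c elim(2) by (intro mult_left_mono) auto
      then show ?case using elim(1)[unfolded \<xi>(2)] dist_commute[of x q] by linarith
    qed
  next
    assume ne: "x \<noteq> g x"
    define l where "l = dist x (g x)"
    have l: "0 < l" using ne by (simp add: l_def)
    obtain \<xi> where \<xi>: "geo x l \<xi>" "\<xi> l = g x" unfolding l_def using ne by (rule geo_exists)
    define \<xi>' where "\<xi>' s = \<xi> (l - s)" for s
    have \<xi>': "geo (g x) l \<xi>'" unfolding \<xi>'_def using \<xi> by (rule geo_reverse)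
    have \<xi>'l: "\<xi>' l = x" using geo_0[OF \<xi>(1)] by (simp add: \<xi>'_def)
    \<comment> \<open>\<open>f\<close> agrees at \<open>x\<close> and \<open>g x\<close>, so the
      chord has slope 0 in both directions and only the semiconcavity error \<open>L * l\<close>
      remains.\<close>
    have "- (L * l) - \<tau> \<le> A * cos_angle \<eta> \<xi>"
      using semiconcave_along_geo[OF sc(1) L \<xi>(1)] \<xi>(2) gx l fg[of x]
      by (intro inner[OF \<xi>(1)]) (simp add: f_def l_def)
    moreover have "- (L * l) - \<tau> \<le> A * cos_angle (g \<circ> \<eta>) \<xi>'"
      using semiconcave_along_geo[OF sc(2) L \<xi>'] \<xi>'l gx l fg[of x]
      by (intro inner'[OF \<xi>']) (simp add: f_def l_def)
    ultimately have "- (2 * L * l + e) \<le> A * (cos_angle \<eta> \<xi> + cos_angle (g \<circ> \<eta>) \<xi>')"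
      by (simp add: \<tau>_def algebra_simps)
    then have "- ((2 * L * l + e) / A) \<le> cos_angle \<eta> \<xi> + cos_angle (g \<circ> \<eta>) \<xi>'"
      using A by (simp add: field_simps)
    moreover have "(2 * L * l + e) / A \<le> (2 * L * l + e) / D"
      using A e L l by (intro divide_left_mono) auto
    ultimately have cc: "- ((2 * L * l + e) / D + e)
        \<le> (cos_angle \<eta> \<xi> - \<tau>) + (cos_angle (g \<circ> \<eta>) \<xi>' - \<tau>)"
      by (simp add: \<tau>_def)
    \<comment> \<open>Both ends of the geodesic move; splitting it at the midpoint lets first
      variation treat them separately.\<close>
    have half: "geo x (l / 2) \<xi>" "geo (g x) (l / 2) \<xi>'" using geo_restrict \<xi>(1) \<xi>' l by auto
    have mid: "\<xi>' (l / 2) = \<xi> (l / 2)" by (simp add: \<xi>'_def)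
    show "eventually (\<lambda>t. dist (\<eta> t) (g (\<eta> t)) \<le> dist x (g x) + t * ((2 * L * dist x (g x) + e) / D + e)) (at_right 0)"
      using first_variation_upper[OF \<eta>(1) half(1) \<mu>(4)] first_variation_upper[OF g\<eta> half(2) \<mu>(4)]
        eventually_at_right_less[of "0::real"]
    proof eventually_elim
      case (elim t)
      have "dist (\<eta> t) (g (\<eta> t)) \<le> dist (\<xi> (l / 2)) (\<eta> t) + dist (\<xi> (l / 2)) (g (\<eta> t))"
        by (rule dist_triangle_base)
      also have "\<dots> \<le> l - t * ((cos_angle \<eta> \<xi> - \<tau>) + (cos_angle (g \<circ> \<eta>) \<xi>' - \<tau>))"
        using elim(1,2) unfolding mid distrib_left o_apply by linarith
      also have "\<dots> \<le> l + t * ((2 * L * l + e) / D + e)"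
      proof -
        have "t * (- ((2 * L * l + e) / D + e))
            \<le> t * ((cos_angle \<eta> \<xi> - \<tau>) + (cos_angle (g \<circ> \<eta>) \<xi>' - \<tau>))"
          using cc elim(3) by (intro mult_left_mono) auto
        then show ?thesis unfolding mult_minus_right by linarith
      qed
      finally show ?case by (simp add: l_def)
    qed
  qed
qed

section \<open>Fixed points near a foot point\<close>

text \<open>A penalised minimisation replaces following the gradient curve of \<open>dist r\<close> from \<open>p\<close>: for large
  \<open>M\<close>, a minimiser of \<open>M * (dist x (g x))\<^sup>2 + dist q x + (a / 4) * dist p x\<close> on a small ball
  cannot be an interior point, because a gradient step would decrease the value.\<close>

lemma penalized_minimum_on_sphere:
  assumes iso: "\<And>x y. dist (g x) (g y) = dist (x::'a) y" and surj: "surj g" and gp: "g p = p" and gr: "g r = r"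
    and sc: "semiconcave_on (ball p \<rho>') L (dist r)" and L: "0 \<le> L"
    and a: "0 < a" "a \<le> 1" and s: "0 < s" "s \<le> \<rho>' / 4" "L * s \<le> a / 16" "s \<le> 1"
    and \<rho>: "\<rho> = a * s / 16"
    and q: "dist p q = s" "dist r p + a * s \<le> dist r q" and M: "0 < M"
    and x: "x \<in> cball p \<rho>" and min: "\<And>y. y \<in> cball p \<rho> \<Longrightarrow>
      M * (dist x (g x))\<^sup>2 + dist q x + a / 4 * dist p x \<le> M * (dist y (g y))\<^sup>2 + dist q y + a / 4 * dist p y"
  shows "dist p x = \<rho>"
proof (rule ccontr)
  assume "dist p x \<noteq> \<rho>"
  then have px: "dist p x < \<rho>" using x by simp
  have as: "a * s \<le> s" using a s by (simp add: mult_left_le_one_le)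
  have "0 < a * s" using a s by simp
  then have \<rho>s: "0 < \<rho>" "\<rho> \<le> s / 16" using as \<rho> by auto
  define l where "l = dist x (g x)"
  have gpx: "dist p (g x) = dist p x" using iso[of p x] gp by simp
  have l: "0 \<le> l" "l \<le> 2 * \<rho>" using dist_triangle_base[of x "g x" p] gpx px by (auto simp: l_def)
  have sub: "ball y (\<rho>' / 2) \<subseteq> ball p \<rho>'" if "dist p y < \<rho>" for y
  proof
    fix z assume "z \<in> ball y (\<rho>' / 2)"
    then show "z \<in> ball p \<rho>'" using dist_triangle[of p z y] that \<rho>s s by simp
  qed
  have sc': "semiconcave_on (ball x (\<rho>' / 2)) L (dist r)" "semiconcave_on (ball (g x) (\<rho>' / 2)) L (dist r)"
    using semiconcave_on_subset[OF sc sub] px gpx by auto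
  have xq: "dist x q \<le> s + \<rho>" "15 / 16 * s \<le> dist x q"
    using dist_triangle_base[of x q p] dist_triangle[of p q x] px q \<rho>s by auto
  \<comment> \<open>Comparison with the fixed point \<open>p\<close>, where the penalty
    vanishes.\<close>
  have M2: "M * l\<^sup>2 \<le> \<rho>"
  proof -
    have "M * l\<^sup>2 + dist q x + a / 4 * dist p x \<le> dist q p"
      using min[of p] gp \<rho>s by (simp add: l_def)
    moreover have "dist q p \<le> dist q x + dist p x" using dist_triangle[of q p x] by (simp add: dist_commute)
    moreover have "0 \<le> a / 4 * dist p x" using a by simp
    ultimately show ?thesis using px by linarith
  qed
  have D: "3 / 4 * a \<le> (dist r q - dist r x) / dist x q - L * dist x q"
  proof -
    have "dist r x \<le> dist r p + dist p x" by (rule dist_triangle)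
    then have "15 / 16 * (a * s) \<le> dist r q - dist r x" using q(2) px \<rho> by linarith
    moreover have "15 / 17 * a * dist x q \<le> 15 / 17 * a * (17 / 16 * s)"
      using xq \<rho>s a by (intro mult_left_mono) auto
    ultimately have "15 / 17 * a * dist x q \<le> dist r q - dist r x" by simp
    then have 1: "15 / 17 * a \<le> (dist r q - dist r x) / dist x q"
      using xq s by (subst pos_le_divide_eq) auto
    have "L * dist x q \<le> L * (17 / 16 * s)" using xq \<rho>s L by (intro mult_left_mono) auto
    then have "L * dist x q \<le> 17 / 16 * (a / 16)" using s(3) by linarith
    then show ?thesis using 1 a by linarith
  qed
  define e where "e = min (a / 16) (a\<^sup>2 / (256 * M))"
  have e: "0 < e" "e \<le> a / 16" "e \<le> a\<^sup>2 / (256 * M)" using a M by (auto simp: e_def)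
  have Me: "M * e \<le> a\<^sup>2 / 256"
  proof -
    have "M * e \<le> M * (a\<^sup>2 / (256 * M))" using e M by (intro mult_left_mono) auto
    then show ?thesis using M by simp
  qed
  have qx: "q \<in> ball x (\<rho>' / 2)" "q \<noteq> x" using xq \<rho>s s by auto
  have gx: "dist x (g x) < \<rho>' / 2" using l \<rho>s s by (simp add: l_def)
  obtain T \<eta> where \<eta>: "geo x T \<eta>"
    and dq: "eventually (\<lambda>t. dist q (\<eta> t) \<le> dist q x - t * (3 / 4 * a - e)) (at_right 0)"
    and dl: "x \<noteq> g x \<Longrightarrow> eventually (\<lambda>t. dist (\<eta> t) (g (\<eta> t)) \<le> l + t * ((2 * L * l + e) / (3 / 4 * a) + e)) (at_right 0)"
    unfolding l_def
    using gradient_step[OF iso surj gr sc' L qx gx D e(1)] e(2) a by auto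
  define E where "E = (2 * L * l + e) / (3 / 4 * a) + e"
  have E0: "0 \<le> E" using L l e a by (simp add: E_def)
  \<comment> \<open>The penalty grows at the rate \<open>2 * M * l * E\<close>. Up to factors
    bounded by \<open>L\<close> and \<open>a\<close>, only \<open>M * l\<^sup>2\<close> and
    \<open>M * e * l\<close> enter, and both are bounded independently of \<open>M\<close>.\<close>
  have lE: "2 * M * l * E \<le> a / 8"
  proof -
    have a2: "a * a \<le> a" using a by (simp add: mult_left_le)
    have "L * (M * l\<^sup>2) \<le> L * \<rho>" using M2 L by (rule mult_left_mono)
    also have "\<dots> = (L * s) * (a / 16)" by (simp add: \<rho>)
    also have "\<dots> \<le> (a / 16) * (a / 16)" using s(3) a by (intro mult_right_mono) auto
    finally have 1: "L * (M * l\<^sup>2) \<le> a * a / 256" by simp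
    have l1: "l \<le> 1 / 8" using l \<rho>s s by linarith
    have "(M * e) * l \<le> (a\<^sup>2 / 256) * (1 / 8)" using Me l1 l by (intro mult_mono) auto
    then have 2: "M * e * l \<le> a * a / 2048" by (simp add: power2_eq_square)
    have "2 * M * l * E * (3 / 4 * a) = 4 * (L * (M * l\<^sup>2)) + 2 * (M * e * l) + (2 * (M * e * l)) * (3 / 4 * a)"
      using a by (simp add: E_def field_simps power2_eq_square)
    also have "\<dots> \<le> 4 * (a * a / 256) + 2 * (a * a / 2048) + (2 * (a * a / 2048)) * 1"
    proof -
      have "(2 * (M * e * l)) * (3 / 4 * a) \<le> (2 * (a * a / 2048)) * 1"
        by (rule mult_mono) (use 2 a in auto)
      then show ?thesis using 1 2 by linarith
    qed
    also have "\<dots> \<le> (a / 8) * (3 / 4 * a)" by simp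
    finally show ?thesis using a by (intro mult_right_le_imp_le[of "2 * M * l * E" "3 / 4 * a" "a / 8"]) auto
  qed
  have "\<exists>b. eventually (\<lambda>t. M * (dist (\<eta> t) (g (\<eta> t)))\<^sup>2 \<le> M * l\<^sup>2 + t * (a / 8) + b * t\<^sup>2) (at_right 0)"
  proof (cases "x = g x")
    case False
    have "eventually (\<lambda>t. M * (dist (\<eta> t) (g (\<eta> t)))\<^sup>2 \<le> M * l\<^sup>2 + t * (a / 8) + (M * E\<^sup>2) * t\<^sup>2) (at_right 0)"
      using dl[OF False] eventually_at_right_less[of "0::real"]
    proof eventually_elim
      case (elim t)
      then have "dist (\<eta> t) (g (\<eta> t)) \<le> l + t * E" by (simp add: E_def)
      then have "(dist (\<eta> t) (g (\<eta> t)))\<^sup>2 \<le> (l + t * E)\<^sup>2" by (intro power_mono) auto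
      then have "M * (dist (\<eta> t) (g (\<eta> t)))\<^sup>2 \<le> M * (l + t * E)\<^sup>2" using M by simp
      also have "\<dots> = M * l\<^sup>2 + t * (2 * M * l * E) + (M * E\<^sup>2) * t\<^sup>2"
        by (simp add: power2_eq_square algebra_simps)
      also have "t * (2 * M * l * E) \<le> t * (a / 8)" using lE elim by (intro mult_left_mono) auto
      finally show ?case by simp
    qed
    then show ?thesis by blast
  next
    \<comment> \<open>At a fixed \<open>x\<close> the displacement is at most \<open>2 * t\<close>,
      so the penalty is of second order.\<close>
    case True
    have "eventually (\<lambda>t. M * (dist (\<eta> t) (g (\<eta> t)))\<^sup>2 \<le> M * l\<^sup>2 + t * (a / 8) + (4 * M) * t\<^sup>2) (at_right 0)"
      using eventually_at_right_real[OF geo_pos[OF \<eta>]]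
    proof eventually_elim
      case (elim t)
      then have "dist x (\<eta> t) = t" using geo_dist0[OF \<eta>] by auto
      moreover have "dist x (g (\<eta> t)) = dist x (\<eta> t)" using iso[of x "\<eta> t"] True by simp
      ultimately have "dist (\<eta> t) (g (\<eta> t)) \<le> 2 * t" using dist_triangle_base[of "\<eta> t" "g (\<eta> t)" x] by simp
      then have "(dist (\<eta> t) (g (\<eta> t)))\<^sup>2 \<le> (2 * t)\<^sup>2" by (intro power_mono) auto
      then have "M * (dist (\<eta> t) (g (\<eta> t)))\<^sup>2 \<le> M * (2 * t)\<^sup>2" using M by simp
      moreover have "0 \<le> M * l\<^sup>2 + t * (a / 8)" using M a elim by simp
      ultimately show ?case by simp
    qed
    then show ?thesis by blast
  qed
  then obtain b where b: "eventually (\<lambda>t. M * (dist (\<eta> t) (g (\<eta> t)))\<^sup>2 \<le> M * l\<^sup>2 + t * (a / 8) + b * t\<^sup>2) (at_right 0)"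
    by blast
  have "((\<lambda>t::real. b * t) \<longlongrightarrow> b * 0) (at_right 0)" by (intro tendsto_intros)
  then have "eventually (\<lambda>t::real. b * t < a / 16) (at_right 0)" using a by (intro order_tendstoD(2)) auto
  moreover have "0 < min T (\<rho> - dist p x)" using geo_pos[OF \<eta>] px by simp
  note eventually_at_right_real[OF this]
  \<comment> \<open>The step gains \<open>3 / 4 * a\<close> in \<open>dist q\<close>; against it
    stand \<open>e \<le> a / 16\<close>, the penalty with \<open>a / 8 + a / 16\<close>, and
    \<open>a / 4\<close> from the last term, in all \<open>a / 2\<close>.\<close>
  ultimately have "eventually (\<lambda>t::real. False) (at_right 0)"
    using dq b
  proof eventually_elim
    case (elim t)
    then have t: "0 < t" "t \<le> T" "t < \<rho> - dist p x" by auto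
    have "dist x (\<eta> t) = t" using geo_dist0[OF \<eta>] t by auto
    then have p\<eta>: "dist p (\<eta> t) \<le> dist p x + t" using dist_triangle[of p "\<eta> t" x] by simp
    then have "\<eta> t \<in> cball p \<rho>" using t by simp
    then have "M * l\<^sup>2 + dist q x + a / 4 * dist p x
        \<le> M * (dist (\<eta> t) (g (\<eta> t)))\<^sup>2 + dist q (\<eta> t) + a / 4 * dist p (\<eta> t)"
      using min by (simp add: l_def)
    moreover have "a / 4 * dist p (\<eta> t) \<le> a / 4 * (dist p x + t)" using p\<eta> a by (intro mult_left_mono) auto
    moreover have "b * t\<^sup>2 \<le> t * (a / 16)"
      using mult_left_mono[of "b * t" "a / 16" t] elim t by (simp add: power2_eq_square mult_ac)
    moreover have "t * e \<le> t * (a / 16)" using e t by (intro mult_left_mono) auto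
    moreover have "0 < t * a" using t a by simp
    ultimately show ?case using elim by (simp add: algebra_simps)
  qed
  then show False by simp
qed

text \<open>Growing weights force the displacement of the minimisers to 0, so a limit point is
  fixed. As the minimisers lie on the sphere, the term \<open>a / 4 * dist p x\<close> is a definite
  gain \<open>a / 4 * \<rho>\<close>, which survives in the limit and makes the inequality
  strict.\<close>

lemma closer_fixed_point:
  assumes iso: "\<And>x y. dist (g x) (g y) = dist (x::'a) y" and surj: "surj g" and gp: "g p = p" and gr: "g r = r"
    and pr: "p \<noteq> r" and \<gamma>: "geo p T \<gamma>" and a: "0 < a" "a \<le> 1"
    and slope: "eventually (\<lambda>t. dist r p + a * t \<le> dist r (\<gamma> t)) (at_right 0)"
  obtains s x where "0 < s" "s \<le> T" "g x = x" "dist (\<gamma> s) x < s"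
proof -
  obtain \<rho>' L where \<rho>': "\<rho>' > 0" "0 \<le> L" "semiconcave_on (ball p \<rho>') L (dist r)"
    by (rule dist_semiconcave[OF pr])
  obtain d where d: "d > 0" "\<And>t. 0 < t \<Longrightarrow> t < d \<Longrightarrow> dist r p + a * t \<le> dist r (\<gamma> t)"
    using slope unfolding eventually_at_right_field by auto
  define s where "s = Min {d / 2, T, \<rho>' / 4, 1, a / (16 * (L + 1))}"
  have "s \<le> d / 2" "s \<le> T" "s \<le> \<rho>' / 4" "s \<le> 1" "s \<le> a / (16 * (L + 1))"
    unfolding s_def by (rule Min_le; simp)+
  moreover have "0 < s" using d geo_pos[OF \<gamma>] \<rho>' a by (auto simp: s_def)
  ultimately have s: "0 < s" "s \<le> d / 2" "s \<le> T" "s \<le> \<rho>' / 4" "s \<le> 1" "s \<le> a / (16 * (L + 1))"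
    by auto
  have Ls: "L * s \<le> a / 16"
  proof -
    have "L * s \<le> (L + 1) * s" using s by simp
    also have "\<dots> \<le> a / 16" using s(6) \<rho>'(2) by (simp add: field_simps)
    finally show ?thesis .
  qed
  define q where "q = \<gamma> s"
  have pq: "dist p q = s" using geo_dist0[OF \<gamma>] s by (simp add: q_def)
  have rq: "dist r p + a * s \<le> dist r q" using d s by (simp add: q_def)
  define \<rho> where "\<rho> = a * s / 16"
  have \<rho>: "0 < \<rho>" using a s by (simp add: \<rho>_def)
  define \<Psi> where "\<Psi> M x = M * (dist x (g x))\<^sup>2 + dist q x + a / 4 * dist p x" for M x
  have contg: "continuous_on S g" for S
    by (rule continuous_onI) (use iso in force)
  have "\<exists>x\<in>cball p \<rho>. \<forall>y\<in>cball p \<rho>. \<Psi> (real (Suc n)) x \<le> \<Psi> (real (Suc n)) y" for n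
    unfolding \<Psi>_def using \<rho>
    by (intro continuous_attains_inf proper continuous_intros contg) auto
  then obtain x where x: "\<And>n. x n \<in> cball p \<rho>" "\<And>n y. y \<in> cball p \<rho> \<Longrightarrow> \<Psi> (real (Suc n)) (x n) \<le> \<Psi> (real (Suc n)) y"
    by metis
  have px: "dist p (x n) = \<rho>" for n
    by (rule penalized_minimum_on_sphere[where M = "real (Suc n)", OF iso surj gp gr \<rho>'(3,2) a s(1,4) Ls s(5) \<rho>_def pq rq])
      (use x(1) x(2)[of _ n] in \<open>auto simp: \<Psi>_def\<close>)
  have le: "real (Suc n) * (dist (x n) (g (x n)))\<^sup>2 + dist q (x n) + a / 4 * \<rho> \<le> s" for n
    using x(2)[of p n] px[of n] gp pq \<rho> by (simp add: \<Psi>_def dist_commute)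
  obtain y \<phi> where y: "strict_mono (\<phi> :: nat \<Rightarrow> nat)" "(x \<circ> \<phi>) \<longlonglongrightarrow> y"
    using proper[of p \<rho>] x(1) unfolding compact_def by metis
  have gy: "((\<lambda>n. g ((x \<circ> \<phi>) n)) \<longlonglongrightarrow> g y)"
    by (rule continuous_on_tendsto_compose[OF contg[of UNIV] y(2)]) auto
  have "(dist (x n) (g (x n)))\<^sup>2 \<le> s * (1 / real (Suc n))" for n
  proof -
    have "0 \<le> a / 4 * \<rho>" using a \<rho> by simp
    then have "real (Suc n) * (dist (x n) (g (x n)))\<^sup>2 \<le> s" using le[of n] zero_le_dist[of q "x n"] by linarith
    then show ?thesis by (simp add: field_simps)
  qed
  then have bnd: "(dist ((x \<circ> \<phi>) n) (g ((x \<circ> \<phi>) n)))\<^sup>2 \<le> s * (1 / real (Suc (\<phi> n)))" for n by simp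
  have "(\<lambda>n. s * (1 / real (Suc (\<phi> n)))) \<longlonglongrightarrow> s * 0"
    using LIMSEQ_subseq_LIMSEQ[OF LIMSEQ_Suc[OF lim_1_over_n] y(1)]
    by (intro tendsto_mult tendsto_const) (simp add: o_def)
  then have lim: "(\<lambda>n. s * (1 / real (Suc (\<phi> n)))) \<longlonglongrightarrow> 0" by (simp only: mult_zero_right)
  have "(\<lambda>n. (dist ((x \<circ> \<phi>) n) (g ((x \<circ> \<phi>) n)))\<^sup>2) \<longlonglongrightarrow> 0"
    by (rule tendsto_sandwich[OF _ _ tendsto_const lim]; intro always_eventually allI zero_le_power2 bnd)
  moreover have "(\<lambda>n. (dist ((x \<circ> \<phi>) n) (g ((x \<circ> \<phi>) n)))\<^sup>2) \<longlonglongrightarrow> (dist y (g y))\<^sup>2"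
    by (intro tendsto_intros y(2) gy)
  ultimately have "(dist y (g y))\<^sup>2 = 0" using LIMSEQ_unique by blast
  then have fix_y: "g y = y" by simp
  have "dist q y \<le> s - a / 4 * \<rho>"
  proof (rule LIMSEQ_le_const2)
    show "(\<lambda>n. dist q ((x \<circ> \<phi>) n)) \<longlonglongrightarrow> dist q y" by (intro tendsto_intros y(2))
    have "dist q (x n) \<le> s - a / 4 * \<rho>" for n
      using le[of n] zero_le_power2[of "dist (x n) (g (x n))"]
      by (smt (verit) mult_nonneg_nonneg of_nat_0_le_iff)
    then show "\<exists>N. \<forall>n\<ge>N. dist q ((x \<circ> \<phi>) n) \<le> s - a / 4 * \<rho>" by simp
  qed
  moreover have "0 < a / 4 * \<rho>" using a \<rho> by simp
  ultimately have "dist (\<gamma> s) y < s" unfolding q_def by linarith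
  then show thesis using that s fix_y by blast
qed

theorem fixed_points_quasi_convex:
  assumes iso: "\<And>x y. dist (g x) (g y) = dist (x::'a) y" and surj: "surj g"
  shows "quasi_convex {x. g x = x}"
  unfolding quasi_convex_def
proof (intro conjI allI impI ballI)
  have "continuous_on UNIV g" by (rule continuous_onI) (use iso in force)
  then show "closed {x. g x = x}" by (intro closed_Collect_eq continuous_on_id)
next
  fix q p r
  assume q: "q \<notin> {x. g x = x}" and p: "p \<in> {x. g x = x}" and near: "\<forall>x\<in>{x. g x = x}. dist q p \<le> dist q x"
    and r: "r \<in> {x. g x = x} - {p}"
  have gp: "g p = p" and gr: "g r = r" and pr: "p \<noteq> r" and pq: "p \<noteq> q" using p q r by auto
  show "direction_setdist (directions_to p q) (directions_to p r) \<le> ereal (pi / 2)"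
  proof (rule ccontr)
    assume "\<not> ?thesis"
    then have "ereal (pi / 2) < direction_setdist (directions_to p q) (directions_to p r)" by simp
    \<comment> \<open>A number strictly in between gives one bound \<open>cos b < 0\<close> for all
      geodesics to \<open>r\<close>, as \<open>first_variation_lower\<close> demands; half of
      \<open>- cos b\<close> is later spent on its error.\<close>
    then obtain b where b: "ereal (pi / 2) < ereal b"
      "ereal b < direction_setdist (directions_to p q) (directions_to p r)"
      using ereal_dense2 by blast
    obtain \<gamma> where \<gamma>: "minimal_geodesic p q \<gamma>" using geodesic_exists by blast
    note g\<gamma> = geo_minimal[OF \<gamma> pq]
    have angle: "b \<le> geodesic_angle \<gamma> \<sigma>" if "minimal_geodesic p r \<sigma>" for \<sigma>
      using direction_setdist_le[OF \<gamma> pq that pr] b(2) by (metis ereal_less_eq(3) less_imp_le order_trans)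
    have bpi: "pi / 2 < b" "b \<le> pi"
    proof -
      show "pi / 2 < b" using b by simp
      obtain \<sigma> where \<sigma>: "minimal_geodesic p r \<sigma>" using geodesic_exists by blast
      show "b \<le> pi" using angle[OF \<sigma>] geodesic_angle_le_pi[OF g\<gamma> geo_minimal[OF \<sigma> pr]] by linarith
    qed
    have cosb: "cos b < 0" using bpi cos_monotone_0_pi[of "pi / 2" b] by simp
    have "cos_angle \<gamma> \<sigma> \<le> cos b" if "minimal_geodesic p r \<sigma>" for \<sigma>
      using angle[OF that] geodesic_angle_le_pi[OF g\<gamma> geo_minimal[OF that pr]] bpi
      by (intro cos_monotone_0_pi_le) auto
    then have "eventually (\<lambda>t. dist r p - t * (cos b + (- cos b / 2)) \<le> dist r (\<gamma> t)) (at_right 0)"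
      using cosb by (intro first_variation_lower[OF g\<gamma> pr]) auto
    then have ev: "eventually (\<lambda>t. dist r p + (- cos b / 2) * t \<le> dist r (\<gamma> t)) (at_right 0)"
      by (simp add: mult.commute)
    have "0 < - cos b / 2" "- cos b / 2 \<le> 1" using cosb cos_ge_minus_one[of b] by linarith+
    from closer_fixed_point[OF iso surj gp gr pr g\<gamma> this ev]
    obtain s x where sx: "0 < s" "s \<le> dist p q" "g x = x" "dist (\<gamma> s) x < s" by blast
    have "dist q (\<gamma> s) = dist p q - s"
      using geo_dist[OF g\<gamma>, of "dist p q" s] \<gamma> sx by (simp add: minimal_geodesic_def)
    then have "dist q x < dist q p" using dist_triangle[of q x "\<gamma> s"] sx by (simp add: dist_commute)
    then show False using near sx(3) by force
  qed
qed

end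

section \<open>Alexandrov spaces satisfy the assumptions of the locale\<close>

lemma Alex_locally_compact:
  fixes p :: "'a::metric_space"
  assumes "Alex k TYPE('a)"
  shows "\<exists>r>0. compact (cball p r)"
proof (rule ccontr)
  assume nc: "\<not> ?thesis"
  have A: "complete (UNIV :: 'a set)" "intrinsic_metric TYPE('a)" "curvature_ge k TYPE('a)"
    "hausdorff_dim (UNIV :: 'a set) < \<infinity>"
    using assms by (auto simp: Alex_def)
  obtain \<kappa> r where \<kappa>: "\<kappa> > 0" "r > 0" "\<kappa> * (2 * r) \<le> 1" "quad_cond \<kappa> (ball p r)"
    using curvature_ge_quad_cond[OF A(3)] by metis
  define R0 where "R0 = r / 8"
  have R0: "R0 > 0" "8 * R0 \<le> r" using \<kappa> by (auto simp: R0_def)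
  have "\<not> compact (cball p R0)" using nc R0 by blast
  then obtain \<epsilon> X where X: "\<epsilon> > 0" "infinite X" "X \<subseteq> cball p R0" "\<And>u v. u \<in> X \<Longrightarrow> v \<in> X \<Longrightarrow> u \<noteq> v \<Longrightarrow> \<epsilon> \<le> dist u v"
    using not_compact_cball_separated[OF A(1)] by metis
  have \<epsilon>: "\<epsilon> \<le> 2 * R0"
  proof -
    obtain u where u: "u \<in> X" using X(2) by (metis finite.emptyI ex_in_conv)
    obtain v where v: "v \<in> X" "v \<noteq> u" using X(2) by (metis finite.emptyI finite.insertI finite_subset insertCI subsetI)
    show ?thesis using X(4)[OF v(1) u v(2)] subsetD[OF X(3) u] subsetD[OF X(3) v(1)] dist_triangle_base[of v u p] by simp
  qed
  have "hausdorff_dim (UNIV :: 'a set) = \<infinity>"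
  proof (rule hausdorff_dim_eq_top_if_packing[OF A(1) _ _ R0(1)])
    show "0 < \<epsilon> / (128 * R0)" "\<epsilon> / (128 * R0) \<le> 1 / 2" using X(1) R0 \<epsilon> by (auto simp: field_simps)
  qed (rule quad_cond_packing[OF A(2) \<kappa>(4,1,3) R0 X])
  then show False using A(4) by simp
qed

lemma Alex_stewart_space:
  assumes "Alex k TYPE('a::metric_space)"
  obtains C where "stewart_space TYPE('a) C"
proof -
  have A: "complete (UNIV :: 'a set)" "intrinsic_metric TYPE('a)" "curvature_ge k TYPE('a)"
    using assms by (auto simp: Alex_def)
  obtain \<kappa> where \<kappa>: "\<kappa> > 0" "\<And>p::'a. \<exists>r>0. \<kappa> * (2 * r) \<le> 1 \<and> quad_cond \<kappa> (ball p r)"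
    using curvature_ge_quad_cond[OF A(3)] by metis
  have proper: "compact (cball (x::'a) R)" for x R
    by (rule hopf_rinow_proper[OF A(2,1) Alex_locally_compact[OF assms]])
  have "stewart_space TYPE('a) (12 * \<kappa>\<^sup>2)"
  proof
    show "\<exists>\<gamma>. minimal_geodesic x y \<gamma>" for x y :: 'a
      using exists_minimal_geodesic[OF A(2) proper] by blast
    fix p :: 'a
    obtain r where "r > 0" "\<kappa> * (2 * r) \<le> 1" "quad_cond \<kappa> (ball p r)" using \<kappa>(2) by blast
    then show "\<exists>r>0. stewart_on (12 * \<kappa>\<^sup>2) (ball p r)" using stewart_of_quad_cond[OF _ \<kappa>(1)] by blast
  qed (use proper in auto)
  then show thesis by (rule that)
qed

theorem proposition4p9:
  fixes k :: real and g :: "'a::metric_space \<Rightarrow> 'a"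
  assumes "Alex k TYPE('a)"
    and "surj g"
    and "\<forall>x y. dist (g x) (g y) = dist x y"
  shows "quasi_convex {x. g x = x}"
proof -
  obtain C where "stewart_space TYPE('a) C" using Alex_stewart_space[OF assms(1)] .
  then show ?thesis using assms(2,3) by (intro stewart_space.fixed_points_quasi_convex) auto
qed

end
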